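(* Let $A$ be the simple bipartite graph whose vertices are the twelve major triads and the twelve minor triads in $\mathbb{Z}/12$, a major triad and a minor triad being joined by an edge if and only if they have exactly one pitch class in common. Then $A$ is regular of degree three and has exactly two connected components, each containing six major triads and six minor triads. Each component has girth four, and hence is not the Levi graph of a combinatorial configuration. Each component can be unfolded to the infinite graph of the Archimedean (semi-regular) tessellation of the Euclidean plane of type $\{4,6,12\}$: there is a covering map of graphs from the vertex-edge graph of this tessellation onto the component.
   Context: Pitch classes are identified with elements of $\mathbb{Z}/12$ ($C=0$, $C_\sharp=D_\flat=1,\dots,B=11$). For $x\in\mathbb{Z}/12$ the major triad with root $x$ is the set $\{x,x+4,x+7\}$ and the minor triad with root $x$ is the set $\{x,x+3,x+7\}$. The girth of a graph is the length of its shortest cycle. A combinatorial configuration consists of finite disjoint sets of points and lines with an incidence relation such that two distinct lines share at most one point, two distinct points lie on at most one common line, all lines have the same number of points, and all points lie on the same number of lines; its Levi graph is the bipartite graph with points and lines as the two vertex classes and incidences as edges. The Archimedean tessellation of type $\{4,6,12\}$ is the edge-to-edge tiling of the Euclidean plane by regular squares, hexagons and dodecagons of equal side length in which exactly one square, one hexagon and one dodecagon meet at every vertex. A covering map of graphs $\widetilde{G}\to G$ is a surjective graph homomorphism which, for each vertex $v$ of $\widetilde{G}$, maps the set of edges at $v$ bijectively onto the set of edges at the image of $v$. *)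

theory Defs
  imports "HOL-Analysis.Analysis" "HOL-Library.Extended_Nat"
begin

section \<open>Undirected graphs\<close>

record 'a graph =
  verts :: "'a set"
  edges :: "'a set set"

definition simple_graph :: "'a graph \<Rightarrow> bool" where
  "simple_graph G \<longleftrightarrow> (\<forall>e\<in>edges G. e \<subseteq> verts G \<and> card e = 2)"

definition bipartite_with :: "'a graph \<Rightarrow> 'a set \<Rightarrow> 'a set \<Rightarrow> bool" where
  "bipartite_with G X Y \<longleftrightarrow>
     verts G = X \<union> Y \<and> X \<inter> Y = {} \<and> (\<forall>e\<in>edges G. \<exists>x\<in>X. \<exists>y\<in>Y. e = {x, y})"

definition edges_at :: "'a graph \<Rightarrow> 'a \<Rightarrow> 'a set set" where
  "edges_at G v = {e \<in> edges G. v \<in> e}"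

definition regular_of_degree :: "'a graph \<Rightarrow> nat \<Rightarrow> bool" where
  "regular_of_degree G d \<longleftrightarrow> (\<forall>v\<in>verts G. finite (edges_at G v) \<and> card (edges_at G v) = d)"

definition reachable :: "'a graph \<Rightarrow> 'a \<Rightarrow> 'a \<Rightarrow> bool" where
  "reachable G = (\<lambda>u v. {u, v} \<in> edges G)\<^sup>*\<^sup>*"

definition induced_subgraph :: "'a graph \<Rightarrow> 'a set \<Rightarrow> 'a graph" where
  "induced_subgraph G W = \<lparr>verts = W, edges = {e \<in> edges G. e \<subseteq> W}\<rparr>"

definition components_of :: "'a graph \<Rightarrow> 'a graph set" where
  "components_of G = (\<lambda>v. induced_subgraph G {w \<in> verts G. reachable G v w}) ` verts G"

definition is_cycle :: "'a graph \<Rightarrow> 'a list \<Rightarrow> bool" where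
  "is_cycle G c \<longleftrightarrow>
     3 \<le> length c \<and> distinct c \<and> set c \<subseteq> verts G \<and>
     (\<forall>i<length c. {c ! i, c ! (Suc i mod length c)} \<in> edges G)"

text \<open>The girth of an acyclic graph is \<open>\<infinity>\<close>.\<close>

definition girth :: "'a graph \<Rightarrow> enat" where
  "girth G = (INF c\<in>{c. is_cycle G c}. enat (length c))"

definition covering_map :: "('a \<Rightarrow> 'b) \<Rightarrow> 'a graph \<Rightarrow> 'b graph \<Rightarrow> bool" where
  "covering_map f G H \<longleftrightarrow>
     f ` verts G = verts H \<and>
     (`) f ` edges G = edges H \<and>
     (\<forall>v\<in>verts G. bij_betw ((`) f) (edges_at G v) (edges_at H (f v)))"


section \<open>Combinatorial configurations and Levi graphs\<close>

definition configuration :: "'a set \<Rightarrow> 'a set \<Rightarrow> ('a \<times> 'a) set \<Rightarrow> bool" where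
  "configuration P L I \<longleftrightarrow>
     finite P \<and> finite L \<and> P \<inter> L = {} \<and> I \<subseteq> P \<times> L \<and>
     (\<forall>l\<in>L. \<forall>m\<in>L. l \<noteq> m \<longrightarrow> card {p \<in> P. (p, l) \<in> I \<and> (p, m) \<in> I} \<le> 1) \<and>
     (\<forall>p\<in>P. \<forall>q\<in>P. p \<noteq> q \<longrightarrow> card {l \<in> L. (p, l) \<in> I \<and> (q, l) \<in> I} \<le> 1) \<and>
     (\<exists>k. \<forall>l\<in>L. card {p \<in> P. (p, l) \<in> I} = k) \<and>
     (\<exists>r. \<forall>p\<in>P. card {l \<in> L. (p, l) \<in> I} = r)"

definition levi_graph :: "'a set \<Rightarrow> 'a set \<Rightarrow> ('a \<times> 'a) set \<Rightarrow> 'a graph" where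
  "levi_graph P L I = \<lparr>verts = P \<union> L, edges = {{p, l} | p l. (p, l) \<in> I}\<rparr>"

text \<open>Points and lines may be arbitrary objects, so being isomorphic to a Levi graph is the same
  as being equal to one: rename the points and lines to the vertices representing them.\<close>

definition is_levi_graph :: "'a graph \<Rightarrow> bool" where
  "is_levi_graph G \<longleftrightarrow> (\<exists>P L I. configuration P L I \<and> G = levi_graph P L I)"


section \<open>Triads\<close>

text \<open>The numeral type \<open>12\<close> with its ring structure is \<open>\<int>/12\<close>.\<close>

type_synonym pitch_class = 12

definition major_triad :: "pitch_class \<Rightarrow> pitch_class set" where
  "major_triad x = {x, x + 4, x + 7}"

definition minor_triad :: "pitch_class \<Rightarrow> pitch_class set" where
  "minor_triad x = {x, x + 3, x + 7}"

definition major_triads :: "pitch_class set set" where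
  "major_triads = range major_triad"

definition minor_triads :: "pitch_class set set" where
  "minor_triads = range minor_triad"

definition triad_graph :: "pitch_class set graph" where
  "triad_graph = \<lparr>verts = major_triads \<union> minor_triads,
     edges = {{M, m} | M m. M \<in> major_triads \<and> m \<in> minor_triads \<and> card (M \<inter> m) = 1}\<rparr>"


section \<open>Tilings of the Euclidean plane\<close>

text \<open>The Euclidean plane is \<open>\<complex>\<close>. A filled regular \<open>n\<close>-gon with circumradius \<open>r\<close> has sides of
  length \<open>2 r sin (\<pi>/n)\<close>.\<close>

definition regular_polygon :: "nat \<Rightarrow> real \<Rightarrow> complex set \<Rightarrow> bool" where
  "regular_polygon n s P \<longleftrightarrow>
     (\<exists>c r \<theta>. r > 0 \<and> s = 2 * r * sin (pi / real n) \<and>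
        P = convex hull ((\<lambda>k. c + complex_of_real r * cis (\<theta> + 2 * pi * real k / real n)) ` {..<n}))"

definition plane_tiling :: "complex set set \<Rightarrow> bool" where
  "plane_tiling T \<longleftrightarrow>
     \<Union>T = UNIV \<and> (\<forall>P\<in>T. \<forall>Q\<in>T. P \<noteq> Q \<longrightarrow> interior P \<inter> interior Q = {})"

text \<open>The faces of a convex polygon are the empty set, its vertices, its edges and the polygon
  itself; the last case is excluded below for distinct tiles with disjoint interiors.\<close>

definition edge_to_edge :: "complex set set \<Rightarrow> bool" where
  "edge_to_edge T \<longleftrightarrow>
     (\<forall>P\<in>T. \<forall>Q\<in>T. P \<noteq> Q \<longrightarrow> (P \<inter> Q) face_of P \<and> (P \<inter> Q) face_of Q)"

definition tiling_vertices :: "complex set set \<Rightarrow> complex set" where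
  "tiling_vertices T = {v. \<exists>P\<in>T. v extreme_point_of P}"

definition tiling_graph :: "complex set set \<Rightarrow> complex graph" where
  "tiling_graph T = \<lparr>verts = tiling_vertices T,
     edges = {{v, w} | v w. v \<noteq> w \<and> (\<exists>P\<in>T. closed_segment v w edge_of P)}\<rparr>"

definition archimedean_4_6_12 :: "complex set set \<Rightarrow> bool" where
  "archimedean_4_6_12 T \<longleftrightarrow>
     plane_tiling T \<and> edge_to_edge T \<and>
     (\<exists>s. (\<forall>P\<in>T. \<exists>n\<in>{4, 6, 12}. regular_polygon n s P) \<and>
          (\<forall>v\<in>tiling_vertices T. \<forall>n\<in>{4, 6, 12}. \<exists>!P. P \<in> T \<and> regular_polygon n s P \<and> v \<in> P))"

end

theory Submission
  imports Defs
begin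

text \<open>Major and minor triads are joined by three kinds of edges: the root of the minor triad exceeds
  that of the major triad by 1, 5 or 7. In a tiling of type 4.6.12 there are three kinds of edges as
  well, according to the two tiles sharing the edge, and the covering sends square-hexagon edges to 1,
  square-dodecagon edges to 7 and hexagon-dodecagon edges to 5. It is given by a local formula, so that
  no monodromy has to be controlled: the tiles at a vertex are a square, a hexagon and a dodecagon in
  one of two cyclic orders, which decides between major and minor, and the direction of the
  square-hexagon edge, which up to rotation by sixty degrees is the same at all vertices of a connected
  component of the graph, decides the root.

  The tiling is constructed as the power diagram of the circumcircles of its tiles, which are the images
  of three circles under the reflection group of a triangle with angles 30, 60 and 90 degrees. In a power
  diagram the cells automatically cover the plane, have disjoint interiors and meet edge to edge. That a
  cell is the expected polygon follows from the neighbouring circles on the one side and, on the other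
  side, from the fact that no vertex lies inside any of the circles.\<close>

section \<open>Triads\<close>

text \<open>The covering is asserted for every tiling of the type, so it may rest only on the local
  conditions at the vertices; existence is a separate clause that keeps the assertion from being
  vacuous. A local formula is possible because of a numerical coincidence. Let \<open>u\<close> be
  the square-hexagon edge vector at a vertex. Passing along an edge keeps \<open>u\<close>, reverses
  it, or turns it by sixty degrees. If a sixth of a turn counts 2 in Z/12, then a full turn counts
  12 = 0 and a reversal 6, and 7, 7 + 6 = 1 and 7 - 2 = 5 are exactly the root differences of the
  triad graph. The formula only has to be equivariant under sixths of a turn, so directions at
  distant vertices are never compared.

  The construction is Wythoff's: the vertices of the tiling are the images of the incenter of the
  triangle. The reflection group is not enumerated; its elements are controlled through isometry,
  inverses and the residues modulo 6 of the lattice coordinates of the circle centers.\<close>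

lemma UNIV_pitch_class: "(UNIV :: pitch_class set) = {0,1,2,3,4,5,6,7,8,9,10,11}"
proof -
  have "x \<in> {0,1,2,3,4,5,6,7,8,9,10,11}" for x :: pitch_class
  proof (cases x)
    case (of_int z)
    then have "z \<in> {0,1,2,3,4,5,6,7,8,9,10,11}" by simp presburger
    then show ?thesis using of_int(1) by auto
  qed
  then show ?thesis by blast
qed

lemma triads_as_translates:
  "major_triad x = (+) x ` {0, 4, 7}" "minor_triad (x + d) = (+) x ` {d, d + 3, d + 7}"
  by (auto simp: major_triad_def minor_triad_def add.assoc)

text \<open>Transposition invariance: only the difference \<open>d\<close> of the roots matters, so
  twelve values are left to check.\<close>

lemma card_triad_Int:
  "card (major_triad x \<inter> minor_triad y) = 1 \<longleftrightarrow> y \<in> {x + 1, x + 5, x + 7}"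
proof -
  define d where "d = y - x"
  have y: "y = x + d" by (simp add: d_def)
  have "d \<in> {0,1,2,3,4,5,6,7,8,9,10,11}" using UNIV_pitch_class by blast
  then have "card ({0, 4, 7} \<inter> {d, d + 3, d + 7}) = 1 \<longleftrightarrow> d \<in> {1, 5, 7}"
    by (elim insertE) (simp_all add: Int_insert_left card_insert_if)
  moreover have "major_triad x \<inter> minor_triad y = (+) x ` ({0, 4, 7} \<inter> {d, d + 3, d + 7})"
    unfolding y triads_as_translates by (simp add: image_Int)
  ultimately show ?thesis by (simp add: card_image y)
qed

text \<open>Vertices of the graph are sets of pitch classes; since a triad has no translational
  symmetry, they can be named by their roots.\<close>

lemma major_triad_eq_iff: "major_triad x = major_triad y \<longleftrightarrow> x = y"
proof
  define d where "d = y - x"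
  have y: "y = x + d" by (simp add: d_def)
  assume "major_triad x = major_triad y"
  then have "(+) x ` {0, 4, 7} = (+) x ` {d, d + 4, d + 7}"
    by (simp add: major_triad_def y add.assoc)
  then have "{0, 4, 7} = {d, d + 4, d + 7}" by (simp only: inj_image_eq_iff[OF inj_on_add])
  then have mem: "0 \<in> {d, d + 4, d + 7}" "4 \<in> {d, d + 4, d + 7}" "7 \<in> {d, d + 4, d + 7}" by blast+
  have "d \<in> {0,1,2,3,4,5,6,7,8,9,10,11}" using UNIV_pitch_class by blast
  then have "d = 0" by (elim insertE) (use mem in simp_all)
  then show "x = y" by (simp add: y)
qed simp

lemma minor_triad_eq_iff: "minor_triad x = minor_triad y \<longleftrightarrow> x = y"
proof
  define d where "d = y - x"
  have y: "y = x + d" by (simp add: d_def)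
  assume "minor_triad x = minor_triad y"
  then have "(+) x ` {0, 3, 7} = (+) x ` {d, d + 3, d + 7}"
    by (simp add: minor_triad_def y add.assoc)
  then have "{0, 3, 7} = {d, d + 3, d + 7}" by (simp only: inj_image_eq_iff[OF inj_on_add])
  then have mem: "0 \<in> {d, d + 3, d + 7}" "3 \<in> {d, d + 3, d + 7}" "7 \<in> {d, d + 3, d + 7}" by blast+
  have "d \<in> {0,1,2,3,4,5,6,7,8,9,10,11}" using UNIV_pitch_class by blast
  then have "d = 0" by (elim insertE) (use mem in simp_all)
  then show "x = y" by (simp add: y)
qed simp

lemma major_neq_minor_triad: "major_triad x \<noteq> minor_triad y"
proof
  define d where "d = y - x"
  have y: "y = x + d" by (simp add: d_def)
  assume "major_triad x = minor_triad y"
  then have "{0, 4, 7} = {d, d + 3, d + 7}"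
    unfolding y triads_as_translates by (simp only: inj_image_eq_iff[OF inj_on_add])
  then have mem: "0 \<in> {d, d + 3, d + 7}" "4 \<in> {d, d + 3, d + 7}" "7 \<in> {d, d + 3, d + 7}" by blast+
  have "d \<in> {0,1,2,3,4,5,6,7,8,9,10,11}" using UNIV_pitch_class by blast
  then show False by (elim insertE) (use mem in simp_all)
qed

lemma triad_edges:
  "edges triad_graph = {{major_triad x, minor_triad y} | x y. y \<in> {x + 1, x + 5, x + 7}}"
  unfolding card_triad_Int[symmetric] triad_graph_def major_triads_def minor_triads_def graph.simps
  by blast

lemma triad_adj_iff:
  "{major_triad x, minor_triad y} \<in> edges triad_graph \<longleftrightarrow> y \<in> {x + 1, x + 5, x + 7}"
  "{minor_triad y, major_triad x} \<in> edges triad_graph \<longleftrightarrow> y \<in> {x + 1, x + 5, x + 7}"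
  "{major_triad x, major_triad z} \<notin> edges triad_graph"
  "{minor_triad x, minor_triad z} \<notin> edges triad_graph"
proof -
  show 1: "{major_triad x, minor_triad y} \<in> edges triad_graph \<longleftrightarrow> y \<in> {x + 1, x + 5, x + 7}"
    unfolding triad_edges mem_Collect_eq doubleton_eq_iff
    by (metis major_triad_eq_iff minor_triad_eq_iff major_neq_minor_triad)
  then show "{minor_triad y, major_triad x} \<in> edges triad_graph \<longleftrightarrow> y \<in> {x + 1, x + 5, x + 7}"
    by (simp only: insert_commute)
  show "{major_triad x, major_triad z} \<notin> edges triad_graph"
    "{minor_triad x, minor_triad z} \<notin> edges triad_graph"
    unfolding triad_edges mem_Collect_eq doubleton_eq_iff
    by (metis major_neq_minor_triad)+
qed

lemma triad_edgeE:
  assumes "e \<in> edges triad_graph"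
  obtains x y where "e = {major_triad x, minor_triad y}" "y \<in> {x + 1, x + 5, x + 7}"
  using assms unfolding triad_edges mem_Collect_eq by (elim exE conjE)

lemma triad_edges_at_major: "edges_at triad_graph (major_triad x) =
    {{major_triad x, minor_triad (x + 1)}, {major_triad x, minor_triad (x + 5)},
     {major_triad x, minor_triad (x + 7)}}" (is "_ = ?R")
proof
  show "edges_at triad_graph (major_triad x) \<subseteq> ?R"
  proof
    fix e assume "e \<in> edges_at triad_graph (major_triad x)"
    then have e: "e \<in> edges triad_graph" "major_triad x \<in> e" by (simp_all add: edges_at_def)
    obtain x' y where "e = {major_triad x', minor_triad y}" "y \<in> {x' + 1, x' + 5, x' + 7}"
      using e(1) by (rule triad_edgeE)
    with e(2) show "e \<in> ?R" by (auto simp: major_triad_eq_iff major_neq_minor_triad)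
  qed
qed (auto simp: edges_at_def triad_adj_iff)

lemma triad_edges_at_minor: "edges_at triad_graph (minor_triad y) =
    {{major_triad (y - 1), minor_triad y}, {major_triad (y - 5), minor_triad y},
     {major_triad (y - 7), minor_triad y}}" (is "_ = ?R")
proof
  show "edges_at triad_graph (minor_triad y) \<subseteq> ?R"
  proof
    fix e assume "e \<in> edges_at triad_graph (minor_triad y)"
    then have e: "e \<in> edges triad_graph" "minor_triad y \<in> e" by (simp_all add: edges_at_def)
    obtain x y' where x: "e = {major_triad x, minor_triad y'}" "y' \<in> {x + 1, x + 5, x + 7}"
      using e(1) by (rule triad_edgeE)
    with e(2) have "y' = y" using major_neq_minor_triad minor_triad_eq_iff by blast
    with x have "x = y - 1 \<or> x = y - 5 \<or> x = y - 7" by (auto simp only: eq_diff_eq insert_iff empty_iff)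
    with x(1) \<open>y' = y\<close> show "e \<in> ?R" by (elim disjE) simp_all
  qed
qed (auto simp: edges_at_def triad_adj_iff)

lemma verts_triad_graph: "verts triad_graph = range major_triad \<union> range minor_triad"
  by (simp add: triad_graph_def major_triads_def minor_triads_def)

lemma regular_triad_graph: "regular_of_degree triad_graph 3"
  unfolding regular_of_degree_def verts_triad_graph
  by (auto simp: triad_edges_at_major triad_edges_at_minor card_insert_if doubleton_eq_iff
      major_triad_eq_iff minor_triad_eq_iff major_neq_minor_triad major_neq_minor_triad[symmetric])

lemma bipartite_triad_graph: "bipartite_with triad_graph major_triads minor_triads"
  unfolding bipartite_with_def verts_triad_graph major_triads_def minor_triads_def
  using major_neq_minor_triad by (auto elim!: triad_edgeE)

lemma simple_triad_graph: "simple_graph triad_graph"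
  unfolding simple_graph_def verts_triad_graph
  by (auto elim!: triad_edgeE simp: card_insert_if major_neq_minor_triad)

lemma card_triads: "card major_triads = 12" "card minor_triads = 12"
  unfolding major_triads_def minor_triads_def
  by (simp_all add: card_image inj_def major_triad_eq_iff minor_triad_eq_iff)

section \<open>Components as parity classes of roots\<close>

definition even_pitch :: "pitch_class set" where
  "even_pitch = range (\<lambda>k. 2 * k)"

lemma even_pitch_eq: "even_pitch = {0,2,4,6,8,10}"
  unfolding even_pitch_def UNIV_pitch_class by auto

lemma even_pitch_add: "x \<in> even_pitch \<Longrightarrow> y \<in> even_pitch \<Longrightarrow> x + y \<in> even_pitch"
  unfolding even_pitch_def image_iff by (metis UNIV_I distrib_left)

lemma even_pitch_diff: "x \<in> even_pitch \<Longrightarrow> y \<in> even_pitch \<Longrightarrow> x - y \<in> even_pitch"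
  unfolding even_pitch_def image_iff by (metis UNIV_I right_diff_distrib)

text \<open>The root differences 1, 5, 7 are odd, so a component joins major triads of one parity
  with minor triads of the other; the extra 1 accounts for this. Only the parity of \<open>p\<close>
  matters.\<close>

definition triad_class :: "pitch_class \<Rightarrow> pitch_class set set" where
  "triad_class p = {major_triad x | x. x - p \<in> even_pitch} \<union> {minor_triad y | y. y - p - 1 \<in> even_pitch}"

lemma major_in_class: "major_triad x \<in> triad_class p \<longleftrightarrow> x - p \<in> even_pitch"
  and minor_in_class: "minor_triad y \<in> triad_class p \<longleftrightarrow> y - p - 1 \<in> even_pitch"
  unfolding triad_class_def Un_iff mem_Collect_eq
  by (metis major_neq_minor_triad major_triad_eq_iff, metis major_neq_minor_triad minor_triad_eq_iff)

lemma triad_class_subset: "triad_class p \<subseteq> verts triad_graph"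
  by (auto simp: triad_class_def verts_triad_graph)

lemma triad_class_closed:
  assumes "v \<in> triad_class p" "{v, w} \<in> edges triad_graph"
  shows "w \<in> triad_class p"
proof -
  obtain x y where e: "{v, w} = {major_triad x, minor_triad y}" and y: "y \<in> {x + 1, x + 5, x + 7}"
    using assms(2) by (rule triad_edgeE)
  have ev: "{0, 4, 6} \<subseteq> even_pitch" by (auto simp: even_pitch_eq)
  \<comment> \<open>\<open>d\<close> is the root difference minus 1, which is even for each of the
    three kinds of edges.\<close>
  obtain d where d: "d \<in> {0, 4, 6}" "y = x + d + 1" using y by (auto simp: add.assoc)
  have "x - p \<in> even_pitch \<longleftrightarrow> y - p - 1 \<in> even_pitch"
  proof -
    have "y - p - 1 = (x - p) + d" "x - p = (y - p - 1) - d" by (simp_all add: d)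
    then show ?thesis using d(1) ev by (metis even_pitch_add even_pitch_diff subsetD)
  qed
  then show ?thesis using e assms(1) by (auto simp: doubleton_eq_iff major_in_class minor_in_class)
qed

lemma reachable_closed:
  assumes "reachable G v w" "v \<in> W" "\<And>a b. a \<in> W \<Longrightarrow> {a, b} \<in> edges G \<Longrightarrow> b \<in> W"
  shows "w \<in> W"
  using assms(1) unfolding reachable_def by (induction rule: rtranclp_induct) (use assms in auto)

lemma reachable_sym: "reachable G v w \<Longrightarrow> reachable G w v"
  unfolding reachable_def
  by (rule sympD[OF symp_rtranclp]) (auto intro: sympI simp: insert_commute)

lemma reachable_trans: "reachable G u v \<Longrightarrow> reachable G v w \<Longrightarrow> reachable G u w"
  unfolding reachable_def by (rule rtranclp_trans)

lemma reachable_edge: "{u, v} \<in> edges G \<Longrightarrow> reachable G u v"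
  unfolding reachable_def by (rule r_into_rtranclp)

text \<open>Going up by 7 to a minor triad and back down by 5 raises the root of a major triad by 2,
  and 2 generates the even residues. A minor triad is attached to the major triad one semitone below
  its root.\<close>

lemma triad_class_connected:
  assumes "v \<in> triad_class p" "w \<in> triad_class p"
  shows "reachable triad_graph v w"
proof -
  have step: "reachable triad_graph (major_triad x) (major_triad (x + 2))" for x
    by (rule reachable_trans[OF reachable_edge reachable_edge, where v = "minor_triad (x + 7)"])
      (auto simp: triad_adj_iff add.assoc)
  have steps: "reachable triad_graph (major_triad p) (major_triad (p + of_nat (2 * k)))" for k
  proof (induction k)
    case (Suc k)
    have "p + of_nat (2 * Suc k) = (p + of_nat (2 * k)) + 2" by (simp add: algebra_simps)
    then show ?case using reachable_trans[OF Suc step] by metis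
  qed (simp add: reachable_def)
  have major: "reachable triad_graph (major_triad p) (major_triad x)" if "x - p \<in> even_pitch" for x
  proof -
    have "\<exists>k. x - p = of_nat (2 * k)"
      using that unfolding even_pitch_eq
      by (elim insertE) (auto intro: exI[of _ 0] exI[of _ 1] exI[of _ 2] exI[of _ 3] exI[of _ 4] exI[of _ 5])
    then show ?thesis using steps by (metis add.commute diff_add_cancel)
  qed
  have "reachable triad_graph (major_triad p) u" if "u \<in> triad_class p" for u
    using that unfolding triad_class_def
  proof
    assume "u \<in> {minor_triad y | y. y - p - 1 \<in> even_pitch}"
    then obtain y where u: "u = minor_triad y" and "y - p - 1 \<in> even_pitch" by blast
    then have "reachable triad_graph (major_triad p) (major_triad (y - 1))"
      by (intro major) (simp add: algebra_simps)
    moreover have "{major_triad (y - 1), minor_triad y} \<in> edges triad_graph" by (simp add: triad_adj_iff)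
    ultimately show ?thesis unfolding u by (meson reachable_edge reachable_trans)
  qed (auto intro: major)
  then show ?thesis using assms reachable_sym reachable_trans by metis
qed

lemma triad_class_cover: "verts triad_graph = triad_class 0 \<union> triad_class 1"
proof -
  have "x - 0 \<in> even_pitch \<or> x - 1 \<in> even_pitch" for x
  proof -
    have "x \<in> {0,1,2,3,4,5,6,7,8,9,10,11}" using UNIV_pitch_class by blast
    then show ?thesis by (elim insertE) (simp_all add: even_pitch_eq)
  qed
  moreover have "y - 0 - 1 \<in> even_pitch \<or> y - 1 - 1 \<in> even_pitch" for y
  proof -
    have "y \<in> {0,1,2,3,4,5,6,7,8,9,10,11}" using UNIV_pitch_class by blast
    then show ?thesis by (elim insertE) (simp_all add: even_pitch_eq)
  qed
  ultimately have "major_triad x \<in> triad_class 0 \<union> triad_class 1"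
    and "minor_triad y \<in> triad_class 0 \<union> triad_class 1" for x y
    unfolding Un_iff major_in_class minor_in_class by blast+
  then show ?thesis using triad_class_subset unfolding verts_triad_graph by blast
qed

lemma component_of_class:
  assumes "v \<in> triad_class p"
  shows "{w \<in> verts triad_graph. reachable triad_graph v w} = triad_class p"
  using assms triad_class_subset triad_class_connected
    reachable_closed[of triad_graph v _ "triad_class p"] triad_class_closed by blast

lemma components_triad_graph:
  "components_of triad_graph =
     {induced_subgraph triad_graph (triad_class 0), induced_subgraph triad_graph (triad_class 1)}"
proof -
  have "major_triad 0 \<in> triad_class 0" "major_triad 1 \<in> triad_class 1"
    by (simp_all add: major_in_class even_pitch_eq)
  then show ?thesis
    unfolding components_of_def triad_class_cover[unfolded verts_triad_graph] 
    using component_of_class triad_class_cover by (force simp: image_Un)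
qed

lemma card_components_triad_graph: "card (components_of triad_graph) = 2"
proof -
  have "major_triad 0 \<in> triad_class 0" "major_triad 0 \<notin> triad_class 1"
    by (simp_all add: major_in_class even_pitch_eq)
  then have "induced_subgraph triad_graph (triad_class 0) \<noteq> induced_subgraph triad_graph (triad_class 1)"
    by (auto simp: induced_subgraph_def)
  then show ?thesis by (simp add: components_triad_graph)
qed

lemma card_class_Int:
  "card (triad_class p \<inter> major_triads) = 6" "card (triad_class p \<inter> minor_triads) = 6"
proof -
  have c: "card even_pitch = 6" by (simp add: even_pitch_eq)
  have "triad_class p \<inter> major_triads = (\<lambda>e. major_triad (e + p)) ` even_pitch"
  proof -
    have "x - p \<in> even_pitch \<Longrightarrow> major_triad x \<in> (\<lambda>e. major_triad (e + p)) ` even_pitch" for x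
      by (rule image_eqI[of _ _ "x - p"]) auto
    then show ?thesis by (auto simp: major_triads_def major_in_class)
  qed
  then show "card (triad_class p \<inter> major_triads) = 6"
    by (simp add: card_image inj_on_def major_triad_eq_iff c)
  have "triad_class p \<inter> minor_triads = (\<lambda>e. minor_triad (e + p + 1)) ` even_pitch"
  proof -
    have "x - p - 1 \<in> even_pitch \<Longrightarrow> minor_triad x \<in> (\<lambda>e. minor_triad (e + p + 1)) ` even_pitch" for x
      by (rule image_eqI[of _ _ "x - p - 1"]) auto
    then show ?thesis by (auto simp: minor_triads_def minor_in_class)
  qed
  then show "card (triad_class p \<inter> minor_triads) = 6"
    by (simp add: card_image inj_on_def minor_triad_eq_iff c)
qed

lemma edges_class:
  "{a, b} \<in> edges (induced_subgraph triad_graph (triad_class p)) \<longleftrightarrow>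
     a \<in> triad_class p \<and> b \<in> triad_class p \<and> {a, b} \<in> edges triad_graph"
  by (auto simp: induced_subgraph_def)

text \<open>A class is closed under adjacency, so the induced subgraph loses no edge at its
  vertices, and the local bijections of the covering can be checked in the whole triad
  graph.\<close>

lemma edges_at_class:
  assumes "v \<in> triad_class p"
  shows "edges_at (induced_subgraph triad_graph (triad_class p)) v = edges_at triad_graph v"
proof -
  have "e \<subseteq> triad_class p" if edge: "e \<in> edges triad_graph" "v \<in> e" for e
  proof -
    obtain a b where e: "e = {a, b}" using triad_edgeE[OF edge(1)] by metis
    then have "v = a \<or> v = b" using edge(2) by blast
    then show ?thesis
      using edge(1) assms triad_class_closed[of a p b] triad_class_closed[of b p a]
      unfolding e by (auto simp: insert_commute)
  qed
  then show ?thesis by (auto simp: edges_at_def induced_subgraph_def)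
qed

section \<open>Girth, and the obstruction to being a Levi graph\<close>

lemma class_four_cycle:
  fixes p :: pitch_class
  defines "a \<equiv> major_triad p" and "b \<equiv> minor_triad (p + 1)"
    and "c \<equiv> major_triad (p + 6)" and "d \<equiv> minor_triad (p + 7)"
    and "G \<equiv> induced_subgraph triad_graph (triad_class p)"
  shows "distinct [a, b, c, d]" "{a, b, c, d} \<subseteq> verts G"
    "{a, b} \<in> edges G" "{b, c} \<in> edges G" "{c, d} \<in> edges G" "{d, a} \<in> edges G"
proof -
  \<comment> \<open>The edges alternate between the root differences 1 and 7, and 1 - 7 + 1 - 7 =
    -12 vanishes in Z/12. The covering maps the boundary of a square tile to a cycle of this
    kind.\<close>
  have v: "{a, b, c, d} \<subseteq> triad_class p"
    by (simp add: a_def b_def c_def d_def major_in_class minor_in_class even_pitch_eq)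
  then show "{a, b, c, d} \<subseteq> verts G" by (simp add: G_def induced_subgraph_def)
  show "distinct [a, b, c, d]"
    by (auto simp: a_def b_def c_def d_def major_triad_eq_iff minor_triad_eq_iff
        major_neq_minor_triad major_neq_minor_triad[symmetric])
  show "{a, b} \<in> edges G" "{b, c} \<in> edges G" "{c, d} \<in> edges G" "{d, a} \<in> edges G"
    using v by (simp_all add: G_def edges_class a_def b_def c_def d_def triad_adj_iff add.assoc)
qed

lemma four_cycle:
  assumes "distinct [a, b, c, d]" "{a, b, c, d} \<subseteq> verts G"
    "{a, b} \<in> edges G" "{b, c} \<in> edges G" "{c, d} \<in> edges G" "{d, a} \<in> edges G"
  shows "is_cycle G [a, b, c, d]"
proof -
  have "{[a, b, c, d] ! i, [a, b, c, d] ! (Suc i mod 4)} \<in> edges G" if "i < 4" for i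
  proof -
    have "i = 0 \<or> i = 1 \<or> i = 2 \<or> i = 3" using that by linarith
    then show ?thesis using assms(3-6) by (elim disjE) simp_all
  qed
  then show ?thesis using assms(1,2) by (simp add: is_cycle_def)
qed

lemma girth_class: "girth (induced_subgraph triad_graph (triad_class p)) = 4"
proof -
  let ?G = "induced_subgraph triad_graph (triad_class p)"
  have lower: "4 \<le> length c" if "is_cycle ?G c" for c
  proof (rule ccontr)
    assume "\<not> 4 \<le> length c"
    with that have l: "length c = 3" by (simp add: is_cycle_def)
    have e: "{c ! i, c ! (Suc i mod 3)} \<in> edges triad_graph" if "i < 3" for i
      using that \<open>is_cycle ?G c\<close> l by (auto simp: is_cycle_def induced_subgraph_def)
    have e: "{c ! 0, c ! 1} \<in> edges triad_graph" "{c ! 1, c ! 2} \<in> edges triad_graph"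
      "{c ! 2, c ! 0} \<in> edges triad_graph"
      using e[of 0] e[of 1] e[of 2] by (simp_all add: numeral_2_eq_2)
    \<comment> \<open>Being major changes along each edge, which is impossible around three
      vertices. Since \<open>is_cycle\<close> demands length at least 3, no other length below 4 has
      to be excluded.\<close>
    have bip: "(u \<in> range major_triad) \<noteq> (w \<in> range major_triad)" if "{u, w} \<in> edges triad_graph" for u w
      using that by (rule triad_edgeE) (auto simp: doubleton_eq_iff major_neq_minor_triad[symmetric])
    show False using e[THEN bip] by blast
  qed
  let ?c = "[major_triad p, minor_triad (p + 1), major_triad (p + 6), minor_triad (p + 7)]"
  have "is_cycle ?G ?c" by (rule four_cycle[OF class_four_cycle])
  moreover have "enat (length ?c) = 4" by (simp add: numeral_eq_enat)
  ultimately have "girth ?G \<le> 4" unfolding girth_def by (metis INF_lower mem_Collect_eq)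
  moreover have "4 \<le> girth ?G"
    unfolding girth_def using lower by (auto intro!: INF_greatest simp: numeral_eq_enat)
  ultimately show ?thesis by (rule antisym)
qed

text \<open>In a four-cycle, two opposite vertices are points and the other two are lines through
  both of them, so two lines share two points.\<close>

lemma levi_graph_no_four_cycle:
  assumes "configuration P L I" and ne: "a \<noteq> c" "b \<noteq> d"
    and e: "{a, b} \<in> edges (levi_graph P L I)" "{b, c} \<in> edges (levi_graph P L I)"
      "{c, d} \<in> edges (levi_graph P L I)" "{d, a} \<in> edges (levi_graph P L I)"
  shows False
proof -
  have fin: "finite P" and PL: "P \<inter> L = {}" and I: "I \<subseteq> P \<times> L"
    and le: "\<And>l m. l \<in> L \<Longrightarrow> m \<in> L \<Longrightarrow> l \<noteq> m \<Longrightarrow> card {p \<in> P. (p, l) \<in> I \<and> (p, m) \<in> I} \<le> 1"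
    using assms(1) by (auto simp: configuration_def)
  have adj: "(u, w) \<in> I \<or> (w, u) \<in> I" if "{u, w} \<in> edges (levi_graph P L I)" for u w
    using that by (auto simp: levi_graph_def doubleton_eq_iff)
  have no: False if "(p, l) \<in> I" "(p, m) \<in> I" "(q, l) \<in> I" "(q, m) \<in> I" "p \<noteq> q" "l \<noteq> m" for p q l m
  proof -
    have "{p, q} \<subseteq> {p \<in> P. (p, l) \<in> I \<and> (p, m) \<in> I}" using that I by auto
    then have "card {p, q} \<le> card {p \<in> P. (p, l) \<in> I \<and> (p, m) \<in> I}"
      by (intro card_mono) (simp_all add: fin)
    also have "\<dots> \<le> 1" using that I by (intro le) auto
    finally show False using \<open>p \<noteq> q\<close> by simp
  qed
  \<comment> \<open>The two instances of \<open>no\<close> belong to the cases that \<open>a\<close>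
    is a point and that \<open>a\<close> is a line.\<close>
  show False
    using e[THEN adj] I PL no[of a b d c] no[of b a c d] ne by blast
qed

lemma class_not_levi: "\<not> is_levi_graph (induced_subgraph triad_graph (triad_class p))"
  using levi_graph_no_four_cycle class_four_cycle[of p] unfolding is_levi_graph_def
  by (metis distinct_length_2_or_more)

section \<open>Regular polygons\<close>

abbreviation root_cis :: "nat \<Rightarrow> complex" where
  "root_cis n \<equiv> cis (2 * pi / real n)"

text \<open>\<open>z\<close> carries circumradius and phase together, and the vertices are indexed
  by roots of unity rather than angles; rotations and reflections become algebra on \<open>z\<close>
  and the roots.\<close>

definition ngon :: "nat \<Rightarrow> complex \<Rightarrow> complex \<Rightarrow> complex set" where
  "ngon n c z = convex hull ((\<lambda>w. c + z * w) ` {w. w ^ n = 1})"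

lemma inner_mult_left_complex: "inner (z * a) (z * b) = (cmod z)\<^sup>2 * inner a (b :: complex)"
  unfolding cmod_power2 by (simp add: inner_complex_def algebra_simps power2_eq_square)

lemma inner_cis: "inner (cis a) (cis b) = cos (a - b)"
  by (simp add: inner_complex_def cos_diff)

lemma norm_root_unity: "w ^ n = 1 \<Longrightarrow> 0 < n \<Longrightarrow> cmod w = 1"
  by (metis norm_ge_zero norm_one norm_power power_eq_1_iff less_numeral_extra(3))

lemma root_cis_power: "0 < n \<Longrightarrow> root_cis n ^ n = 1"
  by (simp add: Complex.DeMoivre)

lemma cnj_root_cis: "root_cis n * cnj (root_cis n) = 1" "cnj (root_cis n) * root_cis n = 1"
  by (simp_all add: cis_cnj cis_mult)

lemma root_unityE:
  assumes "w ^ n = 1" "0 < n"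
  obtains k where "k < n" "w = cis (2 * pi * real k / real n)"
  using bij_betw_imp_surj_on[OF Complex.bij_betw_roots_unity[OF assms(2)]] assms(1) by blast

lemma regular_polygon_iff_ngon:
  assumes "0 < n"
  shows "regular_polygon n s P \<longleftrightarrow>
    (\<exists>c z. z \<noteq> 0 \<and> s = 2 * cmod z * sin (pi / real n) \<and> P = ngon n c z)"
proof -
  have eq: "(\<lambda>k. c + complex_of_real r * cis (\<theta> + 2 * pi * real k / real n)) ` {..<n}
      = (\<lambda>w. c + (r * cis \<theta>) * w) ` {w. w ^ n = 1}" for c r \<theta>
    unfolding bij_betw_imp_surj_on[OF Complex.bij_betw_roots_unity[OF assms], symmetric] image_image
    by (simp add: cis_mult mult.assoc)
  show ?thesis
  proof
    assume "regular_polygon n s P"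
    then obtain c r \<theta> where "r > 0" "s = 2 * r * sin (pi / real n)" "P = ngon n c (r * cis \<theta>)"
      unfolding regular_polygon_def eq ngon_def by blast
    then show "\<exists>c z. z \<noteq> 0 \<and> s = 2 * cmod z * sin (pi / real n) \<and> P = ngon n c z"
      by (intro exI[of _ c] exI[of _ "r * cis \<theta>"]) (simp add: norm_mult)
  next
    assume "\<exists>c z. z \<noteq> 0 \<and> s = 2 * cmod z * sin (pi / real n) \<and> P = ngon n c z"
    then obtain c z where "z \<noteq> 0" "s = 2 * cmod z * sin (pi / real n)" "P = ngon n c z" by blast
    then show "regular_polygon n s P"
      unfolding regular_polygon_def eq ngon_def
      by (intro exI[of _ c] exI[of _ "cmod z"] exI[of _ "Arg z"])
        (use rcis_cmod_Arg[of z] in \<open>simp add: rcis_def\<close>)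
  qed
qed

lemma ngon_rotate:
  assumes "u ^ n = 1" "0 < n"
  shows "ngon n c (z * u) = ngon n c z"
proof -
  have "(*) u ` {w. w ^ n = 1} = {w. w ^ n = 1}"
  proof
    show "(*) u ` {w. w ^ n = 1} \<subseteq> {w. w ^ n = 1}" using assms by (auto simp: power_mult_distrib)
    have "u \<noteq> 0" using assms by (auto simp: zero_power)
    then have "w = u * (w / u)" "w ^ n = 1 \<Longrightarrow> (w / u) ^ n = 1" for w
      using assms by (auto simp: power_divide)
    then show "{w. w ^ n = 1} \<subseteq> (*) u ` {w. w ^ n = 1}" by blast
  qed
  then have "(\<lambda>w. c + z * w) ` {w. w ^ n = 1} = (\<lambda>w. c + z * w) ` (*) u ` {w. w ^ n = 1}" by simp
  then show ?thesis unfolding ngon_def by (simp add: image_image mult.assoc)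
qed

text \<open>The direction \<open>pi / n\<close> bisects the vertices numbered 0 and 1, and all
  others are at a strictly larger angular distance, which is \<open>2 * pi - t\<close> once
  \<open>t\<close> exceeds \<open>pi\<close>.\<close>

lemma root_cos_bound:
  fixes n k :: nat
  assumes "3 \<le> n" "k < n"
  shows "cos (pi / n - 2 * pi * real k / n) \<le> cos (pi / n)"
    and "cos (pi / n - 2 * pi * real k / n) = cos (pi / n) \<Longrightarrow> k = 0 \<or> k = 1"
proof -
  define t where "t = (2 * real k - 1) * pi / n"
  have n: "real n > 0" using assms by simp
  have c: "cos (pi / n - 2 * pi * real k / n) = cos t"
  proof -
    have "pi / n - 2 * pi * real k / n = - t"
      by (simp add: t_def diff_divide_distrib left_diff_distrib)
    then show ?thesis by simp
  qed
  have strict: "cos t < cos (pi / n)" if "2 \<le> k"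
  proof (cases "t \<le> pi")
    case True
    have "1 * pi < (2 * real k - 1) * pi" using that by (intro mult_strict_right_mono) auto
    then have "pi / n < t" using n unfolding t_def by (intro divide_strict_right_mono) auto
    then show ?thesis using True by (intro cos_monotone_0_pi) auto
  next
    case False
    have "2 * pi - t = (2 * (real n - k) + 1) * pi / n"
      using n by (simp add: t_def field_simps)
    moreover have "1 * pi < (2 * (real n - k) + 1) * pi"
      using assms by (intro mult_strict_right_mono) auto
    ultimately have "pi / n < 2 * pi - t"
      using n by (simp only: mult_1) (intro divide_strict_right_mono)
    then have "cos (2 * pi - t) < cos (pi / n)" using False by (intro cos_monotone_0_pi) auto
    then show ?thesis by simp
  qed
  have "cos t = cos (pi / n)" if "k = 0 \<or> k = 1" using that by (auto simp: t_def)
  then show "cos (pi / n - 2 * pi * real k / n) \<le> cos (pi / n)"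
    unfolding c using strict by (cases "2 \<le> k") (auto simp: not_le less_2_cases_iff)
  show "cos (pi / n - 2 * pi * real k / n) = cos (pi / n) \<Longrightarrow> k = 0 \<or> k = 1"
    unfolding c using strict by (cases "2 \<le> k") (auto simp: not_le less_2_cases_iff)
qed

lemma root_inner_bound:
  assumes "3 \<le> n" "w ^ n = 1" "\<eta> ^ n = 1"
  shows "inner (w * cis (pi / n)) \<eta> \<le> cos (pi / n)"
    and "inner (w * cis (pi / n)) \<eta> = cos (pi / n) \<longleftrightarrow> \<eta> = w \<or> \<eta> = w * root_cis n"
proof -
  have n: "0 < n" using assms by simp
  have w: "cmod w = 1" using norm_root_unity assms n by blast
  then have w0: "w \<noteq> 0" by auto
  have "(\<eta> / w) ^ n = 1" using assms by (simp add: power_divide)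
  then obtain k where k: "k < n" "\<eta> / w = cis (2 * pi * real k / real n)"
    using n by (rule root_unityE)
  have \<eta>: "\<eta> = w * cis (2 * pi * real k / real n)" using k w0 by (simp add: field_simps)
  have i: "inner (w * cis (pi / n)) \<eta> = cos (pi / n - 2 * pi * real k / n)"
    unfolding \<eta> inner_mult_left_complex by (simp add: w inner_cis)
  show "inner (w * cis (pi / n)) \<eta> \<le> cos (pi / n)"
    unfolding i using root_cos_bound(1)[OF assms(1) k(1)] .
  have "\<eta> = w \<or> \<eta> = w * root_cis n" if "cos (pi / n - 2 * pi * real k / n) = cos (pi / n)"
    using root_cos_bound(2)[OF assms(1) k(1) that] unfolding \<eta> by auto
  moreover have "inner (w * cis (pi / n)) w = cos (pi / n)"
    using inner_mult_left_complex[of w "cis (pi / n)" "cis 0"] by (simp add: w inner_cis del: cis_zero) (simp add: w)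
  moreover have "inner (w * cis (pi / n)) (w * root_cis n) = cos (pi / n)"
  proof -
    have "pi / n - 2 * pi / n = - (pi / n)" by (simp add: field_simps)
    then show ?thesis unfolding inner_mult_left_complex inner_cis by (simp add: w)
  qed
  ultimately show "inner (w * cis (pi / n)) \<eta> = cos (pi / n) \<longleftrightarrow> \<eta> = w \<or> \<eta> = w * root_cis n"
    using i by auto
qed

text \<open>The normal \<open>z * w * cis (pi / n)\<close> is not normalized: one factor
  \<open>cmod z\<close> on the right is its length, the rest is the apothem
  \<open>cmod z * cos (pi / n)\<close>.\<close>

lemma ngon_vertex_side:
  assumes "3 \<le> n" "w ^ n = 1" "\<eta> ^ n = 1" "z \<noteq> 0"
  shows "inner (z * w * cis (pi / n)) (z * \<eta>) \<le> (cmod z)\<^sup>2 * cos (pi / n)"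
    and "inner (z * w * cis (pi / n)) (z * \<eta>) = (cmod z)\<^sup>2 * cos (pi / n) \<longleftrightarrow>
      \<eta> = w \<or> \<eta> = w * root_cis n"
  unfolding mult.assoc[of z] inner_mult_left_complex using root_inner_bound[OF assms(1-3)] assms(4)
  by (simp_all add: mult.assoc)

text \<open>Cramer's rule for the basis \<open>1\<close>, \<open>root_cis n\<close> yields \<alpha>
  and \<beta>. By the sum-to-product formula their sum is
  \<open>r * cos (t - \<psi>) / cos t\<close>, so the half-plane condition of the side says
  precisely that it is at most 1.\<close>

lemma convex_combination_in_sector:
  assumes "3 \<le> n" "0 \<le> r" "0 \<le> \<psi>" "\<psi> < 2 * pi / n" "r * cos (pi / n - \<psi>) \<le> cos (pi / n)"
  obtains \<alpha> \<beta> where "0 \<le> \<alpha>" "0 \<le> \<beta>" "\<alpha> + \<beta> \<le> 1" "r * cis \<psi> = of_real \<alpha> + of_real \<beta> * root_cis n"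
proof -
  define t where "t = pi / real n"
  have pin: "0 < t" "t < pi / 2" using assms(1) by (auto simp: t_def field_simps)
  have t2: "2 * pi / n = 2 * t" by (simp add: t_def)
  have s2: "sin (2 * t) > 0" and ct: "cos t > 0" and st: "sin t > 0"
    using pin by (auto intro!: sin_gt_zero cos_gt_zero_pi)
  have \<psi>: "0 \<le> \<psi>" "\<psi> < 2 * t" "r * cos (t - \<psi>) \<le> cos t"
    using assms(3-5) unfolding t2 t_def[symmetric] by simp_all
  define \<alpha> \<beta> where "\<alpha> = r * sin (2 * t - \<psi>) / sin (2 * t)" and "\<beta> = r * sin \<psi> / sin (2 * t)"
  have "sin (2 * t - \<psi>) \<ge> 0" "sin \<psi> \<ge> 0" using \<psi> pin by (auto intro!: sin_ge_zero)
  then have nonneg: "0 \<le> \<alpha>" "0 \<le> \<beta>" using assms(2) s2 by (simp_all add: \<alpha>_def \<beta>_def)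
  have "sin (2 * t - \<psi>) + sin \<psi> = 2 * sin t * cos (t - \<psi>)"
    using sin_plus_sin[of "2 * t - \<psi>" \<psi>] by (simp add: diff_divide_distrib add_divide_distrib)
  then have "\<alpha> + \<beta> = r * (2 * sin t * cos (t - \<psi>)) / sin (2 * t)"
    by (simp add: \<alpha>_def \<beta>_def add_divide_distrib[symmetric] distrib_left[symmetric])
  also have "\<dots> = r * cos (t - \<psi>) / cos t" unfolding sin_double using st ct by simp
  also have "\<dots> \<le> 1" using \<psi>(3) ct by simp
  finally have le: "\<alpha> + \<beta> \<le> 1" .
  have "r * cis \<psi> = of_real \<alpha> + of_real \<beta> * cis (2 * t)"
  proof (rule complex_eqI)
    have "sin (2 * t - \<psi>) + sin \<psi> * cos (2 * t) = cos \<psi> * sin (2 * t)" by (simp add: sin_diff)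
    then have "r * (sin (2 * t - \<psi>) + sin \<psi> * cos (2 * t)) / sin (2 * t) = r * cos \<psi>" using s2 by simp
    then show "Re (r * cis \<psi>) = Re (of_real \<alpha> + of_real \<beta> * cis (2 * t))"
      by (simp add: \<alpha>_def \<beta>_def add_divide_distrib distrib_left)
    show "Im (r * cis \<psi>) = Im (of_real \<alpha> + of_real \<beta> * cis (2 * t))" using s2 by (simp add: \<beta>_def)
  qed
  then show thesis using that nonneg le by (simp add: t2)
qed

text \<open>The mean of the vertices is the center because the roots of unity sum to zero.\<close>

lemma center_in_ngon:
  assumes "2 \<le> n"
  shows "c \<in> ngon n c z"
proof -
  let ?R = "{w :: complex. w ^ n = 1}"
  have fin: "finite ?R" using assms by (intro finite_roots_unity) auto
  have card: "card ?R = n" using assms by (intro card_roots_unity_eq) auto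
  have "(\<Sum>w\<in>?R. (1 / n) *\<^sub>R (c + z * w)) \<in> ngon n c z"
    unfolding ngon_def using fin card assms
    by (intro convex_sum convex_convex_hull) (auto intro: hull_inc)
  also have "(\<Sum>w\<in>?R. (1 / n) *\<^sub>R (c + z * w)) = (1 / n) *\<^sub>R (\<Sum>w\<in>?R. c + z * w)"
    by (rule scaleR_right.sum[symmetric])
  also have "(\<Sum>w\<in>?R. c + z * w) = of_nat n * c + z * \<Sum>?R"
    by (simp add: sum.distrib card sum_distrib_left)
  also have "\<Sum>?R = 0" using assms by (intro sum_roots_unity) auto
  finally show ?thesis using assms by (simp add: scaleR_conv_of_real)
qed

text \<open>The vector \<open>z * w * cis (pi / n)\<close> is the outer normal of the edge starting at \<open>c + z * w\<close>.\<close>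

lemma mem_ngon_iff:
  assumes "3 \<le> n" "z \<noteq> 0"
  shows "x \<in> ngon n c z \<longleftrightarrow>
    (\<forall>w. w ^ n = 1 \<longrightarrow> inner (z * w * cis (pi / n)) (x - c) \<le> (cmod z)\<^sup>2 * cos (pi / n))"
    (is "_ \<longleftrightarrow> ?H x")
proof
  show "?H x" if "x \<in> ngon n c z"
  proof (intro allI impI)
    fix w :: complex assume w: "w ^ n = 1"
    let ?a = "z * w * cis (pi / n)"
    have "ngon n c z \<subseteq> {x. inner ?a x \<le> (cmod z)\<^sup>2 * cos (pi / n) + inner ?a c}"
      unfolding ngon_def
      using ngon_vertex_side(1)[OF assms(1) w _ assms(2)]
      by (intro hull_minimal convex_halfspace_le) (auto simp: inner_add_right)
    then show "inner ?a (x - c) \<le> (cmod z)\<^sup>2 * cos (pi / n)"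
      using that by (auto simp: inner_diff_right)
  qed
  show "x \<in> ngon n c z" if H: "?H x"
  proof -
    have n: "0 < n" using assms by simp
    define y where "y = (x - c) / z"
    have xy: "x - c = z * y" using assms(2) by (simp add: y_def)
    define \<phi> where "\<phi> = Arg2pi y"
    have \<phi>: "0 \<le> \<phi>" "y = cmod y * cis \<phi>"
      using Arg2pi[of y] by (simp_all add: \<phi>_def is_Arg_def cis_conv_exp mult.commute)
    \<comment> \<open>\<open>k\<close> numbers the sector between consecutive vertices that contains
      the direction of \<open>y\<close>. The condition of the side spanning this sector alone puts
      \<open>x\<close> into the triangle formed by that side and the center.\<close>
    define k where "k = nat \<lfloor>\<phi> * n / (2 * pi)\<rfloor>"
    have k: "real k \<le> \<phi> * n / (2 * pi)" "\<phi> * n / (2 * pi) < real k + 1"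
      using \<phi>(1) by (simp_all add: k_def floor_le_iff)
    define w where "w = cis (2 * pi * k / n)"
    have w: "w ^ n = 1" using n by (simp add: w_def Complex.DeMoivre)
    have nw: "cmod w = 1" by (simp add: w_def)
    define \<psi> where "\<psi> = \<phi> - 2 * pi * k / n"
    have "2 * pi * k \<le> \<phi> * n" "\<phi> * n < 2 * pi * k + 2 * pi"
      using k by (simp_all add: field_simps)
    then have "2 * pi * k / n \<le> \<phi>" "\<phi> < (2 * pi * k + 2 * pi) / n"
      using n by (simp_all add: pos_divide_le_eq pos_less_divide_eq)
    then have \<psi>: "0 \<le> \<psi>" "\<psi> < 2 * pi / n"
      by (simp_all add: \<psi>_def add_divide_distrib)
    have y: "y = w * (cmod y * cis \<psi>)"
      using \<phi>(2) by (simp add: w_def \<psi>_def cis_mult mult.left_commute)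
    have "inner (z * (w * cis (pi / n))) (z * (w * (cmod y * cis \<psi>))) \<le> (cmod z)\<^sup>2 * cos (pi / n)"
      using H w xy y by (metis mult.assoc)
    then have "inner (cis (pi / n)) (cmod y *\<^sub>R cis \<psi>) \<le> cos (pi / n)"
      unfolding inner_mult_left_complex using assms(2) by (simp add: nw scaleR_conv_of_real)
    then have "cmod y * cos (pi / n - \<psi>) \<le> cos (pi / n)" by (simp add: inner_cis)
    then obtain \<alpha> \<beta> where ab: "0 \<le> \<alpha>" "0 \<le> \<beta>" "\<alpha> + \<beta> \<le> 1"
      "cmod y * cis \<psi> = of_real \<alpha> + of_real \<beta> * root_cis n"
      using convex_combination_in_sector[OF assms(1) norm_ge_zero \<psi>] by blast
    have "x = c + z * (w * (of_real \<alpha> + of_real \<beta> * root_cis n))"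
      using xy y ab(4) by (metis add.commute diff_add_cancel)
    then have "x = (1 - \<alpha> - \<beta>) *\<^sub>R c + \<alpha> *\<^sub>R (c + z * w) + \<beta> *\<^sub>R (c + z * (w * root_cis n))"
      by (simp add: scaleR_conv_of_real algebra_simps)
    moreover have "c \<in> ngon n c z" using assms by (intro center_in_ngon) auto
    moreover have "(w * root_cis n) ^ n = 1" using w root_cis_power[OF n] by (simp add: power_mult_distrib)
    then have "c + z * w \<in> ngon n c z" "c + z * (w * root_cis n) \<in> ngon n c z"
      unfolding ngon_def using w by (auto intro!: hull_inc)
    moreover have "convex (ngon n c z)" by (simp add: ngon_def)
    ultimately have "convex hull {c, c + z * w, c + z * (w * root_cis n)} \<subseteq> ngon n c z"
      and x: "x = (1 - \<alpha> - \<beta>) *\<^sub>R c + \<alpha> *\<^sub>R (c + z * w) + \<beta> *\<^sub>R (c + z * (w * root_cis n))"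
      by (simp_all add: hull_minimal)
    moreover have "x \<in> convex hull {c, c + z * w, c + z * (w * root_cis n)}"
      unfolding convex_hull_3 mem_Collect_eq
      by (intro exI[of _ "1 - \<alpha> - \<beta>"] exI[of _ \<alpha>] exI[of _ \<beta>] conjI x) (use ab in auto)
    ultimately show ?thesis by blast
  qed
qed

lemma convex_ngon: "convex (ngon n c z)"
  by (simp add: ngon_def)

lemma vertex_in_ngon: "w ^ n = 1 \<Longrightarrow> c + z * w \<in> ngon n c z"
  unfolding ngon_def by (auto intro: hull_inc)

section \<open>Interior, extreme points and edges of a regular polygon\<close>

lemma interior_ngonI:
  assumes "3 \<le> n" "z \<noteq> 0"
    and "\<And>w. w ^ n = 1 \<Longrightarrow> inner (z * w * cis (pi / n)) (x - c) < (cmod z)\<^sup>2 * cos (pi / n)"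
  shows "x \<in> interior (ngon n c z)"
proof (rule interiorI)
  let ?U = "\<Inter>w\<in>{w. w ^ n = 1}. {x. inner (z * w * cis (pi / n)) x
              < (cmod z)\<^sup>2 * cos (pi / n) + inner (z * w * cis (pi / n)) c}"
  show "open ?U" using assms(1) by (intro open_INT finite_roots_unity ballI open_halfspace_lt) auto
  show "x \<in> ?U" using assms(3) by (force simp: inner_diff_right)
  show "?U \<subseteq> ngon n c z"
    unfolding subset_iff mem_ngon_iff[OF assms(1,2)]
    by (auto simp: inner_diff_right diff_le_eq intro: less_imp_le)
qed

lemma ngon_subset_cball:
  assumes "0 < n"
  shows "ngon n c z \<subseteq> cball c (cmod z)"
  unfolding ngon_def using norm_root_unity[OF _ assms]
  by (intro hull_minimal convex_cball) (auto simp: dist_norm norm_mult)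

text \<open>A vertex is exposed by the tangent to the circumcircle: by the equality case of
  Cauchy-Schwarz this line meets the enclosing disc only there.\<close>

lemma extreme_point_of_ngon_iff:
  assumes "0 < n"
  shows "x extreme_point_of ngon n c z \<longleftrightarrow> (\<exists>w. w ^ n = 1 \<and> x = c + z * w)"
proof
  assume "x extreme_point_of ngon n c z"
  then show "\<exists>w. w ^ n = 1 \<and> x = c + z * w"
    unfolding ngon_def using extreme_point_of_convex_hull by blast
next
  assume "\<exists>w. w ^ n = 1 \<and> x = c + z * w"
  then obtain w where w: "w ^ n = 1" and x: "x = c + z * w" by blast
  have nzw: "cmod (z * w) = cmod z" using norm_root_unity[OF w assms] by (simp add: norm_mult)
  let ?b = "(cmod z)\<^sup>2 + inner (z * w) c"
  have bound: "inner (z * w) (y - c) \<le> (cmod z)\<^sup>2" "inner (z * w) (y - c) = (cmod z)\<^sup>2 \<Longrightarrow> y = x"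
    if "y \<in> ngon n c z" for y
  proof -
    have yc: "cmod (y - c) \<le> cmod z"
      using that ngon_subset_cball[OF assms] by (force simp: dist_norm norm_minus_commute)
    have "inner (z * w) (y - c) \<le> cmod z * cmod (y - c)"
      using norm_cauchy_schwarz[of "z * w" "y - c"] by (simp add: nzw)
    also have "\<dots> \<le> cmod z * cmod z" using yc by (intro mult_left_mono) auto
    finally show "inner (z * w) (y - c) \<le> (cmod z)\<^sup>2" by (simp add: power2_eq_square)
    assume eq: "inner (z * w) (y - c) = (cmod z)\<^sup>2"
    have "(cmod (y - c - z * w))\<^sup>2 = (cmod (y - c))\<^sup>2 - 2 * inner (z * w) (y - c) + (cmod (z * w))\<^sup>2"
      by (simp add: power2_norm_eq_inner inner_diff_left inner_diff_right inner_commute)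
    also have "\<dots> \<le> 0" using power_mono[OF yc norm_ge_zero, of 2] by (simp add: eq nzw)
    finally show "y = x" by (simp add: x algebra_simps)
  qed
  have shift: "inner (z * w) y = ?b \<longleftrightarrow> inner (z * w) (y - c) = (cmod z)\<^sup>2"
    "inner (z * w) y \<le> ?b \<longleftrightarrow> inner (z * w) (y - c) \<le> (cmod z)\<^sup>2" for y
    by (auto simp: inner_diff_right)
  have "x \<in> ngon n c z" using vertex_in_ngon w x by blast
  moreover have "inner (z * w) (x - c) = (cmod z)\<^sup>2"
    by (simp add: x nzw flip: power2_norm_eq_inner)
  ultimately have "ngon n c z \<inter> {y. inner (z * w) y = ?b} = {x}"
    unfolding shift using bound(2) by blast
  then show "x extreme_point_of ngon n c z"
    using bound(1) unfolding shift(2)[symmetric]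
    by (intro extreme_point_of_Int_supporting_hyperplane_le[of _ "z * w" ?b]) blast+
qed

text \<open>The face cut out by the supporting line is the hull of the vertices lying on it, and
  \<open>ngon_vertex_side\<close> leaves exactly two of them.\<close>

lemma ngon_side_edge:
  assumes "3 \<le> n" "z \<noteq> 0" "w ^ n = 1"
  shows "closed_segment (c + z * w) (c + z * (w * root_cis n)) edge_of ngon n c z"
proof -
  have n: "0 < n" using assms by simp
  let ?a = "z * w * cis (pi / n)" and ?v = "c + z * w" and ?u = "c + z * (w * root_cis n)"
  let ?b = "(cmod z)\<^sup>2 * cos (pi / n) + inner ?a c"
  let ?F = "ngon n c z \<inter> {x. inner ?a x = ?b}"
  have w': "(w * root_cis n) ^ n = 1" using assms(3) root_cis_power[OF n] by (simp add: power_mult_distrib)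
  have face: "?F face_of ngon n c z"
    using mem_ngon_iff[OF assms(1,2)] assms(3)
    by (intro face_of_Int_supporting_hyperplane_le convex_ngon) (force simp: inner_diff_right)
  have on: "inner ?a (c + z * \<eta>) = ?b \<longleftrightarrow> \<eta> = w \<or> \<eta> = w * root_cis n" if "\<eta> ^ n = 1" for \<eta>
    using ngon_vertex_side(2)[OF assms(1,3) that assms(2)] by (simp add: inner_add_right)
  have "compact ((\<lambda>w. c + z * w) ` {w. w ^ n = 1})"
    using n by (intro finite_imp_compact finite_imageI finite_roots_unity) auto
  then obtain S where S: "S \<subseteq> (\<lambda>w. c + z * w) ` {w. w ^ n = 1}" "?F = convex hull S"
    using face unfolding ngon_def by (rule face_of_convex_hull_subset)
  have "S \<subseteq> ?F" unfolding S(2) by (rule hull_subset)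
  then have "S \<subseteq> {?v, ?u}" using S(1) on by blast
  then have "?F \<subseteq> closed_segment ?v ?u" unfolding S(2) segment_convex_hull by (rule hull_mono)
  moreover have "closed_segment ?v ?u \<subseteq> ?F"
    using vertex_in_ngon assms(3) w' on convex_ngon
    by (intro closed_segment_subset convex_Int convex_hyperplane) auto
  ultimately have "?F = closed_segment ?v ?u" by blast
  moreover have "?v \<noteq> ?u"
  proof -
    have "root_cis n \<noteq> 1"
    proof
      assume "root_cis n = 1"
      then have "cos (2 * pi / n) = 1" by (metis cis.sel(1) one_complex.sel(1))
      moreover have "cos (2 * pi / n) < cos 0"
        using assms(1) by (intro cos_monotone_0_pi) (auto simp: field_simps)
      ultimately show False by simp
    qed
    moreover have "w \<noteq> 0" using assms(3) n by (auto simp: zero_power)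
    ultimately show ?thesis using assms(2) by simp
  qed
  then have "aff_dim (closed_segment ?v ?u) = 1" by (simp add: segment_convex_hull aff_dim_convex_hull aff_dim_2)
  ultimately show ?thesis using face by (simp add: edge_of_def)
qed

text \<open>An edge ends at a second vertex. Were this not adjacent to the first, no side line would
  contain both, so the midpoint would satisfy every half-plane condition strictly; a face meeting
  the interior is the whole polygon, but a segment has empty interior.\<close>

lemma ngon_edge_iff:
  assumes "3 \<le> n" "z \<noteq> 0" "w ^ n = 1"
  shows "closed_segment (c + z * w) y edge_of ngon n c z \<longleftrightarrow>
    y = c + z * (w * root_cis n) \<or> y = c + z * (w * cnj (root_cis n))"
proof
  have n: "0 < n" using assms by simp
  let ?v = "c + z * w" let ?w' = "w * cnj (root_cis n)"
  have w': "?w' ^ n = 1"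
    using assms(3) root_cis_power[OF n] by (simp add: power_mult_distrib flip: complex_cnj_power)
  have eq: "?w' * root_cis n = w" by (simp add: mult.assoc cnj_root_cis)
  show "closed_segment ?v y edge_of ngon n c z"
    if "y = c + z * (w * root_cis n) \<or> y = c + z * ?w'"
    using that ngon_side_edge[OF assms] ngon_side_edge[OF assms(1,2) w', of c] unfolding eq
    by (auto simp: closed_segment_commute)
  assume edge: "closed_segment ?v y edge_of ngon n c z"
  then have face: "closed_segment ?v y face_of ngon n c z" and dim: "aff_dim (closed_segment ?v y) = 1"
    by (auto simp: edge_of_def)
  obtain \<eta> where \<eta>: "\<eta> ^ n = 1" and y: "y = c + z * \<eta>"
    using segment_face_of(2)[OF face] extreme_point_of_ngon_iff[OF n] by blast
  have "\<eta> \<noteq> w" using dim by (auto simp: y)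
  show "y = c + z * (w * root_cis n) \<or> y = c + z * ?w'"
  proof (rule ccontr)
    assume "\<not> ?thesis"
    then have ne: "\<eta> \<noteq> w * root_cis n" "\<eta> \<noteq> ?w'" by (auto simp: y)
    have "midpoint ?v y \<in> interior (ngon n c z)"
    proof (rule interior_ngonI[OF assms(1,2)])
      fix u :: complex assume u: "u ^ n = 1"
      let ?I = "\<lambda>x. inner (z * u * cis (pi / n)) x" and ?B = "(cmod z)\<^sup>2 * cos (pi / n)"
      have le: "?I (z * w) \<le> ?B" "?I (z * \<eta>) \<le> ?B"
        using ngon_vertex_side(1)[OF assms(1) u _ assms(2)] assms(3) \<eta> by auto
      have "\<not> (?I (z * w) = ?B \<and> ?I (z * \<eta>) = ?B)"
        using ngon_vertex_side(2)[OF assms(1) u _ assms(2)] assms(3) \<eta> ne \<open>\<eta> \<noteq> w\<close>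
        by (auto simp: mult.assoc cnj_root_cis)
      with le have "?I (z * w) + ?I (z * \<eta>) < 2 * ?B" by linarith
      moreover have "midpoint ?v y - c = (1 / 2) *\<^sub>R (z * w + z * \<eta>)"
        by (simp add: y midpoint_def scaleR_conv_of_real algebra_simps)
      ultimately show "?I (midpoint ?v y - c) < ?B" by (simp add: inner_add_right)
    qed
    moreover have "midpoint ?v y \<in> closed_segment ?v y" by simp
    ultimately have "closed_segment ?v y = ngon n c z"
      using face_of_disjoint_interior[OF face] by blast
    moreover have "interior (closed_segment ?v y) = {}" by (simp add: interior_closed_segment_ge2)
    ultimately show False using \<open>midpoint ?v y \<in> interior (ngon n c z)\<close> by simp
  qed
qed

section \<open>Regular polygons at a given vertex\<close>

text \<open>The regular polygon to the left of its edge from \<open>v\<close> to \<open>v + d\<close>.\<close>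

definition polygon_at :: "nat \<Rightarrow> complex \<Rightarrow> complex \<Rightarrow> complex set" where
  "polygon_at n v d = ngon n (v - d / (root_cis n - 1)) (d / (root_cis n - 1))"

lemma root_cis_neq_1:
  assumes "2 \<le> n"
  shows "root_cis n \<noteq> 1"
proof
  assume "root_cis n = 1"
  then have "cos (2 * pi / n) = 1" by (metis cis.sel(1) one_complex.sel(1))
  moreover have "cos (2 * pi / n) < cos 0"
    using assms by (intro cos_monotone_0_pi) (auto simp: field_simps)
  ultimately show False by simp
qed

text \<open>Chord formula: a side, as a vector, is the radius vector of its first vertex times this
  number.\<close>

lemma root_cis_minus_1: "root_cis n - 1 = 2 * sin (pi / n) * (\<i> * cis (pi / n))"
proof -
  define t where "t = pi / real n"
  have "2 * pi / n = 2 * t" by (simp add: t_def)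
  then have "root_cis n = cis (2 * t)" by simp
  then show ?thesis unfolding t_def[symmetric]
    by (simp add: complex_eq_iff cos_double_sin sin_double power2_eq_square)
qed

lemma sin_pi_div_pos: "2 \<le> n \<Longrightarrow> 0 < sin (pi / real n)"
  by (intro sin_gt_zero) (auto simp: field_simps)

lemma regular_polygon_at:
  assumes "3 \<le> n" "d \<noteq> 0"
  shows "regular_polygon n (cmod d) (polygon_at n v d)"
proof -
  have "cmod (root_cis n - 1) = 2 * sin (pi / n)"
    unfolding root_cis_minus_1 using sin_pi_div_pos[of n] assms by (simp add: norm_mult)
  then have "cmod d = 2 * cmod (d / (root_cis n - 1)) * sin (pi / n)"
    using sin_pi_div_pos[of n] assms by (simp add: norm_divide)
  moreover have "d / (root_cis n - 1) \<noteq> 0" using assms root_cis_neq_1[of n] by simp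
  moreover have "0 < n" using assms by simp
  ultimately show ?thesis
    unfolding polygon_at_def by (subst regular_polygon_iff_ngon) blast+
qed

lemma regular_polygon_vertexE:
  assumes "3 \<le> n" "regular_polygon n s P" "v extreme_point_of P"
  obtains d where "d \<noteq> 0" "cmod d = s" "P = polygon_at n v d"
proof -
  have n: "0 < n" using assms by simp
  obtain c z where z: "z \<noteq> 0" "s = 2 * cmod z * sin (pi / n)" "P = ngon n c z"
    using assms(2) unfolding regular_polygon_iff_ngon[OF n] by blast
  obtain w where w: "w ^ n = 1" "v = c + z * w"
    using assms(3) extreme_point_of_ngon_iff[OF n] unfolding z(3) by blast
  have w0: "w \<noteq> 0" using w n by (auto simp: zero_power)
  let ?d = "z * w * (root_cis n - 1)"
  have r: "root_cis n \<noteq> 1" using root_cis_neq_1[of n] assms by simp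
  have "cmod ?d = s"
    unfolding root_cis_minus_1 using sin_pi_div_pos[of n] assms(1) norm_root_unity[OF w(1) n]
    by (simp add: norm_mult z(2))
  moreover have "?d \<noteq> 0" using z w0 r by simp
  moreover have "P = polygon_at n v ?d"
    unfolding polygon_at_def z(3) w(2) using r ngon_rotate[OF w(1) n] by simp
  ultimately show thesis using that by blast
qed

text \<open>The second edge at \<open>v\<close> is \<open>d\<close> turned by the interior angle, as
  \<open>- cnj (root_cis n)\<close> equals \<open>cis (pi - 2 * pi / n)\<close>.\<close>

lemma polygon_at_edge_iff:
  assumes "3 \<le> n" "d \<noteq> 0"
  shows "closed_segment v y edge_of polygon_at n v d \<longleftrightarrow> y = v + d \<or> y = v - d * cnj (root_cis n)"
proof -
  let ?r = "root_cis n"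
  have r: "?r - 1 \<noteq> 0" using root_cis_neq_1[of n] assms by simp
  define z where "z = d / (?r - 1)"
  have z: "z \<noteq> 0" "d = z * (?r - 1)" using assms r by (simp_all add: z_def)
  have eq: "v - z + z * (1 * ?r) = v + d" "v - z + z * 1 = v" by (simp_all add: z(2) algebra_simps)
  have eq': "v - z + z * (1 * cnj ?r) = v - d * cnj ?r"
    unfolding z(2) by (simp only: left_diff_distrib right_diff_distrib mult.assoc cnj_root_cis) simp
  have "(1 :: complex) ^ n = 1" by simp
  from ngon_edge_iff[OF assms(1) z(1) this, of "v - z" y]
  show ?thesis unfolding eq eq' polygon_at_def z_def[symmetric] .
qed

text \<open>Walking along the boundary turns the edge vector by the exterior angle. This carries
  knowledge of a tile from one vertex to the next.\<close>

lemma polygon_at_next: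
  assumes "3 \<le> n"
  shows "polygon_at n (v + d) (d * root_cis n) = polygon_at n v d"
proof -
  let ?r = "root_cis n"
  have r: "?r - 1 \<noteq> 0" using root_cis_neq_1[of n] assms by simp
  define z where "z = d / (?r - 1)"
  have d: "d = z * (?r - 1)" using r by (simp add: z_def)
  have "v + d - z * ?r = v - z" unfolding d by (simp add: algebra_simps)
  moreover have "d * ?r / (?r - 1) = z * ?r" by (simp add: z_def)
  ultimately have "polygon_at n (v + d) (d * ?r) = ngon n (v - z) (z * ?r)"
    unfolding polygon_at_def by metis
  also have "\<dots> = ngon n (v - z) z" using assms by (intro ngon_rotate root_cis_power) auto
  finally show ?thesis unfolding polygon_at_def z_def[symmetric] .
qed

lemma polygon_at_prev:
  assumes "3 \<le> n"
  shows "polygon_at n (v - d * cnj (root_cis n)) (d * cnj (root_cis n)) = polygon_at n v d"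
  using polygon_at_next[OF assms, of "v - d * cnj (root_cis n)" "d * cnj (root_cis n)"]
  by (simp add: mult.assoc cnj_root_cis)

lemma extreme_point_polygon_at: "3 \<le> n \<Longrightarrow> v extreme_point_of polygon_at n v d"
  unfolding polygon_at_def by (subst extreme_point_of_ngon_iff) (auto intro!: exI[of _ 1])

lemma two_pi_div_bounds: "3 \<le> n \<Longrightarrow> 0 < 2 * pi / real n \<and> 2 * pi / real n < pi"
  by (auto simp: pos_divide_less_eq)

lemma root_cis_inject:
  assumes "3 \<le> n" "3 \<le> m" "root_cis n = root_cis m"
  shows "n = m"
proof -
  have "cos (2 * pi / n) = cos (2 * pi / m)" using assms(3) by (metis cis.sel(1))
  then have "2 * pi / real n = 2 * pi / real m"
    by (rule cos_inj_pi[rotated 4])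
      (use two_pi_div_bounds[OF assms(1)] two_pi_div_bounds[OF assms(2)] in linarith)+
  then have "2 * pi / (2 * pi / real n) = 2 * pi / (2 * pi / real m)" by (rule arg_cong)
  then show ?thesis by simp
qed

lemma root_cis_mult_neq_1:
  assumes "3 \<le> n" "3 \<le> m"
  shows "root_cis n * root_cis m \<noteq> 1"
proof
  assume "root_cis n * root_cis m = 1"
  then have "root_cis m = cnj (root_cis n)" using cnj_root_cis[of n] by (metis mult.assoc mult.commute mult_1)
  then have "Im (root_cis m) = Im (cnj (root_cis n))" by simp
  then have "sin (2 * pi / m) = - sin (2 * pi / n)" by simp
  moreover have "sin (2 * pi / m) > 0" "sin (2 * pi / n) > 0"
    using two_pi_div_bounds[OF assms(1)] two_pi_div_bounds[OF assms(2)] by (auto intro: sin_gt_zero)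
  ultimately show False by simp
qed

text \<open>The polygon determines the pair of its edges at \<open>v\<close>. If the two
  descriptions named them in opposite order, \<open>root_cis n * root_cis m\<close> would be 1,
  which is impossible for exterior angles strictly between 0 and \<open>pi\<close>.\<close>

lemma polygon_at_inject:
  assumes "3 \<le> n" "3 \<le> m" "d \<noteq> 0" "e \<noteq> 0" "polygon_at n v d = polygon_at m v e"
  shows "n = m" "d = e"
proof -
  have iff: "y = v + d \<or> y = v - d * cnj (root_cis n) \<longleftrightarrow> y = v + e \<or> y = v - e * cnj (root_cis m)" for y
    using polygon_at_edge_iff assms by metis
  have "d = e \<and> d * cnj (root_cis n) = e * cnj (root_cis m)"
  proof (rule ccontr)
    assume no: "\<not> ?thesis"
    have "d = e \<or> d = - (e * cnj (root_cis m))" "e = d \<or> e = - (d * cnj (root_cis n))"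
      using iff[of "v + d"] iff[of "v + e"] by (simp_all add: diff_conv_add_uminus del: add_uminus_conv_diff)
    moreover have "d * cnj (root_cis n) = e * cnj (root_cis m) \<or> - (d * cnj (root_cis n)) = e"
      "e * cnj (root_cis m) = d * cnj (root_cis n) \<or> - (e * cnj (root_cis m)) = d"
      using iff[of "v - d * cnj (root_cis n)"] iff[of "v - e * cnj (root_cis m)"]
      by (auto simp: diff_conv_add_uminus simp del: add_uminus_conv_diff)
    ultimately have de: "d = - (e * cnj (root_cis m))" "e = - (d * cnj (root_cis n))"
      using no by metis+
    have "d = - (- (d * cnj (root_cis n)) * cnj (root_cis m))" using de by metis
    then have "d * cnj (root_cis n * root_cis m) = d * 1" by (simp add: mult.assoc)
    then have "cnj (root_cis n * root_cis m) = cnj 1" using assms(3) by simp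
    then show False using root_cis_mult_neq_1[OF assms(1,2)] by (metis complex_cnj_cancel_iff)
  qed
  then have "d = e" "cnj (root_cis n) = cnj (root_cis m)" using assms(3) by auto
  then show "d = e" "n = m"
    using root_cis_inject[OF assms(1,2)] by (simp_all only: complex_cnj_cancel_iff)
qed

text \<open>Near \<open>v\<close> only the two side lines through \<open>v\<close> matter, and the
  direction points strictly inside both; the remaining conditions are strict at \<open>v\<close> and
  persist by continuity.\<close>

lemma polygon_at_sector:
  assumes "3 \<le> n" "d \<noteq> 0" "0 < \<phi>" "\<phi> < pi - 2 * pi / n"
  shows "\<forall>\<^sub>F \<epsilon> in at_right 0. v + of_real \<epsilon> * (d * cis \<phi>) \<in> interior (polygon_at n v d)"
proof -
  let ?r = "root_cis n"
  have r: "?r - 1 \<noteq> 0" using root_cis_neq_1[of n] assms by simp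
  define z where "z = d / (?r - 1)"
  have z: "z \<noteq> 0" "d = z * (?r - 1)" using assms r by (simp_all add: z_def)
  have sn: "0 < sin (pi / n)" using sin_pi_div_pos[of n] assms by simp
  have tight: "inner (z * w * cis (pi / n)) (d * cis \<phi>) < 0" if "w = 1 \<or> w = cnj ?r" for w
  proof -
    \<comment> \<open>these are the two edges at \<open>v\<close>\<close>
    define \<alpha> where "\<alpha> = (if w = 1 then pi / n else - (pi / n))"
    have "w * cis (pi / n) = cis \<alpha>" using that by (auto simp: \<alpha>_def cis_cnj cis_mult)
    then have "inner (z * w * cis (pi / n)) (d * cis \<phi>) =
        inner (z * cis \<alpha>) (z * ((2 * sin (pi / n)) *\<^sub>R cis (pi / 2 + pi / n + \<phi>)))"
      by (simp add: z(2) root_cis_minus_1 scaleR_conv_of_real mult.assoc flip: cis_mult)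
    also have "\<dots> = (cmod z)\<^sup>2 * (2 * sin (pi / n) * cos (\<alpha> - (pi / 2 + pi / n + \<phi>)))"
      by (simp only: inner_mult_left_complex inner_scaleR_right inner_cis)
    also have "cos (\<alpha> - (pi / 2 + pi / n + \<phi>)) = - sin (\<phi> + pi / n - \<alpha>)"
      by (simp add: cos_diff sin_add sin_diff cos_add algebra_simps)
    finally have eq: "inner (z * w * cis (pi / n)) (d * cis \<phi>) =
      (cmod z)\<^sup>2 * (2 * sin (pi / n) * - sin (\<phi> + pi / n - \<alpha>))" .
    have "\<phi> + pi / n - \<alpha> = \<phi> \<or> \<phi> + pi / n - \<alpha> = \<phi> + 2 * pi / n" by (simp add: \<alpha>_def)
    moreover have "0 < 2 * pi / n" using assms(1) by simp
    ultimately have "0 < \<phi> + pi / n - \<alpha>" "\<phi> + pi / n - \<alpha> < pi" using assms(3,4) by linarith+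
    then have "sin (\<phi> + pi / n - \<alpha>) > 0" by (rule sin_gt_zero)
    then have "(cmod z)\<^sup>2 * (2 * sin (pi / n) * - sin (\<phi> + pi / n - \<alpha>)) < 0"
      using sn z(1) by (simp add: mult_pos_pos)
    then show ?thesis unfolding eq .
  qed
  have "\<forall>\<^sub>F \<epsilon> in at_right 0. inner (z * w * cis (pi / n)) (z + of_real \<epsilon> * (d * cis \<phi>)) < (cmod z)\<^sup>2 * cos (pi / n)"
    if w: "w ^ n = 1" for w
  proof (cases "w = 1 \<or> w = cnj ?r")
    case True
    have "inner (z * w * cis (pi / n)) (z * 1) \<le> (cmod z)\<^sup>2 * cos (pi / n)"
      using assms w z by (intro ngon_vertex_side) auto
    moreover have "\<epsilon> * inner (z * w * cis (pi / n)) (d * cis \<phi>) < 0" if "\<epsilon> > 0" for \<epsilon>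
      using tight[OF True] that by (simp add: mult_pos_neg)
    ultimately have "inner (z * w * cis (pi / n)) (z + of_real \<epsilon> * (d * cis \<phi>)) < (cmod z)\<^sup>2 * cos (pi / n)"
      if "\<epsilon> > 0" for \<epsilon>
      using that by (fastforce simp: inner_add_right simp flip: scaleR_conv_of_real)
    then show ?thesis by (intro eventually_mono[OF eventually_at_right_less])
  next
    case False
    have "1 \<noteq> w * ?r"
      using False cnj_root_cis[of n] by (metis mult.assoc mult.right_neutral mult.commute)
    then have "inner (z * w * cis (pi / n)) (z * 1) \<noteq> (cmod z)\<^sup>2 * cos (pi / n)"
      using ngon_vertex_side(2)[OF assms(1) w, of 1 z] z(1) False by auto
    moreover have "inner (z * w * cis (pi / n)) (z * 1) \<le> (cmod z)\<^sup>2 * cos (pi / n)"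
      using assms w z by (intro ngon_vertex_side) auto
    ultimately have lt: "inner (z * w * cis (pi / n)) z < (cmod z)\<^sup>2 * cos (pi / n)" by simp
    have "((\<lambda>\<epsilon>. inner (z * w * cis (pi / n)) (z + of_real \<epsilon> * (d * cis \<phi>))) \<longlongrightarrow>
        inner (z * w * cis (pi / n)) (z + of_real 0 * (d * cis \<phi>))) (at_right 0)"
      by (intro tendsto_intros)
    then show ?thesis using lt by (intro order_tendstoD(2)) auto
  qed
  then have "\<forall>\<^sub>F \<epsilon> in at_right 0. \<forall>w\<in>{w. w ^ n = 1}.
      inner (z * w * cis (pi / n)) (z + of_real \<epsilon> * (d * cis \<phi>)) < (cmod z)\<^sup>2 * cos (pi / n)"
    using assms(1) by (intro eventually_ball_finite finite_roots_unity) auto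
  then show ?thesis
  proof eventually_elim
    case (elim \<epsilon>)
    then show ?case
      unfolding polygon_at_def z_def[symmetric]
      using assms(1) z(1) by (intro interior_ngonI) (auto simp: algebra_simps)
  qed
qed

section \<open>Vertices of tilings of type 4.6.12\<close>

lemma no_common_direction:
  assumes "3 \<le> n" "3 \<le> m" "d \<noteq> 0" "e \<noteq> 0"
    and "interior (polygon_at n v d) \<inter> interior (polygon_at m v e) = {}"
    and "0 < \<phi>" "\<phi> < pi - 2 * pi / n" "0 < \<psi>" "\<psi> < pi - 2 * pi / m"
  shows "d * cis \<phi> \<noteq> e * cis \<psi>"
proof
  assume eq: "d * cis \<phi> = e * cis \<psi>"
  have "\<forall>\<^sub>F \<epsilon> in at_right 0. v + of_real \<epsilon> * (d * cis \<phi>) \<in> interior (polygon_at n v d) \<inter> interior (polygon_at m v e)"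
    using polygon_at_sector[OF assms(1,3,6,7), of v] polygon_at_sector[OF assms(2,4,8,9), of v]
    unfolding eq by eventually_elim simp
  then show False unfolding assms(5) using trivial_limit_at_right_real by auto
qed

text \<open>In angles measured from \<open>d\<close>, the two corners are intervals beginning at
  \<open>0\<close> and at \<open>a\<close>. If they overlapped, a direction \<open>t\<close> beyond
  the start of one of them, with \<open>t\<close> half of the available room, would lie inside both.
  The second bound is the overlap across the angle \<open>2 * pi\<close>.\<close>

lemma sectors_disjoint:
  assumes nm: "3 \<le> n" "3 \<le> m" and d: "d \<noteq> 0"
    and disj: "interior (polygon_at n v d) \<inter> interior (polygon_at m v (d * cis a)) = {}"
    and a: "0 \<le> a" "a < 2 * pi"
  shows "pi - 2 * pi / n \<le> a" "a \<le> pi + 2 * pi / m"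
proof -
  have e: "d * cis a \<noteq> 0" using d by simp
  note no = no_common_direction[OF nm d e disj]
  have n: "0 < pi - 2 * pi / n" and m: "0 < pi - 2 * pi / m"
    using two_pi_div_bounds[OF nm(1)] two_pi_div_bounds[OF nm(2)] by auto
  show "pi - 2 * pi / n \<le> a"
  proof (rule ccontr)
    assume neg: "\<not> ?thesis"
    define t where "t = min (pi - 2 * pi / n - a) (pi - 2 * pi / m) / 2"
    have "0 < t" "2 * t \<le> pi - 2 * pi / n - a" "2 * t \<le> pi - 2 * pi / m"
      using neg m by (simp_all add: t_def)
    then have "0 < t" "a + t < pi - 2 * pi / n" "t < pi - 2 * pi / m" by linarith+
    then show False using no[of "a + t" t] a by (simp add: mult.assoc cis_mult)
  qed
  show "a \<le> pi + 2 * pi / m"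
  proof (rule ccontr)
    assume neg: "\<not> ?thesis"
    define t where "t = min (pi - 2 * pi / m - (2 * pi - a)) (pi - 2 * pi / n) / 2"
    have "0 < t" "2 * t \<le> pi - 2 * pi / m - (2 * pi - a)" "2 * t \<le> pi - 2 * pi / n"
      using neg n by (simp_all add: t_def)
    then have t: "0 < t" "2 * pi - a + t < pi - 2 * pi / m" "t < pi - 2 * pi / n" by linarith+
    have "cis a * cis (2 * pi - a + t) = cis t" by (simp add: cis_mult) (simp add: complex_eq_iff add.commute[of "2 * pi"])
    then show False using no[of t "2 * pi - a + t"] t a by (simp add: mult.assoc)
  qed
qed

text \<open>Let the square-hexagon edge at a vertex be the vector \<open>u\<close>. Then \<open>u * tile_dir b n\<close> is the edge from
  which the \<open>n\<close>-gon at this vertex is obtained by a counterclockwise turn; \<open>b\<close> says whether the square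
  is to the left of \<open>u\<close>.\<close>

definition tile_dir :: "bool \<Rightarrow> nat \<Rightarrow> complex" where
  "tile_dir b n = (if b then (if n = 4 then 1 else if n = 12 then \<i> else Complex (-1/2) (- sqrt 3 / 2))
    else (if n = 4 then - \<i> else if n = 12 then Complex (-1/2) (sqrt 3 / 2) else 1))"

lemma root_cis_values:
  "root_cis 4 = \<i>" "root_cis 6 = Complex (1/2) (sqrt 3 / 2)" "root_cis 12 = Complex (sqrt 3 / 2) (1/2)"
proof -
  have "2 * pi / real 4 = pi / 2" "2 * pi / real 6 = pi / 3" "2 * pi / real 12 = pi / 6" by simp_all
  then show "root_cis 4 = \<i>" "root_cis 6 = Complex (1/2) (sqrt 3 / 2)" "root_cis 12 = Complex (sqrt 3 / 2) (1/2)"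
    by (simp_all only: cis_pi_half complex_eq_iff cis.sel complex.sel cos_60 sin_60 cos_30 sin_30)
qed

text \<open>The interior angles 90, 120 and 150 degrees add up to a full turn, so the inequalities
  between disjoint corners are forced to be equalities. The two cyclic orders give the two values of
  \<open>b\<close>.\<close>

lemma corner_arrangement:
  assumes d: "d4 \<noteq> 0" "cmod d6 = cmod d4" "cmod d12 = cmod d4"
    and disj: "interior (polygon_at 4 v d4) \<inter> interior (polygon_at 6 v d6) = {}"
      "interior (polygon_at 4 v d4) \<inter> interior (polygon_at 12 v d12) = {}"
      "interior (polygon_at 6 v d6) \<inter> interior (polygon_at 12 v d12) = {}"
  obtains b u where "cmod u = cmod d4" "d4 = u * tile_dir b 4" "d6 = u * tile_dir b 6" "d12 = u * tile_dir b 12"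
proof -
  have polar: "\<exists>a. 0 \<le> a \<and> a < 2 * pi \<and> e = d4 * cis a" if "cmod e = cmod d4" for e
  proof -
    have "cmod (e / d4) = 1" using that d(1) by (simp add: norm_divide)
    then have "e / d4 = cis (Arg2pi (e / d4))"
      using Arg2pi[of "e / d4"] by (simp add: is_Arg_def cis_conv_exp)
    then have "e = d4 * cis (Arg2pi (e / d4))" using d(1) by (simp add: field_simps)
    then show ?thesis using Arg2pi[of "e / d4"] by blast
  qed
  obtain a where a: "0 \<le> a" "a < 2 * pi" "d6 = d4 * cis a" using polar[OF d(2)] by blast
  obtain b where b: "0 \<le> b" "b < 2 * pi" "d12 = d4 * cis b" using polar[OF d(3)] by blast
  have A: "pi / 2 \<le> a" "a \<le> pi + pi / 3"
    using sectors_disjoint[of 4 6 d4 v a] disj(1) d(1) a by simp_all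
  have B: "pi / 2 \<le> b" "b \<le> pi + pi / 6"
    using sectors_disjoint[of 4 12 d4 v b] disj(2) d(1) b by simp_all
  have d6: "d6 \<noteq> 0" "d12 \<noteq> 0" using d by (metis norm_eq_zero)+
  show thesis
  proof (cases "a \<le> b")
    \<comment> \<open>Counterclockwise the order is square, hexagon, dodecagon; the square-hexagon
      edge is the second edge \<open>\<i> * d4\<close> of the square, with the square on its
      right.\<close>
    case True
    have "d12 = d6 * cis (b - a)" by (simp add: a b cis_mult)
    from sectors_disjoint(1)[OF _ _ d6(1) disj(3)[unfolded this]] have "pi - pi / 3 \<le> b - a"
      using True a b by simp
    then have ab: "a = pi / 2" "b = pi + pi / 6" using A B by linarith+
    have "d6 = \<i> * d4" by (simp add: a(3) ab)
    moreover have "d12 = d4 * Complex (- sqrt 3 / 2) (- 1 / 2)"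
    proof -
      have "cis (pi + pi / 6) = Complex (- sqrt 3 / 2) (- 1 / 2)"
        by (simp only: complex_eq_iff cis.sel complex.sel cos_periodic_pi2 sin_periodic_pi2 cos_30 sin_30) simp
      then show ?thesis unfolding b(3) ab by simp
    qed
    ultimately show thesis
      by (intro that[of "\<i> * d4" False])
        (simp_all add: tile_dir_def norm_mult complex_eq_iff)
  next
    \<comment> \<open>Here the dodecagon follows the square, so the square-hexagon edge is the first
      edge \<open>d4\<close> itself, with the square on its left.\<close>
    case False
    have "d6 = d12 * cis (a - b)" by (simp add: a b cis_mult)
    from sectors_disjoint(1)[OF _ _ d6(2) disj(3)[unfolded this Int_commute[of "interior (polygon_at 6 _ _)"]]]
    have "pi - pi / 6 \<le> a - b" using False a b by simp
    then have ab: "a = pi + pi / 3" "b = pi / 2" using A B by linarith+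
    have "d12 = \<i> * d4" by (simp add: b(3) ab)
    moreover have "d6 = d4 * Complex (- 1 / 2) (- sqrt 3 / 2)"
    proof -
      have "cis (pi + pi / 3) = Complex (- 1 / 2) (- sqrt 3 / 2)"
        by (simp only: complex_eq_iff cis.sel complex.sel cos_periodic_pi2 sin_periodic_pi2 cos_60 sin_60) simp
      then show ?thesis unfolding a(3) ab by simp
    qed
    ultimately show thesis
      by (intro that[of d4 True]) (simp_all add: tile_dir_def)
  qed
qed

text \<open>The three edges at a vertex relative to \<open>u\<close>: square-hexagon, square-dodecagon and
  hexagon-dodecagon.\<close>

definition edge_dir :: "bool \<Rightarrow> nat \<Rightarrow> complex" where
  "edge_dir b k = (if k = 0 then 1 else if k = 1 then (if b then \<i> else - \<i>)
     else Complex (-1/2) (if b then - sqrt 3 / 2 else sqrt 3 / 2))"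

text \<open>Each of the three edges is the first edge of one tile and the second edge of another;
  these are its two names.\<close>

lemma dir_values:
  "tile_dir True 4 = edge_dir True 0" "tile_dir True 12 = edge_dir True 1" "tile_dir True 6 = edge_dir True 2"
  "tile_dir False 4 = edge_dir False 1" "tile_dir False 12 = edge_dir False 2" "tile_dir False 6 = edge_dir False 0"
  "- (edge_dir True 0 * cnj (root_cis 4)) = edge_dir True 1" "- (edge_dir True 1 * cnj (root_cis 12)) = edge_dir True 2"
  "- (edge_dir True 2 * cnj (root_cis 6)) = edge_dir True 0"
  "- (edge_dir False 1 * cnj (root_cis 4)) = edge_dir False 0" "- (edge_dir False 2 * cnj (root_cis 12)) = edge_dir False 1"
  "- (edge_dir False 0 * cnj (root_cis 6)) = edge_dir False 2"
  unfolding root_cis_values by (simp_all add: tile_dir_def edge_dir_def complex_eq_iff)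

lemma norm_edge_dir: "cmod (edge_dir b k) = 1"
  by (simp add: edge_dir_def cmod_def power2_eq_square)

lemma norm_tile_dir: "cmod (tile_dir b n) = 1"
  by (simp add: tile_dir_def cmod_def power2_eq_square)

section \<open>Corners of an arbitrary tiling of type 4.6.12\<close>

locale tiling_4_6_12 =
  fixes T :: "complex set set" and s :: real
  assumes tiling: "plane_tiling T" and edge: "edge_to_edge T"
    and tiles: "\<And>P. P \<in> T \<Longrightarrow> \<exists>n\<in>{4, 6, 12}. regular_polygon n s P"
    and vertices: "\<And>v n. v \<in> tiling_vertices T \<Longrightarrow> n \<in> {4, 6, 12} \<Longrightarrow>
      \<exists>!P. P \<in> T \<and> regular_polygon n s P \<and> v \<in> P"
begin

text \<open>Tiles meet in common faces, and extreme points of a face are extreme in the whole. So no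
  vertex lies in the middle of a side of another tile.\<close>

lemma vertex_extreme:
  assumes "v \<in> tiling_vertices T" "Q \<in> T" "v \<in> Q"
  shows "v extreme_point_of Q"
proof -
  obtain P where P: "P \<in> T" "v extreme_point_of P" using assms(1) by (auto simp: tiling_vertices_def)
  show ?thesis
  proof (cases "P = Q")
    case False
    then have f: "(P \<inter> Q) face_of P" "(P \<inter> Q) face_of Q"
      using edge P(1) assms(2) by (auto simp: edge_to_edge_def)
    have "v extreme_point_of P \<inter> Q"
      using extreme_point_of_face[OF f(1)] P(2) assms(3) by (auto simp: extreme_point_of_def)
    then show ?thesis using extreme_point_of_face[OF f(2)] by blast
  qed (use P in simp)
qed

lemma corner_tile:
  assumes "v \<in> tiling_vertices T" "n \<in> {4, 6, 12}"
  obtains d where "d \<noteq> 0" "cmod d = s" "polygon_at n v d \<in> T"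
proof -
  obtain P where P: "P \<in> T" "regular_polygon n s P" "v \<in> P" using vertices[OF assms] by blast
  have "3 \<le> n" using assms(2) by auto
  then obtain d where "d \<noteq> 0" "cmod d = s" "P = polygon_at n v d"
    using regular_polygon_vertexE P(2) vertex_extreme[OF assms(1) P(1,3)] by metis
  then show thesis using that P(1) by blast
qed

lemma side_pos: "v \<in> tiling_vertices T \<Longrightarrow> 0 < s"
  by (rule corner_tile[of v 4]) auto

lemma corner_tile_unique:
  assumes "v \<in> tiling_vertices T" "n \<in> {4, 6, 12}"
    and "polygon_at n v d \<in> T" "cmod d = s" "polygon_at n v e \<in> T" "cmod e = s"
  shows "d = e"
proof -
  have n: "3 \<le> n" using assms(2) by auto
  have ne: "d \<noteq> 0" "e \<noteq> 0" using side_pos[OF assms(1)] assms by auto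
  have "regular_polygon n s (polygon_at n v d)" "regular_polygon n s (polygon_at n v e)"
    using regular_polygon_at[OF n] ne assms by metis+
  moreover have "v \<in> polygon_at n v d" "v \<in> polygon_at n v e"
    using extreme_point_polygon_at[OF n] by (auto simp: extreme_point_of_def)
  ultimately have "polygon_at n v d = polygon_at n v e"
    using vertices[OF assms(1,2)] assms(3,5) by blast
  then show ?thesis using polygon_at_inject(2)[OF n n ne] by blast
qed

lemma tile_polygon_at:
  assumes "v \<in> tiling_vertices T" "P \<in> T" "v \<in> P"
  obtains n d where "n \<in> {4, 6, 12}" "cmod d = s" "P = polygon_at n v d"
proof -
  obtain n where n: "n \<in> {4, 6, 12}" "regular_polygon n s P" using tiles[OF assms(2)] by blast
  then have "3 \<le> n" by auto
  then show thesis
    using regular_polygon_vertexE[OF _ n(2) vertex_extreme[OF assms]] that n(1) by metis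
qed

text \<open>The pair of orientation \<open>b\<close> and frame \<open>u\<close> turns out to be a
  function of \<open>v\<close>; the relational form lets it be carried along edges without
  choices.\<close>

definition corner :: "complex \<Rightarrow> bool \<Rightarrow> complex \<Rightarrow> bool" where
  "corner v b u \<longleftrightarrow> v \<in> tiling_vertices T \<and> cmod u = s \<and> (\<forall>n\<in>{4, 6, 12}. polygon_at n v (u * tile_dir b n) \<in> T)"

lemma corner_exists:
  assumes "v \<in> tiling_vertices T"
  obtains b u where "corner v b u"
proof -
  obtain d4 where d4: "d4 \<noteq> 0" "cmod d4 = s" "polygon_at 4 v d4 \<in> T"
    using corner_tile[OF assms, of 4] by auto
  obtain d6 where d6: "d6 \<noteq> 0" "cmod d6 = s" "polygon_at 6 v d6 \<in> T"
    using corner_tile[OF assms, of 6] by auto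
  obtain d12 where d12: "d12 \<noteq> 0" "cmod d12 = s" "polygon_at 12 v d12 \<in> T"
    using corner_tile[OF assms, of 12] by auto
  have "polygon_at 4 v d4 \<noteq> polygon_at 6 v d6" "polygon_at 4 v d4 \<noteq> polygon_at 12 v d12"
    "polygon_at 6 v d6 \<noteq> polygon_at 12 v d12"
    using polygon_at_inject(1)[of 4 6 d4 d6 v] polygon_at_inject(1)[of 4 12 d4 d12 v]
      polygon_at_inject(1)[of 6 12 d6 d12 v] d4(1) d6(1) d12(1) by auto
  then have "interior (polygon_at 4 v d4) \<inter> interior (polygon_at 6 v d6) = {}"
    "interior (polygon_at 4 v d4) \<inter> interior (polygon_at 12 v d12) = {}"
    "interior (polygon_at 6 v d6) \<inter> interior (polygon_at 12 v d12) = {}"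
    using tiling d4(3) d6(3) d12(3) by (auto simp: plane_tiling_def)
  then obtain b u where "cmod u = cmod d4" "d4 = u * tile_dir b 4" "d6 = u * tile_dir b 6" "d12 = u * tile_dir b 12"
    using d4 d6 d12 by (rule_tac corner_arrangement[of d4 d6 d12 v]) auto
  then show thesis using that assms d4 d6 d12 by (simp add: corner_def)
qed

lemma corner_determined:
  assumes "corner v b u" "n \<in> {4, 6, 12}" "polygon_at n v x \<in> T" "cmod x = s"
  shows "u * tile_dir b n = x"
  using assms by (intro corner_tile_unique[of v n]) (auto simp: corner_def norm_mult norm_tile_dir)

lemma corner_unique:
  assumes "corner v b u" "corner v b' u'"
  shows "b = b'" "u = u'"
proof -
  have eq: "u * tile_dir b n = u' * tile_dir b' n" if "n \<in> {4, 6, 12}" for n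
    using assms that by (intro corner_determined[OF assms(1)]) (auto simp: corner_def norm_mult norm_tile_dir)
  have u: "u \<noteq> 0" "u' \<noteq> 0" using assms side_pos by (auto simp: corner_def)
  \<comment> \<open>Cross-multiplying eliminates the frames: the ratio of the directions of square
    and hexagon depends on \<open>b\<close> alone, and differently for the two orientations.\<close>
  have "tile_dir b 4 * tile_dir b' 6 = tile_dir b 6 * tile_dir b' 4"
  proof -
    have "(u * u') * (tile_dir b 4 * tile_dir b' 6) = (u * tile_dir b 4) * (u' * tile_dir b' 6)" by simp
    also have "\<dots> = (u * u') * (tile_dir b 6 * tile_dir b' 4)" unfolding eq[of 4, simplified] eq[of 6, simplified, symmetric] by simp
    finally show ?thesis using u by simp
  qed
  then show b: "b = b'" by (cases b; cases b') (simp_all add: tile_dir_def complex_eq_iff)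
  have "tile_dir b 4 \<noteq> 0" using norm_tile_dir[of b 4] by auto
  then show "u = u'" using eq[of 4] b by simp
qed

text \<open>Each of the three tiles contributes its two edges at \<open>v\<close>, and neighbouring
  tiles share one, which leaves three. No other tile contains \<open>v\<close>.\<close>

lemma corner_neighbours:
  assumes "corner v b u"
  shows "{v, y} \<in> edges (tiling_graph T) \<longleftrightarrow> y \<in> {v + u * edge_dir b 0, v + u * edge_dir b 1, v + u * edge_dir b 2}"
proof -
  have v: "v \<in> tiling_vertices T" and u: "u \<noteq> 0"
    using assms side_pos by (auto simp: corner_def)
  have ends: "closed_segment v y edge_of polygon_at n v (u * tile_dir b n) \<longleftrightarrow>
      y = v + u * tile_dir b n \<or> y = v - u * tile_dir b n * cnj (root_cis n)" if "3 \<le> n" for n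
    using that u norm_tile_dir[of b n] by (intro polygon_at_edge_iff) auto
  have "{v, y} \<in> edges (tiling_graph T) \<longleftrightarrow> (\<exists>n\<in>{4, 6, 12}. closed_segment v y edge_of polygon_at n v (u * tile_dir b n))"
  proof
    assume "{v, y} \<in> edges (tiling_graph T)"
    then obtain P where P: "P \<in> T" "closed_segment v y edge_of P"
      by (auto simp: tiling_graph_def doubleton_eq_iff closed_segment_commute)
    then have "v \<in> P" using edge_of_imp_subset by force
    then obtain n d where n: "n \<in> {4, 6, 12}" "cmod d = s" "P = polygon_at n v d"
      using tile_polygon_at[OF v P(1)] by blast
    then have "u * tile_dir b n = d" using P(1) by (intro corner_determined[OF assms]) auto
    then show "\<exists>n\<in>{4, 6, 12}. closed_segment v y edge_of polygon_at n v (u * tile_dir b n)"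
      using P n by blast
  next
    assume "\<exists>n\<in>{4, 6, 12}. closed_segment v y edge_of polygon_at n v (u * tile_dir b n)"
    then obtain P where P: "P \<in> T" "closed_segment v y edge_of P" using assms by (auto simp: corner_def)
    have "v \<noteq> y" using P(2) by (auto simp: edge_of_def)
    then show "{v, y} \<in> edges (tiling_graph T)" using P by (auto simp: tiling_graph_def)
  qed
  also have "\<dots> \<longleftrightarrow> (\<exists>n\<in>{4, 6, 12}. y = v + u * tile_dir b n \<or> y = v - u * tile_dir b n * cnj (root_cis n))"
    using ends by auto
  also have "\<dots> \<longleftrightarrow> y \<in> {v + u * edge_dir b 0, v + u * edge_dir b 1, v + u * edge_dir b 2}"
  proof -
    have neg: "y = v - u * tile_dir b n * cnj (root_cis n) \<longleftrightarrow> y = v + u * (- (tile_dir b n * cnj (root_cis n)))" for n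
      by (simp add: mult.assoc)
    show ?thesis
    proof (cases b)
      case True
      then have b: "b = True" by simp
      show ?thesis unfolding neg unfolding b bex_simps dir_values by blast
    next
      case False
      then have b: "b = False" by simp
      show ?thesis unfolding neg unfolding b bex_simps dir_values by blast
    qed
  qed
  finally show ?thesis .
qed

text \<open>Both tiles along an edge are known at its far end by \<open>polygon_at_next\<close> and
  \<open>polygon_at_prev\<close>, and two tiles already determine the corner there. The orientation
  flips along every edge, which matches the bipartition into major and minor.\<close>

lemma corner_adjacent:
  assumes "corner v b u"
  shows "corner (v + u * edge_dir b 0) (\<not> b) (- u)"
    and "corner (v + u * edge_dir b 1) (\<not> b) u"
    and "corner (v + u * edge_dir b 2) (\<not> b) (u * (if b then cnj (root_cis 6) else root_cis 6))"
proof -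
  have v: "v \<in> tiling_vertices T" and nu: "cmod u = s" and u: "u \<noteq> 0"
    using assms side_pos by (auto simp: corner_def)
  have at: "polygon_at 4 v (u * tile_dir b 4) \<in> T" "polygon_at 6 v (u * tile_dir b 6) \<in> T"
    "polygon_at 12 v (u * tile_dir b 12) \<in> T" using assms by (auto simp: corner_def)
  have "polygon_at n (v + u * tile_dir b n) (u * (tile_dir b n * root_cis n)) \<in> T \<and>
      polygon_at n (v + u * - (tile_dir b n * cnj (root_cis n))) (u * (tile_dir b n * cnj (root_cis n))) \<in> T"
    if "n \<in> {4, 6, 12}" for n
    using that at polygon_at_next[of n v "u * tile_dir b n"] polygon_at_prev[of n v "u * tile_dir b n"]
    by (auto simp: mult.assoc)
  then have nb: "polygon_at 4 (v + u * tile_dir b 4) (u * (tile_dir b 4 * root_cis 4)) \<in> T"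
    "polygon_at 6 (v + u * tile_dir b 6) (u * (tile_dir b 6 * root_cis 6)) \<in> T"
    "polygon_at 12 (v + u * tile_dir b 12) (u * (tile_dir b 12 * root_cis 12)) \<in> T"
    "polygon_at 4 (v + u * - (tile_dir b 4 * cnj (root_cis 4))) (u * (tile_dir b 4 * cnj (root_cis 4))) \<in> T"
    "polygon_at 6 (v + u * - (tile_dir b 6 * cnj (root_cis 6))) (u * (tile_dir b 6 * cnj (root_cis 6))) \<in> T"
    "polygon_at 12 (v + u * - (tile_dir b 12 * cnj (root_cis 12))) (u * (tile_dir b 12 * cnj (root_cis 12))) \<in> T"
    by blast+
  \<comment> \<open>\<open>x\<close> and \<open>x'\<close> are the first edges at \<open>w\<close>
    of the two known tiles in units of \<open>u\<close>. The inequality says that their relative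
    position contradicts orientation \<open>b\<close>; the frame \<open>u * y\<close> is then read
    off from one tile.\<close>
  have main: "corner w (\<not> b) (u * y)"
    if "n \<in> {4, 6, 12}" "m \<in> {4, 6, 12}" "polygon_at n w (u * x) \<in> T" "polygon_at m w (u * x') \<in> T"
      "cmod x = 1" "cmod x' = 1"
      "tile_dir b n * x' \<noteq> tile_dir b m * x" "y * tile_dir (\<not> b) n = x" for w n m x x' y
  proof -
    have "3 \<le> n" using that(1) by auto
    then have "w \<in> tiling_vertices T"
      using that(3) extreme_point_polygon_at by (auto simp: tiling_vertices_def)
    then obtain b' u' where c: "corner w b' u'" by (rule corner_exists)
    have x: "u' * tile_dir b' n = u * x" "u' * tile_dir b' m = u * x'"
      using that nu by (auto intro!: corner_determined[OF c] simp: norm_mult)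
    have u': "u' \<noteq> 0" using x(1) u that(5) by auto
    have "b' \<noteq> b"
    proof
      assume "b' = b"
      have "u' * u * (tile_dir b n * x') = (u' * tile_dir b n) * (u * x')" by simp
      also have "\<dots> = u' * u * (tile_dir b m * x)" using x unfolding \<open>b' = b\<close> by (metis mult.assoc mult.commute)
      finally show False using u u' that(7) by simp
    qed
    then have b': "b' = (\<not> b)" by blast
    have "u' * tile_dir (\<not> b) n = u * y * tile_dir (\<not> b) n" using x(1) that(8) unfolding b' by (simp add: mult.assoc)
    moreover have "tile_dir (\<not> b) n \<noteq> 0" using norm_tile_dir[of "\<not> b" n] by auto
    ultimately show ?thesis using c unfolding b' by simp
  qed
  have norm: "cmod (edge_dir c k * root_cis n) = 1" "cmod (edge_dir c k * cnj (root_cis n)) = 1" for c k n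
    by (simp_all add: norm_mult norm_edge_dir)
  have "corner (v + u * edge_dir b 0) (\<not> b) (u * - 1) \<and> corner (v + u * edge_dir b 1) (\<not> b) (u * 1)
    \<and> corner (v + u * edge_dir b 2) (\<not> b) (u * (if b then cnj (root_cis 6) else root_cis 6))"
  proof (cases b)
    case True
    then have b: "b = True" by simp
    have n: "tile_dir True 4 * (tile_dir True 6 * cnj (root_cis 6)) \<noteq> tile_dir True 6 * (tile_dir True 4 * root_cis 4)"
      "- 1 * tile_dir (\<not> True) 4 = tile_dir True 4 * root_cis 4"
      "tile_dir True 4 * (tile_dir True 12 * root_cis 12) \<noteq> tile_dir True 12 * (tile_dir True 4 * cnj (root_cis 4))"
      "1 * tile_dir (\<not> True) 4 = tile_dir True 4 * cnj (root_cis 4)"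
      "tile_dir True 6 * (tile_dir True 12 * cnj (root_cis 12)) \<noteq> tile_dir True 12 * (tile_dir True 6 * root_cis 6)"
      "cnj (root_cis 6) * tile_dir (\<not> True) 6 = tile_dir True 6 * root_cis 6"
      unfolding root_cis_values by (simp_all add: tile_dir_def complex_eq_iff)
    have "corner (v + u * edge_dir True 0) (\<not> True) (u * - 1)"
      by (rule main[of 4 6 _ "tile_dir True 4 * root_cis 4" "tile_dir True 6 * cnj (root_cis 6)" "- 1", unfolded b])
        (use nb n norm in \<open>simp_all only: b dir_values insert_iff simp_thms\<close>)
    moreover have "corner (v + u * edge_dir True 1) (\<not> True) (u * 1)"
      by (rule main[of 4 12 _ "tile_dir True 4 * cnj (root_cis 4)" "tile_dir True 12 * root_cis 12" 1, unfolded b])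
        (use nb n norm in \<open>simp_all only: b dir_values insert_iff simp_thms\<close>)
    moreover have "corner (v + u * edge_dir True 2) (\<not> True) (u * cnj (root_cis 6))"
      by (rule main[of 6 12 _ "tile_dir True 6 * root_cis 6" "tile_dir True 12 * cnj (root_cis 12)" "cnj (root_cis 6)", unfolded b])
        (use nb n norm in \<open>simp_all only: b dir_values insert_iff simp_thms\<close>)
    ultimately show ?thesis unfolding b by simp
  next
    case False
    then have b: "b = False" by simp
    have n: "tile_dir False 4 * (tile_dir False 6 * root_cis 6) \<noteq> tile_dir False 6 * (tile_dir False 4 * cnj (root_cis 4))"
      "- 1 * tile_dir (\<not> False) 4 = tile_dir False 4 * cnj (root_cis 4)"
      "tile_dir False 4 * (tile_dir False 12 * cnj (root_cis 12)) \<noteq> tile_dir False 12 * (tile_dir False 4 * root_cis 4)"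
      "1 * tile_dir (\<not> False) 4 = tile_dir False 4 * root_cis 4"
      "tile_dir False 6 * (tile_dir False 12 * root_cis 12) \<noteq> tile_dir False 12 * (tile_dir False 6 * cnj (root_cis 6))"
      "root_cis 6 * tile_dir (\<not> False) 6 = tile_dir False 6 * cnj (root_cis 6)"
      unfolding root_cis_values by (simp_all add: tile_dir_def complex_eq_iff)
    have "corner (v + u * edge_dir False 0) (\<not> False) (u * - 1)"
      by (rule main[of 4 6 _ "tile_dir False 4 * cnj (root_cis 4)" "tile_dir False 6 * root_cis 6" "- 1", unfolded b])
        (use nb n norm in \<open>simp_all only: b dir_values insert_iff simp_thms\<close>)
    moreover have "corner (v + u * edge_dir False 1) (\<not> False) (u * 1)"
      by (rule main[of 4 12 _ "tile_dir False 4 * root_cis 4" "tile_dir False 12 * cnj (root_cis 12)" 1, unfolded b])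
        (use nb n norm in \<open>simp_all only: b dir_values insert_iff simp_thms\<close>)
    moreover have "corner (v + u * edge_dir False 2) (\<not> False) (u * root_cis 6)"
      by (rule main[of 6 12 _ "tile_dir False 6 * cnj (root_cis 6)" "tile_dir False 12 * root_cis 12" "root_cis 6", unfolded b])
        (use nb n norm in \<open>simp_all only: b dir_values insert_iff simp_thms\<close>)
    ultimately show ?thesis unfolding b by simp
  qed
  then show "corner (v + u * edge_dir b 0) (\<not> b) (- u)" "corner (v + u * edge_dir b 1) (\<not> b) u"
    "corner (v + u * edge_dir b 2) (\<not> b) (u * (if b then cnj (root_cis 6) else root_cis 6))"
    by simp_all
qed

end

section \<open>The covering\<close>

text \<open>The number of completed sixths of a turn in the direction of \<open>u\<close>, doubled.
  Rounding down makes this meaningful for every direction, and the jump of \<open>Arg2pi\<close> at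
  a full turn disappears modulo 12.\<close>

definition turns :: "complex \<Rightarrow> pitch_class" where
  "turns u = of_int (2 * \<lfloor>3 * Arg2pi u / pi\<rfloor>)"

lemma turns_even: "turns u \<in> even_pitch"
  by (simp add: turns_def even_pitch_def)

lemma turns_rotate:
  assumes "u \<noteq> 0"
  shows "turns (u * root_cis 6) = turns u + 2"
proof -
  define a where "a = Arg2pi u"
  have a: "0 \<le> a" "a < 2 * pi" "u = cmod u * cis a"
    using Arg2pi[of u] by (simp_all add: a_def is_Arg_def cis_conv_exp mult.commute)
  have r: "u * root_cis 6 = cmod u * cis (a + pi / 3)"
    by (subst a(3)) (simp add: cis_mult)
  show ?thesis
  proof (cases "a + pi / 3 < 2 * pi")
    case True
    have "Arg2pi (u * root_cis 6) = a + pi / 3"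
      unfolding r using True a assms by (intro Arg2pi_unique[of "cmod u"]) (simp_all add: cis_conv_exp)
    then have "3 * Arg2pi (u * root_cis 6) / pi = 3 * a / pi + 1"
      by (simp add: add_divide_distrib)
    then show ?thesis unfolding turns_def a_def[symmetric] by simp
  next
    \<comment> \<open>The argument wraps around: the count of sixths changes by 1 - 6 = -5, and
      doubled this is -10 = 2 in Z/12.\<close>
    case False
    have "cis (x - 2 * pi) = cis x" for x by (simp flip: cis_divide)
    from this[of "a + pi / 3"] have "Arg2pi (u * root_cis 6) = a + pi / 3 - 2 * pi"
      unfolding r using False a assms pi_gt_zero
      by (intro Arg2pi_unique[of "cmod u"]) (simp_all add: cis_conv_exp)
    then have "3 * Arg2pi (u * root_cis 6) / pi = 3 * a / pi - 5"
      by (simp add: add_divide_distrib diff_divide_distrib)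
    then show ?thesis unfolding turns_def a_def[symmetric] by simp
  qed
qed

lemma turns_rotate_back: "u \<noteq> 0 \<Longrightarrow> turns (u * cnj (root_cis 6)) = turns u - 2"
  using turns_rotate[of "u * cnj (root_cis 6)"] by (simp only: mult.assoc cnj_root_cis mult_1_right) simp

lemma turns_minus:
  assumes "u \<noteq> 0"
  shows "turns (- u) = turns u + 6"
proof -
  have "- u = u * root_cis 6 * root_cis 6 * root_cis 6"
    unfolding root_cis_values by (simp add: complex_eq_iff field_simps)
  moreover have "u * root_cis 6 \<noteq> 0" "u * root_cis 6 * root_cis 6 \<noteq> 0" using assms by simp_all
  note turns_rotate[OF this(2)] turns_rotate[OF this(1)] turns_rotate[OF assms]
  ultimately show ?thesis by (simp only:) simp
qed

text \<open>The offset 7 is the root difference along the edge that keeps \<open>u\<close>. From a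
  major triad, reversing \<open>u\<close> makes it 13 = 1, and turning \<open>u\<close> back by a
  sixth makes it 5.\<close>

definition triad_at :: "pitch_class \<Rightarrow> bool \<Rightarrow> complex \<Rightarrow> pitch_class set" where
  "triad_at p b u = (if b then major_triad (turns u + p) else minor_triad (turns u + p + 7))"

lemma triad_at_in_class: "triad_at p b u \<in> triad_class p"
proof -
  have "6 + turns u \<in> even_pitch"
    by (rule even_pitch_add[OF _ turns_even]) (simp add: even_pitch_eq)
  then show ?thesis using turns_even by (simp add: triad_at_def major_in_class minor_in_class)
qed

lemma triad_at_edges:
  assumes "u \<noteq> 0"
  shows "edges_at triad_graph (triad_at p b u) =
    {{triad_at p b u, triad_at p (\<not> b) (- u)}, {triad_at p b u, triad_at p (\<not> b) u},
     {triad_at p b u, triad_at p (\<not> b) (u * (if b then cnj (root_cis 6) else root_cis 6))}}"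
proof (cases b)
  case True
  have "turns u + 6 + p + 7 = turns u + p + 1" "turns u - 2 + p + 7 = turns u + p + 5"
    by (simp_all add: algebra_simps)
  then show ?thesis
    using True unfolding triad_at_def
    by (simp only: triad_edges_at_major turns_minus[OF assms] turns_rotate_back[OF assms] if_False if_True
        simp_thms) blast
next
  case False
  have "turns u + 6 + p = turns u + p + 7 - 1" "turns u + 2 + p = turns u + p + 7 - 5"
    "turns u + p = turns u + p + 7 - 7"
    by (simp_all add: algebra_simps)
  then show ?thesis
    using False unfolding triad_at_def by (simp only: triad_edges_at_minor turns_minus[OF assms] turns_rotate[OF assms] if_False if_True
      simp_thms insert_commute[of "minor_triad _" "major_triad _"]) blast
qed

context tiling_4_6_12
begin

definition label :: "pitch_class \<Rightarrow> complex \<Rightarrow> pitch_class set" where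
  "label p v = triad_at p (THE b. \<exists>u. corner v b u) (THE u. \<exists>b. corner v b u)"

lemma label_corner:
  assumes "corner v b u"
  shows "label p v = triad_at p b u"
proof -
  have "(THE b. \<exists>u. corner v b u) = b" "(THE u. \<exists>b. corner v b u) = u"
    by (rule the_equality; use assms corner_unique in blast)+
  then show ?thesis by (simp add: label_def)
qed

lemma edges_at_tiling_graph: "edges_at (tiling_graph T) v = {{v, y} | y. {v, y} \<in> edges (tiling_graph T)}"
  by (auto simp: edges_at_def tiling_graph_def insert_commute)

lemma edges_at_corner:
  assumes "corner v b u"
  shows "edges_at (tiling_graph T) v = {{v, v + u * edge_dir b 0}, {v, v + u * edge_dir b 1}, {v, v + u * edge_dir b 2}}"
  unfolding edges_at_tiling_graph corner_neighbours[OF assms] by auto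

lemma label_edges_at:
  assumes "v \<in> tiling_vertices T"
  shows "(`) (label p) ` edges_at (tiling_graph T) v = edges_at triad_graph (label p v)"
    "inj_on ((`) (label p)) (edges_at (tiling_graph T) v)"
proof -
  obtain b u where c: "corner v b u" using corner_exists[OF assms] by blast
  have u: "u \<noteq> 0" using c side_pos by (auto simp: corner_def)
  note adj = corner_adjacent[OF c, THEN label_corner, of p]
  show img: "(`) (label p) ` edges_at (tiling_graph T) v = edges_at triad_graph (label p v)"
    unfolding edges_at_corner[OF c] image_insert image_empty adj label_corner[OF c] triad_at_edges[OF u] ..
  have "label p v \<in> verts triad_graph"
    unfolding label_corner[OF c] using triad_at_in_class triad_class_subset by blast
  \<comment> \<open>Injectivity by counting: at most three edges are mapped onto three
    edges.\<close>
  then have "card ((`) (label p) ` edges_at (tiling_graph T) v) = 3"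
    unfolding img using regular_triad_graph by (auto simp: regular_of_degree_def)
  moreover have "finite (edges_at (tiling_graph T) v)" "card (edges_at (tiling_graph T) v) \<le> 3"
    unfolding edges_at_corner[OF c] by (auto simp: card_insert_if)
  ultimately show "inj_on ((`) (label p)) (edges_at (tiling_graph T) v)"
    using card_image_le eq_card_imp_inj_on by (metis le_antisym)
qed

lemma vertex_exists: "tiling_vertices T \<noteq> {}"
proof -
  obtain P where P: "P \<in> T" using tiling unfolding plane_tiling_def by (metis UNIV_I UnionE)
  then obtain n where n: "n \<in> {4, 6, 12}" "regular_polygon n s P" using tiles by blast
  then have "0 < n" by auto
  then obtain c z where "P = ngon n c z" using n(2) regular_polygon_iff_ngon by blast
  then have "(c + z * 1) extreme_point_of P" using extreme_point_of_ngon_iff[OF \<open>0 < n\<close>] by (metis power_one)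
  then show ?thesis using P by (auto simp: tiling_vertices_def)
qed

lemma edge_endpoint:
  assumes "{v, y} \<in> edges (tiling_graph T)"
  shows "v \<in> tiling_vertices T"
proof -
  obtain P where "P \<in> T" "closed_segment v y edge_of P"
    using assms by (auto simp: tiling_graph_def doubleton_eq_iff closed_segment_commute)
  then show ?thesis using segment_face_of(1) by (auto simp: tiling_vertices_def edge_of_def)
qed

text \<open>Path lifting: every edge at \<open>label p v\<close> is the image of an edge at
  \<open>v\<close>, so the image is closed under adjacency and, by connectedness of the class, is
  all of it.\<close>

lemma label_image: "label p ` tiling_vertices T = triad_class p"
proof
  show "label p ` tiling_vertices T \<subseteq> triad_class p"
    using corner_exists label_corner triad_at_in_class by (metis image_subsetI)
  obtain v where v: "v \<in> tiling_vertices T" using vertex_exists by blast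
  show "triad_class p \<subseteq> label p ` tiling_vertices T"
  proof
    fix w assume "w \<in> triad_class p"
    moreover have "label p v \<in> triad_class p" using v corner_exists label_corner triad_at_in_class by metis
    ultimately have "reachable triad_graph (label p v) w" using triad_class_connected by blast
    moreover have "label p v \<in> label p ` tiling_vertices T" using v by blast
    ultimately show "w \<in> label p ` tiling_vertices T"
    proof (rule reachable_closed)
      fix a b assume "a \<in> label p ` tiling_vertices T" and ab: "{a, b} \<in> edges triad_graph"
      then obtain x where x: "x \<in> tiling_vertices T" "a = label p x" by blast
      have "{a, b} \<in> edges_at triad_graph (label p x)" using ab x by (simp add: edges_at_def)
      then obtain y where y: "{x, y} \<in> edges (tiling_graph T)" "{a, b} = label p ` {x, y}"
        unfolding label_edges_at(1)[OF x(1), symmetric] edges_at_tiling_graph by blast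
      have "y \<in> tiling_vertices T" using edge_endpoint y(1) by (metis insert_commute)
      then show "b \<in> label p ` tiling_vertices T" using y(2) x(1) by blast
    qed
  qed
qed

theorem covering_triad_component:
  "covering_map (label p) (tiling_graph T) (induced_subgraph triad_graph (triad_class p))"
proof -
  let ?G = "induced_subgraph triad_graph (triad_class p)"
  have V: "verts (tiling_graph T) = tiling_vertices T" "verts ?G = triad_class p"
    by (simp_all add: tiling_graph_def induced_subgraph_def)
  have at: "(`) (label p) ` edges_at (tiling_graph T) v = edges_at ?G (label p v)"
    if "v \<in> tiling_vertices T" for v
  proof -
    have "label p v \<in> triad_class p" using label_image that by blast
    then show ?thesis unfolding label_edges_at(1)[OF that] by (rule edges_at_class[symmetric])
  qed
  \<comment> \<open>Both edge sets are unions of the sets \<open>edges_at\<close> over their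
    vertices, so surjectivity on edges reduces to the local statement and surjectivity on
    vertices.\<close>
  have "edges (tiling_graph T) = (\<Union>v\<in>tiling_vertices T. edges_at (tiling_graph T) v)"
  proof -
    have "\<exists>v\<in>tiling_vertices T. v \<in> e" if e: "e \<in> edges (tiling_graph T)" for e
    proof -
      obtain v y where "e = {v, y}" using e by (auto simp: tiling_graph_def)
      then show ?thesis using edge_endpoint e by blast
    qed
    then show ?thesis unfolding edges_at_def by blast
  qed
  moreover have "edges ?G = (\<Union>v\<in>triad_class p. edges_at ?G v)"
  proof -
    have "\<exists>v\<in>triad_class p. v \<in> e" if "e \<in> edges ?G" for e
    proof -
      have "e \<in> edges triad_graph" "e \<subseteq> triad_class p" using that by (auto simp: induced_subgraph_def)
      then show ?thesis using triad_edgeE[of e] by (metis insert_subset insertI1)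
    qed
    then show ?thesis unfolding edges_at_def by blast
  qed
  moreover have "(\<Union>v\<in>tiling_vertices T. (`) (label p) ` edges_at (tiling_graph T) v) =
      (\<Union>v\<in>label p ` tiling_vertices T. edges_at ?G v)"
    unfolding UN_simps by (rule SUP_cong[OF refl at])
  ultimately have "(`) (label p) ` edges (tiling_graph T) = edges ?G"
    unfolding label_image by (simp only: image_UN)
  moreover have "bij_betw ((`) (label p)) (edges_at (tiling_graph T) v) (edges_at ?G (label p v))"
    if "v \<in> tiling_vertices T" for v
    unfolding bij_betw_def using label_edges_at(2)[OF that] at[OF that] by blast
  ultimately show ?thesis unfolding covering_map_def V label_image by blast
qed

end

section \<open>Power diagrams\<close>

text \<open>The power of \<open>x\<close> with respect to a circle stored as center and squared
  radius; it is negative inside.\<close>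

definition pow_circle :: "complex \<times> real \<Rightarrow> complex \<Rightarrow> real" where
  "pow_circle C x = (cmod (x - fst C))\<^sup>2 - snd C"

definition power_cell :: "(complex \<times> real) set \<Rightarrow> complex \<times> real \<Rightarrow> complex set" where
  "power_cell I C = {x. \<forall>D\<in>I. pow_circle C x \<le> pow_circle D x}"

text \<open>The quadratic terms cancel in the difference of two powers, so comparing them defines a
  half-plane bounded by the radical axis.\<close>

lemma pow_circle_le_iff:
  "pow_circle C x \<le> pow_circle D x \<longleftrightarrow> inner (2 *\<^sub>R (fst D - fst C)) x \<le>
    pow_circle D 0 - pow_circle C 0" (is ?le)
  "pow_circle C x = pow_circle D x \<longleftrightarrow> inner (2 *\<^sub>R (fst D - fst C)) x =
    pow_circle D 0 - pow_circle C 0" (is ?eq)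
proof -
  have "pow_circle C x - pow_circle D x =
      inner (2 *\<^sub>R (fst D - fst C)) x - (pow_circle D 0 - pow_circle C 0)"
    by (simp add: pow_circle_def power2_norm_eq_inner inner_diff_left inner_diff_right inner_commute)
  then show ?le ?eq by linarith+
qed

lemma convex_power_cell: "convex (power_cell I C)"
proof -
  have "power_cell I C = (\<Inter>D\<in>I. {x. inner (2 *\<^sub>R (fst D - fst C)) x \<le> pow_circle D 0 - pow_circle C 0})"
    by (auto simp: power_cell_def pow_circle_le_iff)
  then show ?thesis by (simp only:) (intro convex_INT convex_halfspace_le)
qed

lemma power_cell_Int:
  assumes "C \<in> I" "D \<in> I"
  shows "power_cell I C \<inter> power_cell I D = power_cell I C \<inter>
    {x. inner (2 *\<^sub>R (fst D - fst C)) x = pow_circle D 0 - pow_circle C 0}"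
  unfolding pow_circle_le_iff(2)[symmetric] using assms by (force simp: power_cell_def)

text \<open>The radical axis supports both cells and cuts their common part out of each; this is why
  a power diagram is edge to edge.\<close>

lemma power_cell_Int_face:
  assumes "C \<in> I" "D \<in> I"
  shows "(power_cell I C \<inter> power_cell I D) face_of power_cell I C"
  unfolding power_cell_Int[OF assms]
  using assms by (intro face_of_Int_supporting_hyperplane_le convex_power_cell)
    (simp only: power_cell_def mem_Collect_eq pow_circle_le_iff(1)[symmetric])

text \<open>For different centers the radical axis is a genuine line and has empty interior.
  Concentric circles are treated where the tiling is assembled.\<close>

lemma power_cell_interiors_disjoint:
  assumes "C \<in> I" "D \<in> I" "fst C \<noteq> fst D"
  shows "interior (power_cell I C) \<inter> interior (power_cell I D) = {}"
proof -
  have "2 *\<^sub>R (fst D - fst C) \<noteq> 0" using assms(3) by simp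
  then have "interior {x. inner (2 *\<^sub>R (fst D - fst C)) x = pow_circle D 0 - pow_circle C 0} = {}"
    by (rule interior_hyperplane)
  then show ?thesis
    unfolding interior_Int[symmetric] power_cell_Int[OF assms(1,2)] by (metis Int_empty_right interior_Int)
qed

text \<open>The circle in the last assumption is the one through \<open>c + z * w\<close> and \<open>c + z * (w * root_cis n)\<close>
  whose center lies on the far side of this edge; its radical axis with the circumcircle of the polygon
  is the line through the edge.\<close>

lemma ngon_eq_power_cell:
  assumes n: "3 \<le> n" and z: "z \<noteq> 0"
    and vertices: "\<And>w D. w ^ n = 1 \<Longrightarrow> D \<in> I \<Longrightarrow> 0 \<le> pow_circle D (c + z * w)"
    and neighbours: "\<And>w. w ^ n = 1 \<Longrightarrow> \<exists>\<mu>>0. (c + of_real \<mu> * (z * w * (1 + root_cis n)),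
      (cmod z)\<^sup>2 * (1 + (\<mu>\<^sup>2 - \<mu>) * (2 + 2 * cos (2 * pi / n)))) \<in> I"
  shows "power_cell I (c, (cmod z)\<^sup>2) = ngon n c z"
proof
  \<comment> \<open>The vertices have power 0 for the circumcircle and nonnegative power for every
    other circle, so they belong to the convex cell.\<close>
  have "pow_circle (c, (cmod z)\<^sup>2) (c + z * w) = 0" if "w ^ n = 1" for w
    using norm_root_unity[OF that] n by (simp add: pow_circle_def norm_mult)
  then show "ngon n c z \<subseteq> power_cell I (c, (cmod z)\<^sup>2)"
    unfolding ngon_def using vertices
    by (intro hull_minimal convex_power_cell) (auto simp: power_cell_def)
  show "power_cell I (c, (cmod z)\<^sup>2) \<subseteq> ngon n c z"
  proof
    fix x assume x: "x \<in> power_cell I (c, (cmod z)\<^sup>2)"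
    show "x \<in> ngon n c z"
      unfolding mem_ngon_iff[OF n z]
    proof (intro allI impI)
      fix w :: complex assume w: "w ^ n = 1"
      define t where "t = pi / n"
      have "0 < t" "t < pi / 2" using n by (auto simp: t_def field_simps)
      then have ct: "cos t > 0" by (intro cos_gt_zero_pi) auto
      have tt: "2 * pi / n = 2 * t" by (simp add: t_def)
      have r: "1 + root_cis n = of_real (2 * cos t) * cis t"
        unfolding tt by (simp add: complex_eq_iff cos_double_cos sin_double power2_eq_square)
      have c2: "2 + 2 * cos (2 * t) = (2 * cos t)\<^sup>2" by (simp add: cos_double_cos power_mult_distrib)
      obtain \<mu> where \<mu>: "\<mu> > 0" "(c + of_real \<mu> * (z * w * (1 + root_cis n)),
          (cmod z)\<^sup>2 * (1 + (\<mu>\<^sup>2 - \<mu>) * (2 + 2 * cos (2 * pi / n)))) \<in> I"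
        using neighbours[OF w] by blast
      \<comment> \<open>\<open>1 + root_cis n\<close> has modulus \<open>2 * cos t\<close> and
        argument \<open>t\<close>. Hence \<open>m\<close> is the outer normal of the side, and \<nu>
        is the distance of the neighbouring center in units of the circumradius.\<close>
      define \<nu> where "\<nu> = 2 * \<mu> * cos t"
      define m where "m = z * w * cis t"
      have nm: "cmod m = cmod z" using norm_root_unity[OF w] n by (simp add: m_def norm_mult)
      have pos: "\<nu> > 0" using \<mu>(1) ct by (simp add: \<nu>_def)
      have "(c + \<nu> *\<^sub>R m, (cmod z)\<^sup>2 * (1 + (\<nu>\<^sup>2 - 2 * \<nu> * cos t))) \<in> I"
      proof -
        have "of_real \<mu> * (z * w * (1 + root_cis n)) = \<nu> *\<^sub>R m"
          unfolding r by (simp add: \<nu>_def m_def scaleR_conv_of_real mult_ac)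
        moreover have "1 + (\<mu>\<^sup>2 - \<mu>) * (2 + 2 * cos (2 * pi / n)) = 1 + (\<nu>\<^sup>2 - 2 * \<nu> * cos t)"
          unfolding tt c2 by (simp add: \<nu>_def algebra_simps power2_eq_square)
        ultimately show ?thesis using \<mu>(2) by metis
      qed
      with x have "(cmod (x - c))\<^sup>2 - (cmod z)\<^sup>2 \<le>
          (cmod (x - (c + \<nu> *\<^sub>R m)))\<^sup>2 - (cmod z)\<^sup>2 * (1 + (\<nu>\<^sup>2 - 2 * \<nu> * cos t))"
        by (force simp: power_cell_def pow_circle_def)
      also have "(cmod (x - (c + \<nu> *\<^sub>R m)))\<^sup>2 = (cmod (x - c))\<^sup>2 - 2 * \<nu> * inner m (x - c) + \<nu>\<^sup>2 * (cmod z)\<^sup>2"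
      proof -
        have "cmod (x - (c + \<nu> *\<^sub>R m)) = cmod (\<nu> *\<^sub>R m - (x - c))"
          by (subst norm_minus_commute) (simp add: algebra_simps)
        moreover have "inner (\<nu> *\<^sub>R m) (x - c) = \<nu> * inner m (x - c)" by simp
        moreover have "(cmod (\<nu> *\<^sub>R m))\<^sup>2 = \<nu>\<^sup>2 * (cmod z)\<^sup>2"
          by (simp add: nm power_mult_distrib)
        ultimately show ?thesis using dot_norm_neg[of "\<nu> *\<^sub>R m" "x - c"] by simp
      qed
      finally have "\<nu> * inner m (x - c) \<le> \<nu> * ((cmod z)\<^sup>2 * cos t)" by (simp add: algebra_simps)
      then show "inner (z * w * cis (pi / n)) (x - c) \<le> (cmod z)\<^sup>2 * cos (pi / n)"
        using pos by (simp add: m_def t_def)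
    qed
  qed
qed

text \<open>Both descriptions are compared at a common vertex, where
  \<open>polygon_at_inject\<close> applies. Tiles are bare sets, so the number of sides has to be
  recovered from the shape.\<close>

lemma regular_polygon_sides_unique:
  assumes "3 \<le> n" "3 \<le> m" "regular_polygon n s P" "regular_polygon m s P"
  shows "n = m"
proof -
  have n: "0 < n" using assms by simp
  obtain c z where "P = ngon n c z" using assms(3) regular_polygon_iff_ngon[OF n] by blast
  then have v: "(c + z * 1) extreme_point_of P" using extreme_point_of_ngon_iff[OF n] by (metis power_one)
  obtain d where d: "d \<noteq> 0" "P = polygon_at n (c + z * 1) d" using regular_polygon_vertexE[OF assms(1,3) v] by blast
  obtain e where e: "e \<noteq> 0" "P = polygon_at m (c + z * 1) e" using regular_polygon_vertexE[OF assms(2,4) v] by blast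
  show ?thesis using polygon_at_inject(1)[OF assms(1,2) d(1) e(1)] d(2) e(2) by metis
qed

section \<open>The tiling\<close>

text \<open>The group generated by the reflections in the sides of the triangle with vertices \<open>0\<close>,
  \<open>center 4\<close> and \<open>center 6\<close> below. Tiles of side length 1 lead to the leg \<open>(3 + sqrt 3) / 2\<close>.\<close>

inductive_set kaleidoscope :: "(complex \<Rightarrow> complex) set" where
  id: "id \<in> kaleidoscope"
| r1: "g \<in> kaleidoscope \<Longrightarrow> cnj \<circ> g \<in> kaleidoscope"
| r2: "g \<in> kaleidoscope \<Longrightarrow> (\<lambda>x. root_cis 6 * cnj x) \<circ> g \<in> kaleidoscope"
| r3: "g \<in> kaleidoscope \<Longrightarrow> (\<lambda>x. of_real (3 + sqrt 3) - cnj x) \<circ> g \<in> kaleidoscope"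

lemma kaleidoscope_comp: "g \<in> kaleidoscope \<Longrightarrow> h \<in> kaleidoscope \<Longrightarrow> g \<circ> h \<in> kaleidoscope"
  by (induction rule: kaleidoscope.induct) (simp_all only: comp_assoc id_comp kaleidoscope.intros)

lemma reflections_in_kaleidoscope:
  "cnj \<in> kaleidoscope" "(\<lambda>x. root_cis 6 * cnj x) \<in> kaleidoscope"
  "(\<lambda>x. of_real (3 + sqrt 3) - cnj x) \<in> kaleidoscope"
  using kaleidoscope.intros(2-4)[OF kaleidoscope.id] by simp_all

lemma reflections_involutive:
  "cnj \<circ> cnj = id" "(\<lambda>x. root_cis 6 * cnj x) \<circ> (\<lambda>x. root_cis 6 * cnj x) = id"
  "(\<lambda>x. of_real (3 + sqrt 3) - cnj x) \<circ> (\<lambda>x. of_real (3 + sqrt 3) - cnj x) = id"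
  by (auto simp: fun_eq_iff cis_cnj cis_mult simp flip: mult.assoc)

lemma kaleidoscope_inverse:
  assumes "g \<in> kaleidoscope"
  shows "\<exists>h\<in>kaleidoscope. g \<circ> h = id \<and> h \<circ> g = id"
proof -
  have step: "\<exists>h\<in>kaleidoscope. (r \<circ> g) \<circ> h = id \<and> h \<circ> (r \<circ> g) = id"
    if r: "r \<in> kaleidoscope" "r \<circ> r = id" and g: "\<exists>h\<in>kaleidoscope. g \<circ> h = id \<and> h \<circ> g = id" for r g
  proof -
    obtain h where h: "h \<in> kaleidoscope" "g \<circ> h = id" "h \<circ> g = id" using g by blast
    have "(r \<circ> g) \<circ> (h \<circ> r) = r \<circ> (g \<circ> h) \<circ> r" "(h \<circ> r) \<circ> (r \<circ> g) = h \<circ> (r \<circ> r) \<circ> g"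
      by (simp_all only: comp_assoc)
    then have "(r \<circ> g) \<circ> (h \<circ> r) = id" "(h \<circ> r) \<circ> (r \<circ> g) = id" using h r(2) by simp_all
    then show ?thesis using kaleidoscope_comp[OF h(1) r(1)] by blast
  qed
  show ?thesis using assms
  proof (induction rule: kaleidoscope.induct)
    case id
    show ?case by (rule bexI[of _ id]) (simp_all add: kaleidoscope.id)
  qed (rule step[OF reflections_in_kaleidoscope(1) reflections_involutive(1)]
      step[OF reflections_in_kaleidoscope(2) reflections_involutive(2)]
      step[OF reflections_in_kaleidoscope(3) reflections_involutive(3)], assumption)+
qed

lemma kaleidoscope_affine:
  assumes "g \<in> kaleidoscope"
  shows "\<exists>\<alpha> \<beta>. cmod \<alpha> = 1 \<and> ((\<forall>x. g x = \<alpha> * x + \<beta>) \<or> (\<forall>x. g x = \<alpha> * cnj x + \<beta>))"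
  using assms
proof (induction rule: kaleidoscope.induct)
  case id
  show ?case by (intro exI[of _ 1] exI[of _ 0]) simp
next
  case (r1 g)
  then obtain \<alpha> \<beta> where "cmod \<alpha> = 1" "(\<forall>x. g x = \<alpha> * x + \<beta>) \<or> (\<forall>x. g x = \<alpha> * cnj x + \<beta>)" by blast
  then show ?case by (intro exI[of _ "cnj \<alpha>"] exI[of _ "cnj \<beta>"]) auto
next
  case (r2 g)
  then obtain \<alpha> \<beta> where "cmod \<alpha> = 1" "(\<forall>x. g x = \<alpha> * x + \<beta>) \<or> (\<forall>x. g x = \<alpha> * cnj x + \<beta>)" by blast
  then show ?case
    by (intro exI[of _ "root_cis 6 * cnj \<alpha>"] exI[of _ "root_cis 6 * cnj \<beta>"])
      (auto simp: norm_mult distrib_left mult.assoc)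
next
  case (r3 g)
  then obtain \<alpha> \<beta> where "cmod \<alpha> = 1" "(\<forall>x. g x = \<alpha> * x + \<beta>) \<or> (\<forall>x. g x = \<alpha> * cnj x + \<beta>)" by blast
  then show ?case
    by (intro exI[of _ "- cnj \<alpha>"] exI[of _ "of_real (3 + sqrt 3) - cnj \<beta>"]) (auto simp: algebra_simps)
qed

lemma kaleidoscope_norm: "g \<in> kaleidoscope \<Longrightarrow> cmod (g x - g y) = cmod (x - y)"
proof -
  assume "g \<in> kaleidoscope"
  then obtain \<alpha> \<beta> where a: "cmod \<alpha> = 1" "(\<forall>x. g x = \<alpha> * x + \<beta>) \<or> (\<forall>x. g x = \<alpha> * cnj x + \<beta>)"
    using kaleidoscope_affine by blast
  from a(2) show ?thesis
  proof
    assume "\<forall>x. g x = \<alpha> * x + \<beta>"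
    then have "g x - g y = \<alpha> * (x - y)" by (simp add: right_diff_distrib)
    then show ?thesis by (simp add: norm_mult a(1))
  next
    assume "\<forall>x. g x = \<alpha> * cnj x + \<beta>"
    then have "g x - g y = \<alpha> * cnj (x - y)" by (simp add: right_diff_distrib)
    then show ?thesis by (simp only: norm_mult a(1) complex_mod_cnj mult_1)
  qed
qed

text \<open>An orientation-reversing map conjugates \<open>z\<close> and permutes the vertices
  through conjugation of the roots of unity. The last clause keeps track of them.\<close>

lemma kaleidoscope_image_ngon:
  assumes "g \<in> kaleidoscope"
  obtains z' where "cmod z' = cmod z" "g ` ngon n c z = ngon n (g c) z'"
    "\<And>w. w ^ n = 1 \<Longrightarrow> \<exists>w'. w' ^ n = 1 \<and> g c + z' * w = g (c + z * w')"
proof -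
  obtain \<alpha> \<beta> where a: "cmod \<alpha> = 1" "(\<forall>x. g x = \<alpha> * x + \<beta>) \<or> (\<forall>x. g x = \<alpha> * cnj x + \<beta>)"
    using kaleidoscope_affine[OF assms] by blast
  have hull: "(\<lambda>x. f x + \<beta>) ` (convex hull S) = convex hull ((\<lambda>x. f x + \<beta>) ` S)" if "linear f" for f S
  proof -
    have "(\<lambda>x. f x + \<beta>) ` A = (\<lambda>x. \<beta> + x) ` f ` A" for A by (auto simp: add.commute)
    then show ?thesis by (simp add: convex_hull_linear_image[OF that] convex_hull_translation)
  qed
  from a(2) show thesis
  proof
    assume g: "\<forall>x. g x = \<alpha> * x + \<beta>"
    then have "g = (\<lambda>x. \<alpha> * x + \<beta>)" by blast
    moreover have "linear (\<lambda>x. \<alpha> * x)" by (intro bounded_linear.linear bounded_linear_mult_right)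
    moreover have g': "g (c + z * w) = g c + \<alpha> * z * w" for w using g by (simp add: algebra_simps)
    ultimately have "g ` ngon n c z = ngon n (g c) (\<alpha> * z)"
      unfolding ngon_def using hull[of "\<lambda>x. \<alpha> * x"] by (simp only: image_image g')
    then show thesis using that[of "\<alpha> * z"] g' a(1) by (simp add: norm_mult) (metis mult.assoc)
  next
    assume g: "\<forall>x. g x = \<alpha> * cnj x + \<beta>"
    then have "g = (\<lambda>x. \<alpha> * cnj x + \<beta>)" by blast
    moreover have "linear (\<lambda>x. \<alpha> * cnj x)"
      by (intro bounded_linear.linear bounded_linear_mult_right[THEN bounded_linear_compose] bounded_linear_cnj)
    moreover have g': "g (c + z * cnj w) = g c + \<alpha> * cnj z * w" for w using g by (simp add: algebra_simps)
    moreover have roots: "{w. w ^ n = 1} = cnj ` {w. w ^ n = 1}"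
    proof -
      have "w ^ n = 1 \<Longrightarrow> cnj w ^ n = 1" for w by (metis complex_cnj_one complex_cnj_power)
      then show ?thesis by (auto intro: image_eqI[of _ cnj "cnj _"])
    qed
    ultimately have "g ` ngon n c z = convex hull ((\<lambda>w. g (c + z * w)) ` {w. w ^ n = 1})"
      unfolding ngon_def using hull[of "\<lambda>x. \<alpha> * cnj x"] by (simp add: image_image)
    also have "(\<lambda>w. g (c + z * w)) ` {w. w ^ n = 1} = (\<lambda>w. g c + \<alpha> * cnj z * w) ` {w. w ^ n = 1}"
      by (subst roots) (simp only: image_image g')
    finally have "g ` ngon n c z = ngon n (g c) (\<alpha> * cnj z)" by (simp only: ngon_def)
    moreover have "w ^ n = 1 \<Longrightarrow> cnj w ^ n = 1" for w by (metis complex_cnj_one complex_cnj_power)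
    ultimately show thesis using that[of "\<alpha> * cnj z"] g' a(1) by (simp add: norm_mult) metis
  qed
qed

text \<open>The steps are the reflections in the perpendicular bisectors of the two sides meeting at
  \<open>1\<close>. Applied alternately they reach every vertex.\<close>

lemma roots_unity_induct:
  assumes "w ^ n = 1" "0 < n" and one: "P 1"
    and step: "\<And>w. w ^ n = 1 \<Longrightarrow> P w \<Longrightarrow> P (root_cis n * cnj w)"
      "\<And>w. w ^ n = 1 \<Longrightarrow> P w \<Longrightarrow> P (cnj (root_cis n) * cnj w)"
  shows "P w"
proof -
  let ?r = "root_cis n"
  have rn: "(?r ^ k) ^ n = 1" "cnj (?r ^ k) ^ n = 1" for k
  proof -
    have "(?r ^ k) ^ n = (?r ^ n) ^ k" by (simp only: power_mult[symmetric] mult.commute)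
    then show 1: "(?r ^ k) ^ n = 1" using root_cis_power[OF assms(2)] by (simp only: power_one)
    show "cnj (?r ^ k) ^ n = 1" using arg_cong[OF 1, of cnj] by (simp only: complex_cnj_power complex_cnj_one)
  qed
  have "P (?r ^ k) \<and> P (cnj (?r ^ k))" for k
  proof (induction k)
    case (Suc k)
    then show ?case
      using step(1)[OF rn(2), of k] step(2)[OF rn(1), of k]
      by (simp only: complex_cnj_cnj power_Suc complex_cnj_mult)
  qed (use one in simp)
  moreover obtain k where "w = cis (2 * pi * real k / real n)"
    using assms(1,2) by (rule root_unityE)
  then have "w = ?r ^ k" by (simp add: Complex.DeMoivre mult.commute)
  ultimately show ?thesis by blast
qed

section \<open>The three base circles and their orbit\<close>

definition center :: "nat \<Rightarrow> complex" where
  "center n = (if n = 4 then of_real ((3 + sqrt 3) / 2)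
    else if n = 6 then Complex ((3 + sqrt 3) / 2) ((1 + sqrt 3) / 2) else 0)"

text \<open>The incenter of the triangle: its distance from each mirror is 1/2, so each reflection
  moves it by the side length 1.\<close>

definition base_vertex :: complex where
  "base_vertex = Complex ((2 + sqrt 3) / 2) (1 / 2)"

definition spoke :: "nat \<Rightarrow> complex" where
  "spoke n = base_vertex - center n"

definition circle :: "(complex \<Rightarrow> complex) \<Rightarrow> nat \<Rightarrow> complex \<times> real" where
  "circle g n = (g (center n), (cmod (spoke n))\<^sup>2)"

definition circles :: "(complex \<times> real) set" where
  "circles = {circle g n | g n. g \<in> kaleidoscope \<and> n \<in> {4, 6, 12}}"

lemma spoke_values:
  "spoke 4 = Complex (-1/2) (1/2)" "spoke 6 = Complex (-1/2) (- sqrt 3 / 2)"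
  "spoke 12 = Complex ((2 + sqrt 3) / 2) (1/2)"
  by (simp_all add: spoke_def base_vertex_def center_def complex_eq_iff field_simps)

lemma norm_spoke: "(cmod (spoke 4))\<^sup>2 = 1 / 2" "(cmod (spoke 6))\<^sup>2 = 1" "(cmod (spoke 12))\<^sup>2 = 2 + sqrt 3"
  unfolding spoke_values cmod_power2 by (simp_all add: power2_eq_square field_simps)

lemma circle_comp: "circle (g \<circ> h) n = (g (fst (circle h n)), snd (circle h n))"
  by (simp add: circle_def)

lemma circles_image:
  assumes "g \<in> kaleidoscope" "D \<in> circles"
  shows "(g (fst D), snd D) \<in> circles"
proof -
  obtain h n where h: "h \<in> kaleidoscope" "n \<in> {4, 6, 12}" "D = circle h n"
    using assms(2) by (auto simp: circles_def)
  then have "(g (fst D), snd D) = circle (g \<circ> h) n" by (simp add: circle_comp)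
  then show ?thesis using kaleidoscope_comp[OF assms(1) h(1)] h(2) by (auto simp: circles_def)
qed

lemma pow_circle_image: "g \<in> kaleidoscope \<Longrightarrow> pow_circle (g (fst D), snd D) (g x) = pow_circle D x"
  by (simp add: pow_circle_def kaleidoscope_norm)

text \<open>The two mirrors through \<open>center n\<close> bisect the two sides of the base
  \<open>n\<close>-gon that meet at the base vertex. In the coordinate \<open>y\<close> they take
  the form required by \<open>roots_unity_induct\<close>.\<close>

lemma corner_reflections:
  assumes "n \<in> {4, 6, 12}"
  obtains p q where "p \<in> kaleidoscope" "q \<in> kaleidoscope"
    "\<And>y. p (center n + spoke n * y) = center n + spoke n * (root_cis n * cnj y)"
    "\<And>y. q (center n + spoke n * y) = center n + spoke n * (cnj (root_cis n) * cnj y)"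
proof -
  let ?r1 = "cnj" and ?r2 = "\<lambda>x. root_cis 6 * cnj x" and ?r3 = "\<lambda>x. of_real (3 + sqrt 3) - cnj x"
  have r1: "?r1 (c + z * y) = c + z * (u * cnj y)" if "cnj c = c" "cnj z = z * u" for c z u y
    using that by (simp add: mult.assoc)
  have r2: "?r2 (c + z * y) = c + z * (u * cnj y)"
    if "root_cis 6 * cnj c = c" "root_cis 6 * cnj z = z * u" for c z u y
  proof -
    have "?r2 (c + z * y) = root_cis 6 * cnj c + root_cis 6 * cnj z * cnj y"
      by (simp only: complex_cnj_add complex_cnj_mult distrib_left mult.assoc)
    then show ?thesis unfolding that by (simp only: mult.assoc)
  qed
  have r3: "?r3 (c + z * y) = c + z * (u * cnj y)"
    if "of_real (3 + sqrt 3) - cnj c = c" "- cnj z = z * u" for c z u y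
  proof -
    have "?r3 (c + z * y) = (of_real (3 + sqrt 3) - cnj c) + (- cnj z) * cnj y"
      by (simp only: complex_cnj_add complex_cnj_mult) simp
    then show ?thesis unfolding that by (simp only: mult.assoc)
  qed
  note W = reflections_in_kaleidoscope
  have c: "cnj (center 4) = center 4" "cnj (spoke 4) = spoke 4 * root_cis 4"
    "of_real (3 + sqrt 3) - cnj (center 4) = center 4" "- cnj (spoke 4) = spoke 4 * cnj (root_cis 4)"
    "of_real (3 + sqrt 3) - cnj (center 6) = center 6" "- cnj (spoke 6) = spoke 6 * root_cis 6"
    "root_cis 6 * cnj (center 6) = center 6" "root_cis 6 * cnj (spoke 6) = spoke 6 * cnj (root_cis 6)"
    "root_cis 6 * cnj (center 12) = center 12" "root_cis 6 * cnj (spoke 12) = spoke 12 * root_cis 12"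
    "cnj (center 12) = center 12" "cnj (spoke 12) = spoke 12 * cnj (root_cis 12)"
    unfolding root_cis_values spoke_values
    by (simp_all add: complex_eq_iff center_def field_simps)
  consider "n = 4" | "n = 6" | "n = 12" using assms by auto
  then show thesis
  proof cases
    case 1
    show thesis by (rule that[unfolded 1, OF W(1) W(3) r1[OF c(1,2)] r3[OF c(3,4)]])
  next
    case 2
    show thesis by (rule that[unfolded 2, OF W(3) W(2) r3[OF c(5,6)] r2[OF c(7,8)]])
  next
    case 3
    show thesis by (rule that[unfolded 3, OF W(2) W(1) r2[OF c(9,10)] r1[OF c(11,12)]])
  qed
qed

lemma polygon_vertices_in_orbit:
  assumes "n \<in> {4, 6, 12}" "w ^ n = 1"
  shows "\<exists>g\<in>kaleidoscope. center n + spoke n * w = g base_vertex"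
proof -
  obtain p q where pq: "p \<in> kaleidoscope" "q \<in> kaleidoscope"
    "\<And>y. p (center n + spoke n * y) = center n + spoke n * (root_cis n * cnj y)"
    "\<And>y. q (center n + spoke n * y) = center n + spoke n * (cnj (root_cis n) * cnj y)"
    using corner_reflections[OF assms(1)] by metis
  have "0 < n" using assms(1) by auto
  with assms(2) show ?thesis
  proof (rule roots_unity_induct)
    show "\<exists>g\<in>kaleidoscope. center n + spoke n * 1 = g base_vertex"
      by (rule bexI[OF _ kaleidoscope.id]) (simp add: spoke_def)
  next
    fix w assume "\<exists>g\<in>kaleidoscope. center n + spoke n * w = g base_vertex"
    then obtain g where g: "g \<in> kaleidoscope" "center n + spoke n * w = g base_vertex" by blast
    show "\<exists>g\<in>kaleidoscope. center n + spoke n * (root_cis n * cnj w) = g base_vertex"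
      by (rule bexI[OF _ kaleidoscope_comp[OF pq(1) g(1)]]) (simp only: pq(3)[symmetric] g(2) comp_apply)
    show "\<exists>g\<in>kaleidoscope. center n + spoke n * (cnj (root_cis n) * cnj w) = g base_vertex"
      by (rule bexI[OF _ kaleidoscope_comp[OF pq(2) g(1)]]) (simp only: pq(4)[symmetric] g(2) comp_apply)
  qed
qed

text \<open>The neighbours across the two sides at the base vertex are computed explicitly; the
  reflections fixing \<open>center n\<close> carry them to the remaining sides.\<close>

lemma neighbouring_circles:
  assumes n: "n \<in> {4, 6, 12}" and "w ^ n = 1"
  shows "\<exists>\<mu>>0. (center n + of_real \<mu> * (spoke n * w * (1 + root_cis n)),
    (cmod (spoke n))\<^sup>2 * (1 + (\<mu>\<^sup>2 - \<mu>) * (2 + 2 * cos (2 * pi / n)))) \<in> circles"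
    (is "?Q w")
proof -
  obtain p q where pq: "p \<in> kaleidoscope" "q \<in> kaleidoscope"
    "\<And>y. p (center n + spoke n * y) = center n + spoke n * (root_cis n * cnj y)"
    "\<And>y. q (center n + spoke n * y) = center n + spoke n * (cnj (root_cis n) * cnj y)"
    using corner_reflections[OF n] by metis
  let ?r = "root_cis n"
  have id: "circle id m \<in> circles" if "m \<in> {4, 6, 12}" for m
    using that kaleidoscope.id by (auto simp: circles_def)
  \<comment> \<open>A reflection reverses sides: \<open>p\<close> takes the side from
    \<open>w\<close> to \<open>w * root_cis n\<close> to one beginning at \<open>cnj w\<close>, the
    image of the old end point. For \<open>q\<close> the new beginning has two further factors
    \<open>cnj (root_cis n)\<close>.\<close>
  have stepp: "?Q (cnj w)" and stepq: "?Q (cnj ?r * cnj ?r * cnj w)" if "?Q w" for w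
  proof -
    obtain \<mu> where \<mu>: "\<mu> > 0" "(center n + of_real \<mu> * (spoke n * w * (1 + ?r)),
      (cmod (spoke n))\<^sup>2 * (1 + (\<mu>\<^sup>2 - \<mu>) * (2 + 2 * cos (2 * pi / n)))) \<in> circles"
      using \<open>?Q w\<close> by blast
    have eq: "of_real \<mu> * (spoke n * w * (1 + ?r)) = spoke n * (of_real \<mu> * w * (1 + ?r))" for w
      by simp
    have P: "?r * cnj (of_real \<mu> * w * (1 + ?r)) = of_real \<mu> * cnj w * (1 + ?r)"
    proof -
      have "?r * cnj (of_real \<mu> * w * (1 + ?r)) = of_real \<mu> * cnj w * (?r + ?r * cnj ?r)"
        by (simp add: algebra_simps)
      then show ?thesis by (simp only: cnj_root_cis add.commute)
    qed
    have "cnj ?r * cnj (of_real \<mu> * w * (1 + ?r)) = cnj ?r * cnj ?r * (?r * cnj (of_real \<mu> * w * (1 + ?r)))"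
      by (simp only: mult.assoc[symmetric] cnj_root_cis mult.assoc[of "cnj ?r" "cnj ?r" ?r]) simp
    then have Q: "cnj ?r * cnj (of_real \<mu> * w * (1 + ?r)) = of_real \<mu> * (cnj ?r * cnj ?r * cnj w) * (1 + ?r)"
      unfolding P by (simp only: mult.assoc mult.left_commute)
    note circles_image[OF pq(1) \<mu>(2), unfolded eq fst_conv snd_conv pq(3) P, folded eq]
      circles_image[OF pq(2) \<mu>(2), unfolded eq fst_conv snd_conv pq(4) Q, folded eq]
    then show "?Q (cnj w)" "?Q (cnj ?r * cnj ?r * cnj w)" using \<mu>(1) by blast+
  qed
  have base: "?Q 1 \<and> ?Q (cnj ?r)"
  proof -
    have s3: "1 < sqrt 3" "sqrt 3 < 3" by (simp_all add: real_less_rsqrt real_less_lsqrt)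
    \<comment> \<open>These are the values of \<mu> for the six ordered pairs of base tiles: the
      distance of the centers divided by twice the apothem of the first.\<close>
    then have pos: "0 < (3 + sqrt 3) / 2" "0 < (1 + sqrt 3) / 2" "0 < (3 + sqrt 3) / 6"
      "0 < (3 + sqrt 3) / 3" "0 < sqrt 3 - 1" "0 < (3 - sqrt 3) / 2" by (simp_all add: add_pos_pos)
    have val: "center m = center n + of_real \<mu> * (spoke n * w * (1 + ?r)) \<Longrightarrow>
        (cmod (spoke m))\<^sup>2 = (cmod (spoke n))\<^sup>2 * (1 + (\<mu>\<^sup>2 - \<mu>) * (2 + 2 * cos (2 * pi / n))) \<Longrightarrow>
        0 < \<mu> \<Longrightarrow> m \<in> {4, 6, 12} \<Longrightarrow> ?Q w" for m w \<mu>
      using id[of m] by (auto simp: circle_def)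
    have cosr: "cos (2 * pi / n) = Re ?r" by simp
    consider "n = 4" | "n = 6" | "n = 12" using n by auto
    then show ?thesis
    proof cases
      case 1
      have "?Q 1" by (rule val[OF _ _ pos(1), of 12], unfold cosr 1 root_cis_values norm_spoke)
          (simp_all add: cos_30 cos_60 spoke_values center_def complex_eq_iff power2_eq_square field_simps)
      moreover have "?Q (cnj ?r)" by (rule val[OF _ _ pos(2), of 6], unfold cosr 1 root_cis_values norm_spoke)
          (simp_all add: cos_30 cos_60 spoke_values center_def complex_eq_iff power2_eq_square field_simps)
      ultimately show ?thesis by blast
    next
      case 2
      have "?Q 1" by (rule val[OF _ _ pos(3), of 4], unfold cosr 2 root_cis_values norm_spoke)
          (simp_all add: cos_30 cos_60 spoke_values center_def complex_eq_iff power2_eq_square field_simps)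
      moreover have "?Q (cnj ?r)" by (rule val[OF _ _ pos(4), of 12], unfold cosr 2 root_cis_values norm_spoke)
          (simp_all add: cos_30 cos_60 spoke_values center_def complex_eq_iff power2_eq_square field_simps)
      ultimately show ?thesis by blast
    next
      case 3
      have "?Q 1" by (rule val[OF _ _ pos(5), of 6], unfold cosr 3 root_cis_values norm_spoke)
          (simp_all add: cos_30 cos_60 spoke_values center_def complex_eq_iff power2_eq_square field_simps)
      moreover have "?Q (cnj ?r)" by (rule val[OF _ _ pos(6), of 4], unfold cosr 3 root_cis_values norm_spoke)
          (simp_all add: cos_30 cos_60 spoke_values center_def complex_eq_iff power2_eq_square field_simps)
      ultimately show ?thesis by blast
    qed
  qed
  \<comment> \<open>The two reflections together shift a side by two places, so the two computed
    sides start a two-step induction.\<close>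
  have "?Q (?r ^ k) \<and> ?Q (cnj (?r ^ k))" for k
  proof (induction k rule: induct_nat_012)
    case 0
    show ?case using base by simp
  next
    case 1
    show ?case using base stepp[of "cnj ?r"] by simp
  next
    case (ge2 k)
    have "cnj (?r ^ Suc (Suc k)) = cnj ?r * cnj ?r * cnj (?r ^ k)" by simp
    then have Q: "?Q (cnj (?r ^ Suc (Suc k)))" using stepq[of "?r ^ k"] ge2(1) by metis
    show ?case using stepp[OF Q] Q unfolding complex_cnj_cnj by blast
  qed
  moreover have "0 < n" using n by auto
  then obtain k where "w = cis (2 * pi * real k / real n)" using assms(2) by (rule_tac root_unityE)
  then have "w = ?r ^ k" by (simp add: Complex.DeMoivre mult.commute)
  ultimately show ?thesis by blast
qed

section \<open>Lattice coordinates of the circle centers\<close>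

definition lattice_point :: "real \<Rightarrow> real \<Rightarrow> complex" where
  "lattice_point x y = Complex ((3 + sqrt 3) / 6 * (x + y / 2)) ((3 + sqrt 3) / 6 * (sqrt 3 / 2 * y))"

text \<open>The unit \<open>(3 + sqrt 3) / 6\<close> makes the base centers the integral points (0,
  0), (3, 0), (2, 2), and the mirrors act by integral affine maps.\<close>

lemma reflect_lattice_point:
  "cnj (lattice_point x y) = lattice_point (x + y) (- y)"
  "root_cis 6 * cnj (lattice_point x y) = lattice_point y x"
  "of_real (3 + sqrt 3) - cnj (lattice_point x y) = lattice_point (6 - x - y) y"
  unfolding root_cis_values by (simp_all add: lattice_point_def complex_eq_iff field_simps)

lemma lattice_point_diff: "lattice_point x y - lattice_point x' y' = lattice_point (x - x') (y - y')"
  by (simp add: lattice_point_def complex_eq_iff field_simps)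

lemma norm_lattice_point: "(cmod (lattice_point x y))\<^sup>2 = (2 + sqrt 3) / 6 * (x\<^sup>2 + x * y + y\<^sup>2)"
  unfolding cmod_power2 by (simp add: lattice_point_def power2_eq_square field_simps)

text \<open>Completing the square bounds the quadratic form below by 3/4 of the square of each
  coordinate; with the factor 1/6 of the norm this gives 8.\<close>

lemma lattice_point_bound:
  assumes "(cmod (lattice_point x y))\<^sup>2 \<le> r"
  shows "(2 + sqrt 3) * x\<^sup>2 \<le> 8 * r" "(2 + sqrt 3) * y\<^sup>2 \<le> 8 * r"
proof -
  have "3 / 4 * x\<^sup>2 \<le> x\<^sup>2 + x * y + y\<^sup>2"
    using zero_le_power2[of "x / 2 + y"] by (simp add: power2_eq_square algebra_simps)
  moreover have "3 / 4 * y\<^sup>2 \<le> x\<^sup>2 + x * y + y\<^sup>2"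
    using zero_le_power2[of "y / 2 + x"] by (simp add: power2_eq_square algebra_simps)
  ultimately have "(2 + sqrt 3) / 6 * (3 / 4 * x\<^sup>2) \<le> r" "(2 + sqrt 3) / 6 * (3 / 4 * y\<^sup>2) \<le> r"
    using assms unfolding norm_lattice_point by (smt (verit) mult_left_mono divide_nonneg_pos real_sqrt_ge_zero)+
  then show "(2 + sqrt 3) * x\<^sup>2 \<le> 8 * r" "(2 + sqrt 3) * y\<^sup>2 \<le> 8 * r" by (simp_all add: field_simps)
qed

lemma lattice_point_surj: obtains x y where "v = lattice_point x y"
proof -
  define k where "k = (3 + sqrt 3) / 6"
  have k: "k \<noteq> 0" using add_pos_pos[of 3 "sqrt 3"] by (simp add: k_def)
  define y where "y = Im v / (k * (sqrt 3 / 2))"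
  define x where "x = Re v / k - y / 2"
  have "k * (x + y / 2) = Re v" "k * (sqrt 3 / 2 * y) = Im v" using k by (simp_all add: x_def y_def)
  then have "v = lattice_point x y" by (simp only: lattice_point_def complex_eq_iff complex.sel k_def)
  then show thesis using that by blast
qed

text \<open>Coordinates of the centers of the \<open>n\<close>-gons, in the lattice spanned by \<open>(3 + sqrt 3) / 6\<close> and its
  rotation by sixty degrees.\<close>

definition circle_site :: "nat \<Rightarrow> int \<Rightarrow> int \<Rightarrow> bool" where
  "circle_site n p q \<longleftrightarrow>
    (if n = 12 then 6 dvd p \<and> 6 dvd q
     else if n = 4 then 3 dvd p \<and> 3 dvd q \<and> \<not> (6 dvd p \<and> 6 dvd q)
     else p mod 6 = 2 \<and> q mod 6 = 2 \<or> p mod 6 = 4 \<and> q mod 6 = 4)"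

lemma circle_site_reflect:
  assumes "circle_site n p q"
  shows "circle_site n (p + q) (- q)" "circle_site n q p" "circle_site n (6 - p - q) q"
proof -
  consider "n = 12" | "n \<noteq> 12" "n = 4" | "n \<noteq> 12" "n \<noteq> 4" by blast
  then have "circle_site n (p + q) (- q) \<and> circle_site n q p \<and> circle_site n (6 - p - q) q"
  proof cases
    case 1
    show ?thesis using assms unfolding circle_site_def if_P[OF 1] by presburger
  next
    case 2
    show ?thesis using assms unfolding circle_site_def if_not_P[OF 2(1)] if_P[OF 2(2)] by presburger
  next
    case 3
    have 2: "(p + q) mod 6 = 4" "(- q) mod 6 = 4" "(6 - p - q) mod 6 = 2"
      if "p mod 6 = 2" "q mod 6 = 2" for p q :: int using that by presburger+
    have 4: "(p + q) mod 6 = 2" "(- q) mod 6 = 2" "(6 - p - q) mod 6 = 4"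
      if "p mod 6 = 4" "q mod 6 = 4" for p q :: int using that by presburger+
    have "p mod 6 = 2 \<and> q mod 6 = 2 \<or> p mod 6 = 4 \<and> q mod 6 = 4"
      using assms unfolding circle_site_def if_not_P[OF 3(1)] if_not_P[OF 3(2)] .
    then show ?thesis
      unfolding circle_site_def if_not_P[OF 3(1)] if_not_P[OF 3(2)]
    proof (elim disjE conjE)
      assume "p mod 6 = 2" "q mod 6 = 2"
      note this 2[OF this]
      then show "((p + q) mod 6 = 2 \<and> - q mod 6 = 2 \<or> (p + q) mod 6 = 4 \<and> - q mod 6 = 4) \<and>
        (q mod 6 = 2 \<and> p mod 6 = 2 \<or> q mod 6 = 4 \<and> p mod 6 = 4) \<and>
        ((6 - p - q) mod 6 = 2 \<and> q mod 6 = 2 \<or> (6 - p - q) mod 6 = 4 \<and> q mod 6 = 4)"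
        by (simp only: simp_thms)
    next
      assume "p mod 6 = 4" "q mod 6 = 4"
      note this 4[OF this]
      then show "((p + q) mod 6 = 2 \<and> - q mod 6 = 2 \<or> (p + q) mod 6 = 4 \<and> - q mod 6 = 4) \<and>
        (q mod 6 = 2 \<and> p mod 6 = 2 \<or> q mod 6 = 4 \<and> p mod 6 = 4) \<and>
        ((6 - p - q) mod 6 = 2 \<and> q mod 6 = 2 \<or> (6 - p - q) mod 6 = 4 \<and> q mod 6 = 4)"
        by (simp only: simp_thms)
    qed
  qed
  then show "circle_site n (p + q) (- q)" "circle_site n q p" "circle_site n (6 - p - q) q" by blast+
qed

text \<open>The residues modulo 6 are an invariant of the three generators; they stand in for a
  description of all group elements.\<close>

lemma circles_on_lattice:
  assumes "g \<in> kaleidoscope" "n \<in> {4, 6, 12}"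
  shows "\<exists>p q. g (center n) = lattice_point (of_int p) (of_int q) \<and> circle_site n p q"
  using assms(1)
proof (induction rule: kaleidoscope.induct)
  case id
  have "center 4 = lattice_point (of_int 3) (of_int 0)" "center 6 = lattice_point (of_int 2) (of_int 2)"
    "center 12 = lattice_point (of_int 0) (of_int 0)"
    by (simp_all add: center_def lattice_point_def complex_eq_iff field_simps)
  moreover have "circle_site 4 3 0" "circle_site 6 2 2" "circle_site 12 0 0" by (simp_all add: circle_site_def)
  ultimately show ?case using assms(2) unfolding id_apply by blast
next
  case (r1 g)
  then obtain p q where "g (center n) = lattice_point (of_int p) (of_int q)" "circle_site n p q" by blast
  then show ?case
    by (intro exI[of _ "p + q"] exI[of _ "- q"]) (simp add: reflect_lattice_point circle_site_reflect)
next
  case (r2 g)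
  then obtain p q where pq: "g (center n) = lattice_point (of_int p) (of_int q)" "circle_site n p q" by blast
  show ?case unfolding comp_apply pq(1) reflect_lattice_point(2) using circle_site_reflect(2)[OF pq(2)] by blast
next
  case (r3 g)
  then obtain p q where pq: "g (center n) = lattice_point (of_int p) (of_int q)" "circle_site n p q" by blast
  show ?case unfolding comp_apply pq(1) reflect_lattice_point(3)
    using circle_site_reflect(3)[OF pq(2)] by (intro exI[of _ "6 - p - q"] exI[of _ q]) simp
qed

lemma abs_less_of_scaled_square:
  fixes x :: real
  assumes "(2 + sqrt 3) * x\<^sup>2 \<le> 8 * r" "8 * r < (2 + sqrt 3) * b\<^sup>2" "0 \<le> b"
  shows "\<bar>x\<bar> < b"
proof -
  have "(2 + sqrt 3) * x\<^sup>2 < (2 + sqrt 3) * b\<^sup>2" using assms by linarith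
  moreover have "0 < 2 + sqrt 3" by (simp add: add_pos_pos)
  ultimately have "x\<^sup>2 < b\<^sup>2" by simp
  then show ?thesis using power2_less_imp_less[of "\<bar>x\<bar>" b] assms(3) by simp
qed

text \<open>A circle around or through the base vertex has its center within one radius of it. This
  leaves a small range for the lattice coordinates, and the congruences select a single center for
  each \<open>n\<close>.\<close>

lemma circles_through_base_vertex:
  assumes "D \<in> circles" "pow_circle D base_vertex \<le> 0"
  shows "\<exists>n\<in>{4, 6, 12}. D = circle id n"
proof -
  obtain g n where g: "g \<in> kaleidoscope" "n \<in> {4, 6, 12}" "D = circle g n"
    using assms(1) by (auto simp: circles_def)
  obtain p q where pq: "g (center n) = lattice_point (of_int p) (of_int q)" "circle_site n p q"
    using circles_on_lattice[OF g(1,2)] by blast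
  have s3: "173 / 100 < sqrt 3" "sqrt 3 < 174 / 100"
    by (rule real_less_rsqrt, simp add: power2_eq_square)
      (rule real_less_lsqrt, simp_all add: power2_eq_square)
  have bv: "base_vertex = lattice_point 2 (sqrt 3 - 1)"
    by (simp add: base_vertex_def lattice_point_def complex_eq_iff field_simps)
  have "(cmod (base_vertex - lattice_point p q))\<^sup>2 \<le> (cmod (spoke n))\<^sup>2"
    using assms(2) by (simp add: g(3) circle_def pow_circle_def pq(1))
  note bound = lattice_point_bound[OF this[unfolded bv lattice_point_diff]]
  \<comment> \<open>\<open>b\<close> is taken to be 11/10, 3/2 and 3, convenient numbers above the
    root of \<open>8 * (cmod (spoke n))\<^sup>2 / (2 + sqrt 3)\<close>.\<close>
  have near: "\<bar>2 - real_of_int p\<bar> < b \<and> \<bar>sqrt 3 - 1 - real_of_int q\<bar> < b"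
    if "8 * (cmod (spoke n))\<^sup>2 < (2 + sqrt 3) * b\<^sup>2" "0 \<le> b" for b
    using abs_less_of_scaled_square[OF bound(1) that] abs_less_of_scaled_square[OF bound(2) that] by blast
  consider "n = 4" | "n = 6" | "n = 12" using g(2) by auto
  then have "g (center n) = center n"
  proof cases
    case 1
    have "\<bar>2 - real_of_int p\<bar> < 11 / 10 \<and> \<bar>sqrt 3 - 1 - real_of_int q\<bar> < 11 / 10"
      using s3 by (intro near, unfold 1 norm_spoke) (simp_all add: power2_eq_square)
    then have "real_of_int p < 4" "0 < real_of_int p" "-1 < real_of_int q" "real_of_int q < 2" using s3 by linarith+
    then have "p < 4" "0 < p" "- 1 < q" "q < 2" by linarith+
    moreover have "3 dvd p" "3 dvd q" using pq(2) by (simp_all add: 1 circle_site_def)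
    ultimately have "p = 3" "q = 0" by presburger+
    then show ?thesis unfolding pq(1) unfolding 1 by (simp add: center_def lattice_point_def complex_eq_iff field_simps)
  next
    case 2
    have "\<bar>2 - real_of_int p\<bar> < 3 / 2 \<and> \<bar>sqrt 3 - 1 - real_of_int q\<bar> < 3 / 2"
      using s3 by (intro near, unfold 2 norm_spoke) (simp_all add: power2_eq_square)
    then have "real_of_int p < 4" "0 < real_of_int p" "-1 < real_of_int q" "real_of_int q < 3" using s3 by linarith+
    then have "p < 4" "0 < p" "- 1 < q" "q < 3" by linarith+
    moreover have "p mod 6 = 2 \<and> q mod 6 = 2 \<or> p mod 6 = 4 \<and> q mod 6 = 4" using pq(2) by (simp_all add: 2 circle_site_def)
    ultimately have "p = 2" "q = 2" by presburger+
    then show ?thesis unfolding pq(1) unfolding 2 by (simp add: center_def lattice_point_def complex_eq_iff field_simps)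
  next
    case 3
    have "\<bar>2 - real_of_int p\<bar> < 3 \<and> \<bar>sqrt 3 - 1 - real_of_int q\<bar> < 3"
      using s3 by (intro near, unfold 3 norm_spoke) (simp_all add: power2_eq_square)
    then have "real_of_int p < 6" "-1 < real_of_int p" "-3 < real_of_int q" "real_of_int q < 4" using s3 by linarith+
    then have "p < 6" "-1 < p" "- 3 < q" "q < 4" by linarith+
    moreover have "6 dvd p" "6 dvd q" using pq(2) by (simp_all add: 3 circle_site_def)
    ultimately have "p = 0" "q = 0" by presburger+
    then show ?thesis unfolding pq(1) unfolding 3 by (simp add: center_def lattice_point_def complex_eq_iff)
  qed
  then have "D = circle id n" by (simp add: g(3) circle_def)
  then show ?thesis using g(2) by blast
qed

lemma circle_id_in_circles: "n \<in> {4, 6, 12} \<Longrightarrow> circle id n \<in> circles"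
  using kaleidoscope.id by (auto simp: circles_def)

lemma pow_circle_base: "pow_circle (circle id n) base_vertex = 0"
  by (simp add: pow_circle_def circle_def spoke_def)

lemma circles_through_vertex:
  assumes g: "g \<in> kaleidoscope" and D: "D \<in> circles" "pow_circle D (g base_vertex) \<le> 0"
  shows "\<exists>n\<in>{4, 6, 12}. D = circle g n"
proof -
  obtain h where h: "h \<in> kaleidoscope" "g \<circ> h = id" "h \<circ> g = id" using kaleidoscope_inverse[OF g] by blast
  then have hg: "h (g x) = x" "g (h x) = x" for x by (metis comp_apply id_apply)+
  have "pow_circle (h (fst D), snd D) (h (g base_vertex)) \<le> 0" using pow_circle_image[OF h(1)] D(2) by simp
  then obtain n where n: "n \<in> {4, 6, 12}" "(h (fst D), snd D) = circle id n"
    using circles_through_base_vertex[OF circles_image[OF h(1) D(1)]] unfolding hg by blast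
  have "D = (g (h (fst D)), snd D)" by (simp add: hg)
  also have "\<dots> = circle g n" using n(2) by (simp add: circle_def)
  finally show ?thesis using n(1) by blast
qed

text \<open>The empty-circle property, as for Delaunay circles: a circle with the vertex inside
  would be one of the three passing through it.\<close>

lemma pow_circle_vertex_nonneg:
  assumes "g \<in> kaleidoscope" "D \<in> circles"
  shows "0 \<le> pow_circle D (g base_vertex)"
proof (rule ccontr)
  assume neg: "\<not> ?thesis"
  then obtain n where "D = circle g n" using circles_through_vertex[OF assms] by auto
  then have "pow_circle D (g base_vertex) = 0"
    using pow_circle_image[OF assms(1), of "circle id n"] pow_circle_base[of n] by (simp add: circle_def)
  then show False using neg by simp
qed

section \<open>The power cells are the regular polygons\<close>

lemma base_cell:
  assumes n: "n \<in> {4, 6, 12}"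
  shows "power_cell circles (circle id n) = ngon n (center n) (spoke n)"
proof -
  have "circle id n = (center n, (cmod (spoke n))\<^sup>2)" by (simp add: circle_def)
  moreover have "0 < 2 + sqrt 3" by (simp add: add_pos_pos)
  then have "0 < (cmod (spoke 4))\<^sup>2" "0 < (cmod (spoke 6))\<^sup>2" "0 < (cmod (spoke 12))\<^sup>2"
    unfolding norm_spoke by simp_all
  then have "0 < (cmod (spoke n))\<^sup>2" using n by blast
  then have "spoke n \<noteq> 0" by auto
  moreover have "3 \<le> n" using n by auto
  ultimately show ?thesis
    using neighbouring_circles[OF n] polygon_vertices_in_orbit[OF n] pow_circle_vertex_nonneg
    by (simp only:) (rule ngon_eq_power_cell; metis)
qed

lemma cell_image:
  assumes g: "g \<in> kaleidoscope"
  shows "power_cell circles (g (fst C), snd C) = g ` power_cell circles C"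
proof -
  obtain h where h: "h \<in> kaleidoscope" "g \<circ> h = id" "h \<circ> g = id" using kaleidoscope_inverse[OF g] by blast
  then have hg: "h (g x) = x" "g (h x) = x" for x by (metis comp_apply id_apply)+
  have sub: "g ` power_cell circles C \<subseteq> power_cell circles (g (fst C), snd C)"
    if g: "g \<in> kaleidoscope" "h \<in> kaleidoscope" "\<And>x. h (g x) = x" "\<And>x. g (h x) = x" for g h C
  proof -
    have "pow_circle (g (fst C), snd C) (g x) \<le> pow_circle D (g x)"
      if "x \<in> power_cell circles C" "D \<in> circles" for x D
    proof -
      have "pow_circle C x \<le> pow_circle (h (fst D), snd D) x"
        using that circles_image[OF g(2)] by (simp add: power_cell_def)
      then show ?thesis
        using pow_circle_image[OF g(1), of "(h (fst D), snd D)" x] pow_circle_image[OF g(1), of C x] by (simp add: g(4))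
    qed
    then show ?thesis by (auto simp: power_cell_def)
  qed
  have "h ` power_cell circles (g (fst C), snd C) \<subseteq> power_cell circles C"
    using sub[OF h(1) g hg(2,1), of "(g (fst C), snd C)"] by (simp add: hg)
  then have "g (h x) \<in> g ` power_cell circles C" if "x \<in> power_cell circles (g (fst C), snd C)" for x
    using that by blast
  then have "power_cell circles (g (fst C), snd C) \<subseteq> g ` power_cell circles C" unfolding hg by blast
  then show ?thesis using sub[OF g h(1) hg] by blast
qed

lemma cell_circle:
  assumes "g \<in> kaleidoscope" "n \<in> {4, 6, 12}"
  shows "power_cell circles (circle g n) = g ` ngon n (center n) (spoke n)"
  using cell_image[OF assms(1), of "circle id n"] base_cell[OF assms(2)] by (simp add: circle_def)

lemma regular_cell:
  assumes "g \<in> kaleidoscope" "n \<in> {4, 6, 12}"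
  shows "regular_polygon n 1 (power_cell circles (circle g n))"
proof -
  have n: "3 \<le> n" using assms(2) by auto
  obtain z where z: "cmod z = cmod (spoke n)" "g ` ngon n (center n) (spoke n) = ngon n (g (center n)) z"
    by (rule kaleidoscope_image_ngon[OF assms(1)])
  \<comment> \<open>The sides of the base tiles that start at the base vertex, as vectors.\<close>
  have "spoke 4 * (root_cis 4 - 1) = - \<i>" "spoke 6 * (root_cis 6 - 1) = 1"
    "spoke 12 * (root_cis 12 - 1) = Complex (-1/2) (sqrt 3 / 2)"
    unfolding spoke_values root_cis_values by (simp_all add: complex_eq_iff field_simps)
  then have "cmod (spoke 4 * (root_cis 4 - 1)) = 1" "cmod (spoke 6 * (root_cis 6 - 1)) = 1"
    "cmod (spoke 12 * (root_cis 12 - 1)) = 1"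
    by (simp_all only:) (simp_all add: cmod_def power2_eq_square)
  then have "cmod (spoke n * (root_cis n - 1)) = 1" using assms(2) by blast
  then have "1 = 2 * cmod z * sin (pi / n)"
    unfolding root_cis_minus_1 norm_mult z(1) using sin_pi_div_pos[of n] n by simp
  moreover from this have "z \<noteq> 0" by auto
  ultimately show ?thesis unfolding cell_circle[OF assms] z(2)
    using n by (subst regular_polygon_iff_ngon) auto
qed

lemma vertex_of_cell:
  assumes "g \<in> kaleidoscope" "n \<in> {4, 6, 12}" "v extreme_point_of power_cell circles (circle g n)"
  obtains h where "h \<in> kaleidoscope" "v = h base_vertex"
proof -
  have n: "0 < n" using assms(2) by auto
  obtain z where z: "g ` ngon n (center n) (spoke n) = ngon n (g (center n)) z"
    "\<And>w. w ^ n = 1 \<Longrightarrow> \<exists>w'. w' ^ n = 1 \<and> g (center n) + z * w = g (center n + spoke n * w')"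
    using kaleidoscope_image_ngon[OF assms(1)] by metis
  obtain w where "w ^ n = 1" "v = g (center n + spoke n * w)"
    using assms(3) z(2) unfolding cell_circle[OF assms(1,2)] z(1) extreme_point_of_ngon_iff[OF n] by metis
  then obtain h where "h \<in> kaleidoscope" "v = g (h base_vertex)"
    using polygon_vertices_in_orbit[OF assms(2)] by metis
  then show thesis using that[OF kaleidoscope_comp[OF assms(1)]] by simp
qed

section \<open>Local finiteness and the tiling property\<close>

lemma finite_circles_below: "finite {D \<in> circles. pow_circle D v \<le> K}"
proof -
  obtain x y where v: "v = lattice_point x y" by (rule lattice_point_surj)
  \<comment> \<open>\<open>M\<close> comes from the crude estimate
    \<open>\<bar>t\<bar> \<le> t\<^sup>2 + 1\<close>, where 4 bounds the squared
    circumradii.\<close>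
  define M where "M = 8 * (K + 4) + 1"
  let ?A = "{\<lfloor>x - M\<rfloor>..\<lceil>x + M\<rceil>} \<times> {\<lfloor>y - M\<rfloor>..\<lceil>y + M\<rceil>} \<times> {4, 6, 12}"
  have "{D \<in> circles. pow_circle D v \<le> K} \<subseteq>
      (\<lambda>(p, q, n). (lattice_point (of_int p) (of_int q), (cmod (spoke n))\<^sup>2)) ` ?A"
  proof
    fix D assume "D \<in> {D \<in> circles. pow_circle D v \<le> K}"
    then obtain g n where g: "g \<in> kaleidoscope" "n \<in> {4, 6, 12}" "D = circle g n" and K: "pow_circle D v \<le> K"
      by (auto simp: circles_def)
    obtain p q where pq: "g (center n) = lattice_point (of_int p) (of_int q)"
      using circles_on_lattice[OF g(1,2)] by blast
    have "sqrt 3 < 2" by (simp add: real_less_lsqrt)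
    then have "(cmod (spoke n))\<^sup>2 \<le> 4" using g(2) norm_spoke by auto
    then have "(cmod (lattice_point (x - p) (y - q)))\<^sup>2 \<le> K + 4"
      using K unfolding g(3) by (simp add: circle_def pow_circle_def pq v lattice_point_diff)
    note b = lattice_point_bound[OF this]
    have abs: "\<bar>t\<bar> \<le> M" if "(2 + sqrt 3) * t\<^sup>2 \<le> 8 * (K + 4)" for t :: real
    proof -
      have "1 * t\<^sup>2 \<le> (2 + sqrt 3) * t\<^sup>2" by (intro mult_right_mono) auto
      moreover have "\<bar>t\<bar> \<le> t\<^sup>2 + 1"
        using zero_le_power2[of "\<bar>t\<bar> - 1"] unfolding power2_diff by simp
      ultimately show ?thesis using that by (simp add: M_def)
    qed
    have "\<bar>x - p\<bar> \<le> M" "\<bar>y - q\<bar> \<le> M" using abs b by blast+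
    then have "(p, q, n) \<in> ?A" using g(2) by (simp add: abs_le_iff) linarith
    moreover have "D = (lattice_point (of_int p) (of_int q), (cmod (spoke n))\<^sup>2)"
      by (simp add: g(3) circle_def pq)
    ultimately show "D \<in> (\<lambda>(p, q, n). (lattice_point (of_int p) (of_int q), (cmod (spoke n))\<^sup>2)) ` ?A"
      by force
  qed
  then show ?thesis by (rule finite_subset) auto
qed

text \<open>Among infinitely many circles a least power need not exist a priori; comparison with one
  fixed circle restricts the search to a finite set.\<close>

lemma cells_cover: "\<exists>C\<in>circles. x \<in> power_cell circles C"
proof -
  define K where "K = pow_circle (circle id 4) x"
  let ?S = "{D \<in> circles. pow_circle D x \<le> K}"
  have "circle id 4 \<in> ?S" using circle_id_in_circles[of 4] by (simp add: K_def)
  then have ne: "?S \<noteq> {}" by blast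
  then obtain C where "is_arg_min (\<lambda>D. pow_circle D x) (\<lambda>D. D \<in> ?S) C"
    using ex_is_arg_min_if_finite[OF finite_circles_below] by blast
  then have C: "C \<in> ?S" "\<And>D. D \<in> ?S \<Longrightarrow> pow_circle C x \<le> pow_circle D x"
    unfolding is_arg_min_linorder by blast+
  have "pow_circle C x \<le> pow_circle D x" if "D \<in> circles" for D
  proof (cases "pow_circle D x \<le> K")
    case True
    then show ?thesis using that by (intro C(2)) simp
  next
    case False
    then show ?thesis using C(1) by simp
  qed
  then show ?thesis using C(1) unfolding power_cell_def by blast
qed

theorem archimedean_4_6_12_exists: "archimedean_4_6_12 (power_cell circles ` circles)"
proof -
  let ?T = "power_cell circles ` circles"
  have tileE: "\<exists>g\<in>kaleidoscope. \<exists>n\<in>{4, 6, 12}. P = power_cell circles (circle g n)" if "P \<in> ?T" for P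
    using that by (auto simp: circles_def)
  have "plane_tiling ?T"
    unfolding plane_tiling_def
  proof (intro conjI ballI impI)
    show "\<Union> ?T = UNIV" using cells_cover by blast
    fix P Q assume "P \<in> ?T" "Q \<in> ?T" "P \<noteq> Q"
    then obtain C D where CD: "C \<in> circles" "D \<in> circles" "P = power_cell circles C" "Q = power_cell circles D" by blast
    show "interior P \<inter> interior Q = {}"
    proof (cases "fst C = fst D")
      case False
      then show ?thesis unfolding CD(3,4) by (rule power_cell_interiors_disjoint[OF CD(1,2)])
    next
      \<comment> \<open>Of two concentric circles the smaller has an empty cell. As all cells are
        nonempty, the circles coincide.\<close>
      case True
      have small: "snd E \<le> snd C" if "E \<in> circles" "fst E = fst C" "x \<in> power_cell circles C" for x C E
        using that by (auto simp: power_cell_def pow_circle_def)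
      have nonempty: "\<exists>x. x \<in> power_cell circles C" if C: "C \<in> circles" for C
      proof -
        obtain g n where g: "g \<in> kaleidoscope" "n \<in> {4, 6, 12}" "C = circle g n" using C by (auto simp: circles_def)
        have "1 ^ n = (1 :: complex)" by simp
        then show ?thesis unfolding g(3) cell_circle[OF g(1,2)] using vertex_in_ngon by blast
      qed
      obtain x y where "x \<in> power_cell circles C" "y \<in> power_cell circles D" using nonempty CD by metis
      then have "snd C = snd D" using small[OF CD(2) True[symmetric]] small[OF CD(1) True] by (metis antisym)
      then have "C = D" using True by (simp add: prod_eq_iff)
      then show ?thesis using \<open>P \<noteq> Q\<close> CD by simp
    qed
  qed
  moreover have "edge_to_edge ?T"
    unfolding edge_to_edge_def
  proof (intro ballI impI)
    fix P Q assume "P \<in> ?T" "Q \<in> ?T"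
    then obtain C D where CD: "C \<in> circles" "D \<in> circles" "P = power_cell circles C" "Q = power_cell circles D" by blast
    show "(P \<inter> Q) face_of P \<and> (P \<inter> Q) face_of Q"
      unfolding CD(3,4) using power_cell_Int_face[OF CD(1,2)] power_cell_Int_face[OF CD(2,1)]
      by (simp only: Int_commute)
  qed
  moreover have "\<exists>n\<in>{4, 6, 12}. regular_polygon n 1 P" if "P \<in> ?T" for P
    using tileE[OF that] regular_cell by metis
  moreover have "\<exists>!P. P \<in> ?T \<and> regular_polygon n 1 P \<and> v \<in> P"
    if v: "v \<in> tiling_vertices ?T" and n: "n \<in> {4, 6, 12}" for v n
  proof -
    obtain P where P: "P \<in> ?T" "v extreme_point_of P" using v by (auto simp: tiling_vertices_def)
    then obtain g where g: "g \<in> kaleidoscope" "v = g base_vertex"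
      using tileE[OF P(1)] vertex_of_cell by metis
    have pow0: "pow_circle (circle g m) v = 0" for m
      using pow_circle_image[OF g(1), of "circle id m" base_vertex] pow_circle_base[of m]
      by (simp add: circle_def g(2))
    have mem: "circle g m \<in> circles" if "m \<in> {4, 6, 12}" for m using that g(1) by (auto simp: circles_def)
    show ?thesis
    proof (rule ex1I[of _ "power_cell circles (circle g n)"], intro conjI)
      show "power_cell circles (circle g n) \<in> ?T" using mem[OF n] by blast
      show "regular_polygon n 1 (power_cell circles (circle g n))" by (rule regular_cell[OF g(1) n])
      show "v \<in> power_cell circles (circle g n)"
        using pow_circle_vertex_nonneg[OF g(1)] by (simp add: power_cell_def pow0) (simp add: g(2))
    next
      fix Q assume Q: "Q \<in> ?T \<and> regular_polygon n 1 Q \<and> v \<in> Q"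
      then obtain D where D: "D \<in> circles" "Q = power_cell circles D" by blast
      \<comment> \<open>The vertex has power 0 for a known circle, so a cell containing it belongs
        to a circle of nonpositive power there, that is, to one of the three around this
        vertex.\<close>
      then have "pow_circle D v \<le> pow_circle (circle g 4) v" using Q mem[of 4] by (auto simp: power_cell_def)
      then have "pow_circle D (g base_vertex) \<le> 0" by (simp add: pow0 flip: g(2))
      then obtain m where m: "m \<in> {4, 6, 12}" "D = circle g m"
        using circles_through_vertex[OF g(1) D(1)] by blast
      have "regular_polygon m 1 Q" unfolding D(2) m(2) by (rule regular_cell[OF g(1) m(1)])
      then have "m = n" using Q regular_polygon_sides_unique[of m n 1 Q] m(1) n by auto
      then show "Q = power_cell circles (circle g n)" using D m by simp
    qed
  qed
  ultimately show ?thesis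
    unfolding archimedean_4_6_12_def by (intro conjI exI[of _ 1] ballI)
qed

theorem mainTheorem4:
  shows "simple_graph triad_graph
    \<and> card major_triads = 12 \<and> card minor_triads = 12
    \<and> bipartite_with triad_graph major_triads minor_triads
    \<and> regular_of_degree triad_graph 3
    \<and> card (components_of triad_graph) = 2
    \<and> (\<forall>G\<in>components_of triad_graph.
          card (verts G \<inter> major_triads) = 6 \<and> card (verts G \<inter> minor_triads) = 6
        \<and> girth G = 4
        \<and> \<not> is_levi_graph G)
    \<and> (\<exists>T. archimedean_4_6_12 T)
    \<and> (\<forall>T. archimedean_4_6_12 T \<longrightarrow>
          (\<forall>G\<in>components_of triad_graph. \<exists>f. covering_map f (tiling_graph T) G))"
proof (intro conjI ballI allI impI)
  fix G assume "G \<in> components_of triad_graph"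
  then obtain p where G: "G = induced_subgraph triad_graph (triad_class p)"
    unfolding components_triad_graph by blast
  then have "verts G = triad_class p" by (simp add: induced_subgraph_def)
  then show "card (verts G \<inter> major_triads) = 6" "card (verts G \<inter> minor_triads) = 6"
    by (simp_all only: card_class_Int)
  show "girth G = 4" unfolding G by (rule girth_class)
  show "\<not> is_levi_graph G" unfolding G by (rule class_not_levi)
  fix T assume "archimedean_4_6_12 T"
  then obtain s where T: "plane_tiling T" "edge_to_edge T"
    "\<forall>P\<in>T. \<exists>n\<in>{4, 6, 12}. regular_polygon n s P"
    "\<forall>v\<in>tiling_vertices T. \<forall>n\<in>{4, 6, 12}. \<exists>!P. P \<in> T \<and> regular_polygon n s P \<and> v \<in> P"
    unfolding archimedean_4_6_12_def by (elim conjE exE)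
  have "tiling_4_6_12 T s"
    by (rule tiling_4_6_12.intro[OF T(1,2) bspec[OF T(3)] bspec[OF bspec[OF T(4)]]])
  then show "\<exists>f. covering_map f (tiling_graph T) G"
    unfolding G using tiling_4_6_12.covering_triad_component by blast
next
  show "\<exists>T. archimedean_4_6_12 T" using archimedean_4_6_12_exists by blast
qed (fact simple_triad_graph card_triads bipartite_triad_graph regular_triad_graph
    card_components_triad_graph)+

end
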